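(* Let $\mathcal M$ be a discretely ordered ring and $x^y\colon M^+\times M^+\to M^+$ a function. Then $(\mathcal M^+,x^y)$ (with $S(x)$ interpreted as $x+1$) is a model of $\mathsf{IOpen}+\mathsf{T_{x^y}}$ if and only if there is an exponential field $(\mathcal R,\exp)$ such that $(\mathcal M,x^y)$ is an $x^y$-integer part of $(\mathcal R,\exp)$, $\mathcal R$ is a real closed field, and $(\mathcal R,\exp)$ satisfies $\varphi_{Bern}$: for all $x>0$ and all $y\geqslant1$, $(1+x)^y\geqslant 1+xy$, where $(1+x)^y:=\exp(y\log(1+x))$.
   Context: An exponential field is an ordered field $\mathcal F$ with a map $\exp\colon F\to F^{>0}$ that is an order-preserving isomorphism from $(F,+)$ onto $(F^{>0},\cdot)$; $\log$ is its inverse. A discretely ordered ring is an ordered (commutative unital) ring in which $1$ is the least positive element; $M^+=\{m\in M:m\geqslant0\}$. If $\mathcal M\subseteq\mathcal R$ with $\mathcal M$ discretely ordered, $\mathcal M$ is an integer part of $\mathcal R$ if for each $r\in R$ there is $m\in M$ with $m\leqslant r<m+1$. $(\mathcal M,x^y)$ is an $x^y$-integer part of $(\mathcal R,\exp)$ if $\mathcal M$ is an integer part of $\mathcal R$ and $n^m=\exp(m\log n)$ for all $n,m\in M^+$ with $n>0$, $0^0=1$, and $0^m=0$ for $m\in M^{>0}$. $\mathsf{IOpen}$ is the theory in the language $(0,S,+,\cdot,\leqslant)$ consisting of (Q1) $Sx\neq0$; (Q2) $Sx=Sy\to x=y$; (Q3) $x\neq0\to\exists y\,(x=Sy)$; (Q4)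 $x+0=x$; (Q5) $x+Sy=S(x+y)$; (Q6) $x\cdot0=0$; (Q7) $x\cdot Sy=x\cdot y+x$; (Q8) $x\leqslant y\leftrightarrow\exists r\,(r+x=y)$; and induction for all quantifier-free formulas of the language $(0,S,+,\cdot,\leqslant)$ (formulas not involving $x^y$). $\mathsf{T_{x^y}}$ is the theory in the language $(0,S,+,\cdot,\leqslant,x^y)$, with $1=S(0)$, $2=S(S(0))$, consisting of: (T1) $x^0=1$; (T2) $x^1=x$; (T3) $1^x=1$; (T4) $x^{y+z}=x^y\cdot x^z$; (T5) $(x\cdot y)^z=x^z\cdot y^z$; (T6) $(x^y)^z=x^{yz}$; (T7) $\forall x>1\,(y<z\leftrightarrow x^y<x^z)$; (T8) $\forall x>0\,(y<z\leftrightarrow y^x<z^x)$; (T9) $\forall k>0\,\exists d\,(2^d\leqslant k<2^{d+1})$; (T10) $\forall c>0\,\exists m\,(m^c\leqslant x<(m+1)^c)$; (T11) $\forall a>0\,\forall b>0\,\forall y>0\,\forall x\geqslant y\,\big((b+a)^x(by)^y\geqslant(by+ax)^y b^x\big)$. *)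

theory Defs
  imports "HOL-Algebra.Polynomials"
begin

section \<open>Discretely ordered rings\<close>

text \<open>
  Building on \<^class>\<open>linordered_idom\<close> loses no generality: in an ordered commutative ring whose
  least positive element is 1, \<open>0 < a\<close> and \<open>0 < b\<close> give \<open>1 \<le> a\<close>, hence \<open>0 < b \<le> a * b\<close>, so there
  are no zero divisors; \<open>\<bar>_\<bar>\<close> and \<open>sgn\<close> are determined by the order.
\<close>

class discretely_ordered_ring = linordered_idom +
  assumes one_least_positive: "0 < x \<Longrightarrow> 1 \<le> x"


section \<open>The theories \<open>IOpen\<close> and \<open>T_xy\<close>\<close>

record 'a arith_structure =
  universe :: "'a set"
  arith_zero :: 'a  (\<open>\<^bold>0\<index>\<close>)
  arith_suc :: "'a \<Rightarrow> 'a"  (\<open>\<^bold>S\<index>\<close>)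
  arith_add :: "'a \<Rightarrow> 'a \<Rightarrow> 'a"  (infixl \<open>\<^bold>+\<index>\<close> 65)
  arith_mult :: "'a \<Rightarrow> 'a \<Rightarrow> 'a"  (infixl \<open>\<^bold>*\<index>\<close> 70)
  arith_le :: "'a \<Rightarrow> 'a \<Rightarrow> bool"  (infix \<open>\<^bold>\<le>\<index>\<close> 50)

record 'a arith_exp_structure = "'a arith_structure" +
  arith_power :: "'a \<Rightarrow> 'a \<Rightarrow> 'a"  (infixr \<open>\<^bold>^\<index>\<close> 80)

definition arith_less :: "('a, 'm) arith_structure_scheme \<Rightarrow> 'a \<Rightarrow> 'a \<Rightarrow> bool"
    (infix \<open>\<^bold><\<index>\<close> 50) where
  "x \<^bold><\<^bsub>A\<^esub> y \<longleftrightarrow> x \<^bold>\<le>\<^bsub>A\<^esub> y \<and> x \<noteq> y"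

abbreviation arith_one :: "('a, 'm) arith_structure_scheme \<Rightarrow> 'a"  (\<open>\<^bold>1\<index>\<close>) where
  "\<^bold>1\<^bsub>A\<^esub> \<equiv> \<^bold>S\<^bsub>A\<^esub> \<^bold>0\<^bsub>A\<^esub>"

abbreviation arith_two :: "('a, 'm) arith_structure_scheme \<Rightarrow> 'a"  (\<open>\<^bold>2\<index>\<close>) where
  "\<^bold>2\<^bsub>A\<^esub> \<equiv> \<^bold>S\<^bsub>A\<^esub> (\<^bold>S\<^bsub>A\<^esub> \<^bold>0\<^bsub>A\<^esub>)"

text \<open>Terms and quantifier-free formulas of the language \<open>(0, S, +, \<cdot>, \<le>)\<close>, without \<open>x^y\<close>.\<close>

datatype arith_term =
    TVar nat
  | TZero
  | TSuc arith_term
  | TAdd arith_term arith_term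
  | TMult arith_term arith_term

datatype qf_formula =
    FEq arith_term arith_term
  | FLe arith_term arith_term
  | FNot qf_formula
  | FAnd qf_formula qf_formula
  | FOr qf_formula qf_formula
  | FImp qf_formula qf_formula

primrec term_val :: "('a, 'm) arith_structure_scheme \<Rightarrow> (nat \<Rightarrow> 'a) \<Rightarrow> arith_term \<Rightarrow> 'a" where
  "term_val A e (TVar i) = e i"
| "term_val A e TZero = \<^bold>0\<^bsub>A\<^esub>"
| "term_val A e (TSuc s) = \<^bold>S\<^bsub>A\<^esub> (term_val A e s)"
| "term_val A e (TAdd s t) = term_val A e s \<^bold>+\<^bsub>A\<^esub> term_val A e t"
| "term_val A e (TMult s t) = term_val A e s \<^bold>*\<^bsub>A\<^esub> term_val A e t"

primrec qf_sat :: "('a, 'm) arith_structure_scheme \<Rightarrow> (nat \<Rightarrow> 'a) \<Rightarrow> qf_formula \<Rightarrow> bool" where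
  "qf_sat A e (FEq s t) \<longleftrightarrow> term_val A e s = term_val A e t"
| "qf_sat A e (FLe s t) \<longleftrightarrow> term_val A e s \<^bold>\<le>\<^bsub>A\<^esub> term_val A e t"
| "qf_sat A e (FNot p) \<longleftrightarrow> \<not> qf_sat A e p"
| "qf_sat A e (FAnd p q) \<longleftrightarrow> qf_sat A e p \<and> qf_sat A e q"
| "qf_sat A e (FOr p q) \<longleftrightarrow> qf_sat A e p \<or> qf_sat A e q"
| "qf_sat A e (FImp p q) \<longleftrightarrow> (qf_sat A e p \<longrightarrow> qf_sat A e q)"

text \<open>
  In \<open>open_induction\<close> the formula \<open>p\<close> is arbitrary, \<open>v\<close> is its induction variable and the
  environment \<open>e\<close> supplies the parameters.
\<close>

locale IOpen_model =
  fixes A :: "('a, 'm) arith_structure_scheme" (structure)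
  assumes Q1: "\<forall>x\<in>universe A. \<^bold>S x \<noteq> \<^bold>0"
    and Q2: "\<forall>x\<in>universe A. \<forall>y\<in>universe A. \<^bold>S x = \<^bold>S y \<longrightarrow> x = y"
    and Q3: "\<forall>x\<in>universe A. x \<noteq> \<^bold>0 \<longrightarrow> (\<exists>y\<in>universe A. x = \<^bold>S y)"
    and Q4: "\<forall>x\<in>universe A. x \<^bold>+ \<^bold>0 = x"
    and Q5: "\<forall>x\<in>universe A. \<forall>y\<in>universe A. x \<^bold>+ \<^bold>S y = \<^bold>S (x \<^bold>+ y)"
    and Q6: "\<forall>x\<in>universe A. x \<^bold>* \<^bold>0 = \<^bold>0"
    and Q7: "\<forall>x\<in>universe A. \<forall>y\<in>universe A. x \<^bold>* \<^bold>S y = x \<^bold>* y \<^bold>+ x"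
    and Q8: "\<forall>x\<in>universe A. \<forall>y\<in>universe A. x \<^bold>\<le> y \<longleftrightarrow> (\<exists>r\<in>universe A. r \<^bold>+ x = y)"
    and open_induction:
      "\<forall>p v e. (\<forall>i. e i \<in> universe A) \<longrightarrow>
         qf_sat A (e(v := \<^bold>0)) p \<longrightarrow>
         (\<forall>x\<in>universe A. qf_sat A (e(v := x)) p \<longrightarrow> qf_sat A (e(v := \<^bold>S x)) p) \<longrightarrow>
         (\<forall>x\<in>universe A. qf_sat A (e(v := x)) p)"

locale T_xy_model =
  fixes A :: "('a, 'm) arith_exp_structure_scheme" (structure)
  assumes T1: "\<forall>x\<in>universe A. x \<^bold>^ \<^bold>0 = \<^bold>1"
    and T2: "\<forall>x\<in>universe A. x \<^bold>^ \<^bold>1 = x"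
    and T3: "\<forall>x\<in>universe A. \<^bold>1 \<^bold>^ x = \<^bold>1"
    and T4: "\<forall>x\<in>universe A. \<forall>y\<in>universe A. \<forall>z\<in>universe A.
               x \<^bold>^ (y \<^bold>+ z) = (x \<^bold>^ y) \<^bold>* (x \<^bold>^ z)"
    and T5: "\<forall>x\<in>universe A. \<forall>y\<in>universe A. \<forall>z\<in>universe A.
               (x \<^bold>* y) \<^bold>^ z = (x \<^bold>^ z) \<^bold>* (y \<^bold>^ z)"
    and T6: "\<forall>x\<in>universe A. \<forall>y\<in>universe A. \<forall>z\<in>universe A.
               (x \<^bold>^ y) \<^bold>^ z = x \<^bold>^ (y \<^bold>* z)"
    and T7: "\<forall>x\<in>universe A. \<forall>y\<in>universe A. \<forall>z\<in>universe A. \<^bold>1 \<^bold>< x \<longrightarrow>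
               (y \<^bold>< z \<longleftrightarrow> x \<^bold>^ y \<^bold>< x \<^bold>^ z)"
    and T8: "\<forall>x\<in>universe A. \<forall>y\<in>universe A. \<forall>z\<in>universe A. \<^bold>0 \<^bold>< x \<longrightarrow>
               (y \<^bold>< z \<longleftrightarrow> y \<^bold>^ x \<^bold>< z \<^bold>^ x)"
    and T9: "\<forall>k\<in>universe A. \<^bold>0 \<^bold>< k \<longrightarrow>
               (\<exists>d\<in>universe A. \<^bold>2 \<^bold>^ d \<^bold>\<le> k \<and> k \<^bold>< \<^bold>2 \<^bold>^ (d \<^bold>+ \<^bold>1))"
    and T10: "\<forall>x\<in>universe A. \<forall>c\<in>universe A. \<^bold>0 \<^bold>< c \<longrightarrow>
               (\<exists>m\<in>universe A. m \<^bold>^ c \<^bold>\<le> x \<and> x \<^bold>< (m \<^bold>+ \<^bold>1) \<^bold>^ c)"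
    and T11: "\<forall>a\<in>universe A. \<forall>b\<in>universe A. \<forall>y\<in>universe A. \<forall>x\<in>universe A.
               \<^bold>0 \<^bold>< a \<longrightarrow> \<^bold>0 \<^bold>< b \<longrightarrow> \<^bold>0 \<^bold>< y \<longrightarrow> y \<^bold>\<le> x \<longrightarrow>
               ((b \<^bold>* y \<^bold>+ a \<^bold>* x) \<^bold>^ y) \<^bold>* (b \<^bold>^ x)
                 \<^bold>\<le> ((b \<^bold>+ a) \<^bold>^ x) \<^bold>* ((b \<^bold>* y) \<^bold>^ y)"

definition nonneg_part ::
    "('a::discretely_ordered_ring \<Rightarrow> 'a \<Rightarrow> 'a) \<Rightarrow> 'a arith_exp_structure" where
  "nonneg_part pw =
     \<lparr>universe = {m. 0 \<le> m}, arith_zero = 0, arith_suc = (\<lambda>x. x + 1),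
      arith_add = (+), arith_mult = (*), arith_le = (\<le>), arith_power = pw\<rparr>"


section \<open>Ordered fields, exponential fields and integer parts\<close>

text \<open>Carrier-based, because the theorem quantifies existentially over such fields.\<close>

record 'r ordered_ring = "'r ring" +
  ring_le :: "'r \<Rightarrow> 'r \<Rightarrow> bool"  (infix \<open>\<preceq>\<index>\<close> 50)

definition ring_less :: "('r, 'm) ordered_ring_scheme \<Rightarrow> 'r \<Rightarrow> 'r \<Rightarrow> bool"
    (infix \<open>\<prec>\<index>\<close> 50) where
  "x \<prec>\<^bsub>R\<^esub> y \<longleftrightarrow> x \<preceq>\<^bsub>R\<^esub> y \<and> x \<noteq> y"

definition positives :: "('r, 'm) ordered_ring_scheme \<Rightarrow> 'r set" where
  "positives R = {x \<in> carrier R. \<zero>\<^bsub>R\<^esub> \<prec>\<^bsub>R\<^esub> x}"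

locale linearly_ordered_field = field R
  for R :: "('r, 'm) ordered_ring_scheme" (structure) +
  assumes le_refl: "x \<in> carrier R \<Longrightarrow> x \<preceq> x"
    and le_antisym: "\<lbrakk>x \<in> carrier R; y \<in> carrier R; x \<preceq> y; y \<preceq> x\<rbrakk> \<Longrightarrow> x = y"
    and le_trans: "\<lbrakk>x \<in> carrier R; y \<in> carrier R; z \<in> carrier R; x \<preceq> y; y \<preceq> z\<rbrakk> \<Longrightarrow> x \<preceq> z"
    and le_total: "\<lbrakk>x \<in> carrier R; y \<in> carrier R\<rbrakk> \<Longrightarrow> x \<preceq> y \<or> y \<preceq> x"
    and le_add: "\<lbrakk>x \<in> carrier R; y \<in> carrier R; z \<in> carrier R; x \<preceq> y\<rbrakk> \<Longrightarrow> x \<oplus> z \<preceq> y \<oplus> z"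
    and le_mult: "\<lbrakk>x \<in> carrier R; y \<in> carrier R; \<zero> \<preceq> x; \<zero> \<preceq> y\<rbrakk> \<Longrightarrow> \<zero> \<preceq> x \<otimes> y"

locale real_closed_field = linearly_ordered_field +
  assumes sqrt_exists:
      "\<lbrakk>x \<in> carrier R; \<zero> \<preceq> x\<rbrakk> \<Longrightarrow> \<exists>y\<in>carrier R. y \<otimes> y = x"
    and odd_degree_root:
      "\<lbrakk>polynomial (carrier R) p; odd (degree p)\<rbrakk> \<Longrightarrow> \<exists>x\<in>carrier R. eval p x = \<zero>"

locale exponential_field = linearly_ordered_field +
  fixes E :: "'a \<Rightarrow> 'a"
  assumes exp_bij: "bij_betw E (carrier R) (positives R)"
    and exp_add: "\<lbrakk>x \<in> carrier R; y \<in> carrier R\<rbrakk> \<Longrightarrow> E (x \<oplus> y) = E x \<otimes> E y"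
    and exp_mono: "\<lbrakk>x \<in> carrier R; y \<in> carrier R; x \<preceq> y\<rbrakk> \<Longrightarrow> E x \<preceq> E y"

definition exp_field_log :: "('r, 'm) ordered_ring_scheme \<Rightarrow> ('r \<Rightarrow> 'r) \<Rightarrow> 'r \<Rightarrow> 'r" where
  "exp_field_log R E = inv_into (carrier R) E"

definition exp_field_power ::
    "('r, 'm) ordered_ring_scheme \<Rightarrow> ('r \<Rightarrow> 'r) \<Rightarrow> 'r \<Rightarrow> 'r \<Rightarrow> 'r" where
  "exp_field_power R E x y = E (y \<otimes>\<^bsub>R\<^esub> exp_field_log R E x)"

text \<open>The inclusion of \<open>M\<close> into \<open>R\<close> as an ordered subring is rendered by an embedding \<open>\<iota>\<close>.\<close>

definition ordered_ring_embedding ::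
    "('r, 'm) ordered_ring_scheme \<Rightarrow> ('a::discretely_ordered_ring \<Rightarrow> 'r) \<Rightarrow> bool" where
  "ordered_ring_embedding R \<iota> \<longleftrightarrow>
     (\<forall>x. \<iota> x \<in> carrier R) \<and>
     \<iota> 0 = \<zero>\<^bsub>R\<^esub> \<and> \<iota> 1 = \<one>\<^bsub>R\<^esub> \<and>
     (\<forall>x y. \<iota> (x + y) = \<iota> x \<oplus>\<^bsub>R\<^esub> \<iota> y) \<and>
     (\<forall>x y. \<iota> (x * y) = \<iota> x \<otimes>\<^bsub>R\<^esub> \<iota> y) \<and>
     (\<forall>x y. x \<le> y \<longleftrightarrow> \<iota> x \<preceq>\<^bsub>R\<^esub> \<iota> y)"

definition integer_part ::
    "('r, 'm) ordered_ring_scheme \<Rightarrow> ('a::discretely_ordered_ring \<Rightarrow> 'r) \<Rightarrow> bool" where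
  "integer_part R \<iota> \<longleftrightarrow>
     ordered_ring_embedding R \<iota> \<and>
     (\<forall>r\<in>carrier R. \<exists>m. \<iota> m \<preceq>\<^bsub>R\<^esub> r \<and> r \<prec>\<^bsub>R\<^esub> \<iota> (m + 1))"

definition xy_integer_part ::
    "('r, 'm) ordered_ring_scheme \<Rightarrow> ('r \<Rightarrow> 'r) \<Rightarrow>
     ('a::discretely_ordered_ring \<Rightarrow> 'a \<Rightarrow> 'a) \<Rightarrow> ('a \<Rightarrow> 'r) \<Rightarrow> bool" where
  "xy_integer_part R E pw \<iota> \<longleftrightarrow>
     integer_part R \<iota> \<and>
     (\<forall>n m. 0 < n \<longrightarrow> 0 \<le> m \<longrightarrow> \<iota> (pw n m) = exp_field_power R E (\<iota> n) (\<iota> m)) \<and>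
     pw 0 0 = 1 \<and>
     (\<forall>m>0. pw 0 m = 0)"

definition Bernoulli_inequality ::
    "('r, 'm) ordered_ring_scheme \<Rightarrow> ('r \<Rightarrow> 'r) \<Rightarrow> bool" where
  "Bernoulli_inequality R E \<longleftrightarrow>
     (\<forall>x\<in>carrier R. \<forall>y\<in>carrier R. \<zero>\<^bsub>R\<^esub> \<prec>\<^bsub>R\<^esub> x \<longrightarrow> \<one>\<^bsub>R\<^esub> \<preceq>\<^bsub>R\<^esub> y \<longrightarrow>
        \<one>\<^bsub>R\<^esub> \<oplus>\<^bsub>R\<^esub> x \<otimes>\<^bsub>R\<^esub> y \<preceq>\<^bsub>R\<^esub> exp_field_power R E (\<one>\<^bsub>R\<^esub> \<oplus>\<^bsub>R\<^esub> x) y)"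

text \<open>
  HOL cannot quantify existentially over types, so \<open>\<exists>R\<close> needs a fixed type of elements. The type
  \<open>('a \<times> 'a) set\<close> suffices for every \<open>R\<close> with integer part \<open>\<iota> :: 'a \<Rightarrow> R\<close>: the fractions of
  \<open>\<iota> ` M\<close> are dense in \<open>R\<close>, so \<open>r \<mapsto> {(a, b). 0 < b \<and> \<iota> a \<prec> r \<otimes> \<iota> b}\<close> is injective and any such
  \<open>R\<close> has an isomorphic copy on that type.
\<close>

end

theory Submission
  imports Defs "HOL-Algebra.Algebraic_Closure_Type"
begin

text \<open>
  Given the exponential field \<open>R\<close>, the fractions of \<open>M\<close> are dense in \<open>R\<close>, so \<open>R\<close> embeds into the
  Cauchy completion of the fraction field of \<open>M\<close>. Its image is real closed, hence by Laplace's
  argument polynomials over it have the intermediate value property; so an atomic formula in one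
  variable changes its truth value at finitely many points, and taking integer parts of these points
  gives open induction. The axioms about \<open>x\<^sup>y\<close> are read off from the exponential laws.

  Conversely, \<open>R\<close> is the Cauchy completion itself. Open induction on finer and finer grids gives
  arguments where a polynomial \<open>p\<close> with a sign change is arbitrarily small; if \<open>p\<close> is coprime to
  \<open>p'\<close>, then \<open>p'\<close> is bounded away from 0 there, so these arguments converge to a root, and the
  general case follows by factoring. The binary logarithm of \<open>n\<close> is the cut of the fractions
  \<open>d / b\<close> with \<open>2\<^sup>d \<le> n\<^sup>b\<close>, and the exponential is the cut that inverts it. Both cuts are filled
  because of (T9), (T10) and the estimates \<open>1 / n \<le> log (1 + 1 / n)\<close> and
  \<open>log (1 + 1 / (2 c)) \<le> 1 / c\<close>, which are instances of (T11).
\<close>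

section \<open>The Cauchy completion of an ordered field\<close>

text \<open>\<open>M\<close> may be nonstandard, so the fields around it are in general
  non-archimedean and bounded sets need not have suprema. What the completion does provide is a
  point in every cut whose two sides come arbitrarily close. Hence each root, logarithm or
  exponential is caught between fractions with a prescribed gap, and two elements are shown to be
  equal by bounding their difference by \<open>k / c\<close>, with a fixed \<open>k\<close>, for
  every positive \<open>c\<close> of \<open>M\<close>. The lack of suprema also shapes the root
  argument. Near a multiple root \<open>p\<close> is flat, small values of \<open>p\<close> do not
  confine the argument, and approximate roots need not converge; the derivative and Bezout's
  identity exclude this. Base 2 comes from (T9), which provides integer parts of binary logarithms.
  Bernoulli's inequality mentions powers only, and these do not depend on the base. In the direction
  from fields to models, the embedding has a further purpose: a field given by a carrier becomes a
  subset of a type, where the theory of polynomials over types applies.\<close>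

text \<open>
  Functions of \<open>\<epsilon> \<rightarrow> 0+\<close> replace Cauchy sequences, because the field may have uncountable cofinality.
\<close>

definition zero_right :: "'k::linordered_field filter" where
  "zero_right = (INF d\<in>{0<..}. principal {0<..<d})"

lemma eventually_zero_right:
  "eventually P zero_right \<longleftrightarrow> (\<exists>d>0. \<forall>x::'k::linordered_field. 0 < x \<longrightarrow> x < d \<longrightarrow> P x)"
  unfolding zero_right_def
proof (subst eventually_INF_base)
  show "{0::'k<..} \<noteq> {}" using zero_less_one by blast
  show "\<exists>x\<in>{0<..}. principal {0<..<x} \<le> inf (principal {0<..<a}) (principal {0<..<b})"
    if "a \<in> {0<..}" "b \<in> {0<..}" for a b :: 'k
    using that by (intro bexI[of _ "min a b"]) auto
qed (auto simp: eventually_principal Bex_def)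

lemma zero_right_neq_bot: "zero_right \<noteq> (bot :: 'k::linordered_field filter)"
proof
  assume "zero_right = (bot :: 'k filter)"
  then have "eventually (\<lambda>_::'k. False) zero_right" by simp
  then obtain d :: 'k where "d > 0" "\<forall>x. 0 < x \<longrightarrow> x < d \<longrightarrow> False"
    unfolding eventually_zero_right by blast
  then show False using dense by blast
qed

lemma eventually_const_zero_right [simp]:
  "(\<forall>\<^sub>F _ in (zero_right :: 'k::linordered_field filter). P) \<longleftrightarrow> P"
  using zero_right_neq_bot by (rule eventually_const)

text \<open>Values near 0 are compared with a constant of the field instead of with each other. Up
  to a factor 2 in \<open>e\<close> this is the usual Cauchy condition, with a single condition
  along the filter.\<close>

definition cauchy_fun :: "('k::linordered_field \<Rightarrow> 'k) \<Rightarrow> bool" where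
  "cauchy_fun f \<longleftrightarrow> (\<forall>e>0. \<exists>c. \<forall>\<^sub>F x in zero_right. \<bar>f x - c\<bar> < e)"

definition null_fun :: "('k::linordered_field \<Rightarrow> 'k) \<Rightarrow> bool" where
  "null_fun f \<longleftrightarrow> (\<forall>e>0. \<forall>\<^sub>F x in zero_right. \<bar>f x\<bar> < e)"

lemma cauchy_funD: "cauchy_fun f \<Longrightarrow> 0 < e \<Longrightarrow> \<exists>c. \<forall>\<^sub>F x in zero_right. \<bar>f x - c\<bar> < e"
  by (simp add: cauchy_fun_def)

lemma null_funD: "null_fun f \<Longrightarrow> 0 < e \<Longrightarrow> \<forall>\<^sub>F x in zero_right. \<bar>f x\<bar> < e"
  by (simp add: null_fun_def)

lemma cauchy_fun_const: "cauchy_fun (\<lambda>_. c)"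
  unfolding cauchy_fun_def by (auto intro!: exI[of _ c])

lemma cauchy_fun_add:
  assumes "cauchy_fun f" "cauchy_fun g"
  shows "cauchy_fun (\<lambda>x. f x + g x)"
  unfolding cauchy_fun_def
proof safe
  fix e :: 'a assume "e > 0"
  then have "e / 2 > 0" by simp
  then obtain c d where "\<forall>\<^sub>F x in zero_right. \<bar>f x - c\<bar> < e / 2" "\<forall>\<^sub>F x in zero_right. \<bar>g x - d\<bar> < e / 2"
    using assms cauchy_funD by metis
  then have "\<forall>\<^sub>F x in zero_right. \<bar>f x + g x - (c + d)\<bar> < e"
    by eventually_elim (simp add: abs_if field_simps split: if_splits)
  then show "\<exists>c. \<forall>\<^sub>F x in zero_right. \<bar>f x + g x - c\<bar> < e" ..
qed

lemma cauchy_fun_minus: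
  assumes "cauchy_fun f"
  shows "cauchy_fun (\<lambda>x. - f x)"
  unfolding cauchy_fun_def
proof safe
  fix e :: 'a assume "e > 0"
  then obtain c where "\<forall>\<^sub>F x in zero_right. \<bar>f x - c\<bar> < e"
    using assms cauchy_funD by metis
  then have "\<forall>\<^sub>F x in zero_right. \<bar>- f x - - c\<bar> < e"
    by eventually_elim (simp add: abs_if field_simps split: if_splits)
  then show "\<exists>c. \<forall>\<^sub>F x in zero_right. \<bar>- f x - c\<bar> < e" ..
qed

lemma cauchy_fun_diff: "cauchy_fun f \<Longrightarrow> cauchy_fun g \<Longrightarrow> cauchy_fun (\<lambda>x. f x - g x)"
  using cauchy_fun_add[OF _ cauchy_fun_minus, of f g] by simp

lemma cauchy_fun_bounded:
  assumes "cauchy_fun f"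
  shows "\<exists>b>0. \<forall>\<^sub>F x in zero_right. \<bar>f x\<bar> < b"
proof -
  obtain c where "\<forall>\<^sub>F x in zero_right. \<bar>f x - c\<bar> < 1"
    using cauchy_funD[OF assms, of 1] by auto
  then have "\<forall>\<^sub>F x in zero_right. \<bar>f x\<bar> < \<bar>c\<bar> + 1"
    by eventually_elim (simp add: abs_if split: if_splits)
  then show ?thesis by (intro exI[of _ "\<bar>c\<bar> + 1"]) auto
qed

lemma cauchy_fun_mult:
  assumes "cauchy_fun f" "cauchy_fun g"
  shows "cauchy_fun (\<lambda>x. f x * g x)"
  unfolding cauchy_fun_def
proof safe
  fix e :: 'a assume e: "e > 0"
  obtain b where b: "b > 0" "\<forall>\<^sub>F x in zero_right. \<bar>f x\<bar> < b"
    using cauchy_fun_bounded[OF assms(1)] by blast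
  then obtain d where d: "\<forall>\<^sub>F x in zero_right. \<bar>g x - d\<bar> < e / (2 * b)"
    using cauchy_funD[OF assms(2), of "e / (2 * b)"] e by auto
  obtain c where c: "\<forall>\<^sub>F x in zero_right. \<bar>f x - c\<bar> < e / (2 * (\<bar>d\<bar> + 1))"
    using cauchy_funD[OF assms(1), of "e / (2 * (\<bar>d\<bar> + 1))"] e by auto
  have "\<forall>\<^sub>F x in zero_right. \<bar>f x * g x - c * d\<bar> < e"
    using b(2) c d
  proof eventually_elim
    case (elim x)
    have "\<bar>f x * g x - c * d\<bar> = \<bar>f x * (g x - d) + d * (f x - c)\<bar>"
      by (simp add: algebra_simps)
    also have "\<dots> \<le> \<bar>f x\<bar> * \<bar>g x - d\<bar> + \<bar>d\<bar> * \<bar>f x - c\<bar>"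
      by (metis abs_mult abs_triangle_ineq)
    also have "\<bar>f x\<bar> * \<bar>g x - d\<bar> \<le> b * \<bar>g x - d\<bar>"
      using elim by (intro mult_right_mono) auto
    also have "b * \<bar>g x - d\<bar> < b * (e / (2 * b))"
      using elim b by (intro mult_strict_left_mono) auto
    also have "\<bar>d\<bar> * \<bar>f x - c\<bar> \<le> (\<bar>d\<bar> + 1) * (e / (2 * (\<bar>d\<bar> + 1)))"
      using elim by (intro mult_mono) auto
    also have "(\<bar>d\<bar> + 1) * (e / (2 * (\<bar>d\<bar> + 1))) = e / 2"
      by (simp add: divide_simps)
    finally show ?case using b by (simp add: field_simps)
  qed
  then show "\<exists>c. \<forall>\<^sub>F x in zero_right. \<bar>f x * g x - c\<bar> < e" ..
qed

lemma null_fun_zero [simp]: "null_fun (\<lambda>_. 0)"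
  by (simp add: null_fun_def)

lemma null_fun_add:
  assumes "null_fun f" "null_fun g"
  shows "null_fun (\<lambda>x. f x + g x)"
  unfolding null_fun_def
proof safe
  fix e :: 'a assume "e > 0"
  then have "\<forall>\<^sub>F x in zero_right. \<bar>f x\<bar> < e / 2" "\<forall>\<^sub>F x in zero_right. \<bar>g x\<bar> < e / 2"
    using null_funD[OF assms(1), of "e / 2"] null_funD[OF assms(2), of "e / 2"] by auto
  then show "\<forall>\<^sub>F x in zero_right. \<bar>f x + g x\<bar> < e"
    by eventually_elim (simp add: abs_if field_simps split: if_splits)
qed

lemma null_fun_mult:
  assumes "null_fun f" "cauchy_fun g"
  shows "null_fun (\<lambda>x. f x * g x)"
  unfolding null_fun_def
proof safe
  fix e :: 'a assume e: "e > 0"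
  obtain b where b: "b > 0" "\<forall>\<^sub>F x in zero_right. \<bar>g x\<bar> < b"
    using cauchy_fun_bounded[OF assms(2)] by blast
  have "\<forall>\<^sub>F x in zero_right. \<bar>f x\<bar> < e / b"
    using assms(1) e b by (auto simp: null_fun_def)
  then show "\<forall>\<^sub>F x in zero_right. \<bar>f x * g x\<bar> < e"
    using b(2)
  proof eventually_elim
    case (elim x)
    have "\<bar>f x * g x\<bar> \<le> \<bar>f x\<bar> * b"
      unfolding abs_mult using elim by (intro mult_left_mono) auto
    also have "\<dots> < (e / b) * b"
      using elim b by (intro mult_strict_right_mono) auto
    finally show ?case using b by simp
  qed
qed

text \<open>Some tolerance \<open>e\<close> is missed by \<open>f\<close>. A constant
  \<open>c\<close> within \<open>e / 4\<close> of the values near 0 then satisfies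
  \<open>\<bar>c\<bar> \<ge> e / 2\<close>, which fixes the sign of \<open>f\<close> with margin
  \<open>e / 4\<close>. Inverses and the totality of the order on the completion come from
  this.\<close>

lemma cauchy_fun_not_null:
  assumes "cauchy_fun f" "\<not> null_fun f"
  shows "\<exists>d>0. (\<forall>\<^sub>F x in zero_right. f x > d) \<or> (\<forall>\<^sub>F x in zero_right. f x < - d)"
proof -
  obtain e where e: "e > 0" "\<not> (\<forall>\<^sub>F x in zero_right. \<bar>f x\<bar> < e)"
    using assms(2) by (auto simp: null_fun_def)
  obtain c where c: "\<forall>\<^sub>F x in zero_right. \<bar>f x - c\<bar> < e / 4"
    using cauchy_funD[OF assms(1), of "e / 4"] e by auto
  have "\<bar>c\<bar> \<ge> e / 2"
  proof (rule ccontr)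
    assume "\<not> ?thesis"
    with c have "\<forall>\<^sub>F x in zero_right. \<bar>f x\<bar> < e"
      by (rule_tac eventually_mono[OF c]) (use e in \<open>auto simp: abs_if field_simps split: if_splits\<close>)
    with e show False by blast
  qed
  then consider "c \<ge> e / 2" | "c \<le> - e / 2"
    by (auto simp: abs_if split: if_splits)
  then show ?thesis
  proof cases
    case 1
    have "\<forall>\<^sub>F x in zero_right. f x > e / 4"
      using c by eventually_elim (use 1 in \<open>auto simp: abs_if field_simps split: if_splits\<close>)
    then show ?thesis using e by (intro exI[of _ "e / 4"]) auto
  next
    case 2
    have "\<forall>\<^sub>F x in zero_right. f x < - (e / 4)"
      using c by eventually_elim (use 2 in \<open>auto simp: abs_if field_simps split: if_splits\<close>)
    then show ?thesis using e by (intro exI[of _ "e / 4"]) auto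
  qed
qed

lemma cauchy_fun_nonzero:
  assumes "cauchy_fun f" "\<not> null_fun f"
  shows "\<forall>\<^sub>F x in zero_right. f x \<noteq> 0"
proof -
  obtain d where "d > 0" "(\<forall>\<^sub>F x in zero_right. f x > d) \<or> (\<forall>\<^sub>F x in zero_right. f x < - d)"
    using cauchy_fun_not_null[OF assms] by blast
  then show ?thesis by (elim disjE) (auto elim!: eventually_mono)
qed

lemma cauchy_fun_inverse:
  assumes "cauchy_fun f" "\<not> null_fun f"
  shows "cauchy_fun (\<lambda>x. inverse (f x))"
  unfolding cauchy_fun_def
proof safe
  fix e :: 'a assume e: "e > 0"
  obtain d where d: "d > 0" "(\<forall>\<^sub>F x in zero_right. f x > d) \<or> (\<forall>\<^sub>F x in zero_right. f x < - d)"
    using cauchy_fun_not_null[OF assms] by blast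
  have d': "\<forall>\<^sub>F x in zero_right. \<bar>f x\<bar> > d"
    using d(2) by (auto elim!: eventually_mono simp: abs_if)
  \<comment> \<open>The first bound keeps \<open>\<bar>c\<bar>\<close> above \<open>d / 2\<close>;
    the second absorbs the denominator \<open>\<bar>f x\<bar> * \<bar>c\<bar>\<close>, which is at
    least \<open>d * (d / 2)\<close>.\<close>
  obtain c where c: "\<forall>\<^sub>F x in zero_right. \<bar>f x - c\<bar> < min (d / 2) (e * d * d / 2)"
    using cauchy_funD[OF assms(1), of "min (d / 2) (e * d * d / 2)"] e d by auto
  have "\<exists>x. \<bar>f x\<bar> > d \<and> \<bar>f x - c\<bar> < d / 2"
    using eventually_conj[OF d' c] zero_right_neq_bot eventually_happens'
    by (metis (mono_tags, lifting) min_less_iff_conj)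
  then have cd: "\<bar>c\<bar> > d / 2"
    by (auto simp: abs_if field_simps split: if_splits)
  have "\<forall>\<^sub>F x in zero_right. \<bar>inverse (f x) - inverse c\<bar> < e"
    using c d'
  proof eventually_elim
    case (elim x)
    have nz: "f x \<noteq> 0" "c \<noteq> 0" using elim cd d(1) by auto
    have "\<bar>inverse (f x) - inverse c\<bar> = \<bar>f x - c\<bar> / (\<bar>f x\<bar> * \<bar>c\<bar>)"
      using nz by (simp add: divide_simps abs_mult[symmetric] abs_minus_commute)
    also have "\<dots> < e"
    proof -
      have "\<bar>f x - c\<bar> < e * (d * (d / 2))" using elim by (simp add: mult.assoc)
      also have "\<dots> \<le> e * (\<bar>f x\<bar> * \<bar>c\<bar>)"
        using e d elim cd by (intro mult_left_mono mult_mono) auto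
      finally show ?thesis using nz by (simp add: pos_divide_less_eq)
    qed
    finally show ?case .
  qed
  then show "\<exists>c. \<forall>\<^sub>F x in zero_right. \<bar>inverse (f x) - c\<bar> < e" ..
qed

text \<open>Being Cauchy is part of the relation, which is therefore reflexive exactly on the Cauchy
  functions; the quotient is partial and no separate type of Cauchy functions is introduced.\<close>

definition completion_rel :: "('k::linordered_field \<Rightarrow> 'k) \<Rightarrow> ('k \<Rightarrow> 'k) \<Rightarrow> bool" where
  "completion_rel f g \<longleftrightarrow> cauchy_fun f \<and> cauchy_fun g \<and> null_fun (\<lambda>x. f x - g x)"

lemma null_fun_diff_commute: "null_fun (\<lambda>x. f x - g x) \<Longrightarrow> null_fun (\<lambda>x. g x - f x)"
  by (simp add: null_fun_def abs_minus_commute)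

lemma null_fun_diff_trans:
  "null_fun (\<lambda>x. f x - g x) \<Longrightarrow> null_fun (\<lambda>x. g x - h x) \<Longrightarrow> null_fun (\<lambda>x. f x - h x)"
  using null_fun_add[of "\<lambda>x. f x - g x" "\<lambda>x. g x - h x"] by simp

lemma part_equivp_completion_rel: "part_equivp completion_rel"
proof (rule part_equivpI)
  show "\<exists>f. completion_rel f (f :: 'a \<Rightarrow> 'a)"
    by (rule exI[of _ "\<lambda>_. 0"]) (simp add: completion_rel_def cauchy_fun_const)
  show "symp completion_rel"
    unfolding completion_rel_def symp_def by (metis null_fun_diff_commute)
  show "transp completion_rel"
    unfolding completion_rel_def transp_def by (metis null_fun_diff_trans)
qed

quotient_type (overloaded) 'k completion = "'k::linordered_field \<Rightarrow> 'k" / partial: completion_rel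
  morphisms completion_repr completion_class
  by (rule part_equivp_completion_rel)

section \<open>The completion as an ordered field\<close>

instantiation completion :: (linordered_field) linordered_field
begin

lift_definition zero_completion :: "'a completion" is "\<lambda>_. 0"
  by (simp add: completion_rel_def cauchy_fun_const)

lift_definition one_completion :: "'a completion" is "\<lambda>_. 1"
  by (simp add: completion_rel_def cauchy_fun_const)

lift_definition plus_completion :: "'a completion \<Rightarrow> 'a completion \<Rightarrow> 'a completion"
  is "\<lambda>f g x. f x + g x"
  unfolding completion_rel_def
  by (auto intro: cauchy_fun_add dest: null_fun_add simp: algebra_simps)

lift_definition uminus_completion :: "'a completion \<Rightarrow> 'a completion" is "\<lambda>f x. - f x"
  unfolding completion_rel_def
  by (auto intro: cauchy_fun_minus dest: null_fun_diff_commute)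

lift_definition times_completion :: "'a completion \<Rightarrow> 'a completion \<Rightarrow> 'a completion"
  is "\<lambda>f g x. f x * g x"
  unfolding completion_rel_def
proof safe
  fix f f' g g' :: "'a \<Rightarrow> 'a"
  assume *: "cauchy_fun f" "cauchy_fun f'" "cauchy_fun g" "cauchy_fun g'"
    "null_fun (\<lambda>x. f x - f' x)" "null_fun (\<lambda>x. g x - g' x)"
  have "null_fun (\<lambda>x. (f x - f' x) * g x + (g x - g' x) * f' x)"
    using * by (intro null_fun_add null_fun_mult)
  then show "null_fun (\<lambda>x. f x * g x - f' x * g' x)"
    by (simp add: algebra_simps)
qed (auto intro: cauchy_fun_mult)

definition minus_completion :: "'a completion \<Rightarrow> 'a completion \<Rightarrow> 'a completion" where
  "minus_completion x y = x + - y"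

text \<open>A null function may be nonzero everywhere, and its pointwise inverse need not be Cauchy.
  The case distinction is therefore made on the whole function, and every null function gets the
  inverse 0.\<close>

lift_definition inverse_completion :: "'a completion \<Rightarrow> 'a completion"
  is "\<lambda>f. if null_fun f then (\<lambda>_. 0) else (\<lambda>x. inverse (f x))"
proof -
  fix f g :: "'a \<Rightarrow> 'a"
  assume "completion_rel f g"
  then have fg: "cauchy_fun f" "cauchy_fun g" "null_fun (\<lambda>x. f x - g x)"
    by (auto simp: completion_rel_def)
  have iff: "null_fun f \<longleftrightarrow> null_fun g"
    using null_fun_add[OF fg(3), of g] null_fun_add[OF null_fun_diff_commute[OF fg(3)], of f] by auto
  show "completion_rel (if null_fun f then (\<lambda>_. 0) else (\<lambda>x. inverse (f x)))
    (if null_fun g then (\<lambda>_. 0) else (\<lambda>x. inverse (g x)))"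
  proof (cases "null_fun f")
    case True
    then show ?thesis using iff by (simp add: completion_rel_def cauchy_fun_const)
  next
    case False
    then have nf: "\<not> null_fun f" "\<not> null_fun g" using iff by auto
    note inv = cauchy_fun_inverse[OF fg(1) nf(1)] cauchy_fun_inverse[OF fg(2) nf(2)]
    have nz: "\<forall>\<^sub>F x in zero_right. f x \<noteq> 0" "\<forall>\<^sub>F x in zero_right. g x \<noteq> 0"
      using cauchy_fun_nonzero[OF fg(1) nf(1)] cauchy_fun_nonzero[OF fg(2) nf(2)] .
    have null: "null_fun (\<lambda>x. (g x - f x) * (inverse (f x) * inverse (g x)))"
      using null_fun_mult[OF null_fun_diff_commute[OF fg(3)] cauchy_fun_mult[OF inv]] .
    have "null_fun (\<lambda>x. inverse (f x) - inverse (g x))"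
      unfolding null_fun_def
    proof safe
      fix e :: 'a assume "e > 0"
      show "\<forall>\<^sub>F x in zero_right. \<bar>inverse (f x) - inverse (g x)\<bar> < e"
        using null_funD[OF null \<open>e > 0\<close>] nz
        by eventually_elim (simp add: inverse_eq_divide diff_frac_eq)
    qed
    with nf inv show ?thesis by (simp add: completion_rel_def)
  qed
qed

definition divide_completion :: "'a completion \<Rightarrow> 'a completion \<Rightarrow> 'a completion" where
  "divide_completion x y = x * inverse y"

text \<open>The gap \<open>d\<close> makes the relation invariant under null perturbations;
  pointwise inequality along the filter is not, as a positive null function shows.\<close>

lift_definition less_completion :: "'a completion \<Rightarrow> 'a completion \<Rightarrow> bool"
  is "\<lambda>f g. \<exists>d>0. \<forall>\<^sub>F x in zero_right. f x + d < g x"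
proof -
  have *: "\<exists>d>0. \<forall>\<^sub>F x in zero_right. f' x + d < g' x"
    if "null_fun (\<lambda>x. f x - f' x)" "null_fun (\<lambda>x. g x - g' x)" "d > 0"
      "\<forall>\<^sub>F x in zero_right. f x + d < g x"
    for f f' g g' :: "'a \<Rightarrow> 'a" and d
  proof (intro exI conjI)
    show "d / 4 > 0" using that by simp
    then have 1: "\<forall>\<^sub>F x in zero_right. \<bar>f x - f' x\<bar> < d / 4" "\<forall>\<^sub>F x in zero_right. \<bar>g x - g' x\<bar> < d / 4"
      using null_funD[OF that(1), of "d / 4"] null_funD[OF that(2), of "d / 4"] that(3) by auto
    show "\<forall>\<^sub>F x in zero_right. f' x + d / 4 < g' x"
      using 1 that(4)
      by eventually_elim (use \<open>d > 0\<close> in \<open>auto simp: abs_if field_simps split: if_splits\<close>)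
  qed
  show "(\<exists>d>0. \<forall>\<^sub>F x in zero_right. f x + d < g x) = (\<exists>d>0. \<forall>\<^sub>F x in zero_right. f' x + d < g' x)"
    if "completion_rel f f'" "completion_rel g g'" for f f' g g' :: "'a \<Rightarrow> 'a"
    using that *[of f f' g g'] *[of f' f g' g] unfolding completion_rel_def
    using null_fun_diff_commute by blast
qed

definition less_eq_completion :: "'a completion \<Rightarrow> 'a completion \<Rightarrow> bool" where
  "less_eq_completion x y \<longleftrightarrow> x < y \<or> x = y"

definition abs_completion :: "'a completion \<Rightarrow> 'a completion" where
  "abs_completion x = (if x < 0 then - x else x)"

definition sgn_completion :: "'a completion \<Rightarrow> 'a completion" where
  "sgn_completion x = (if x = 0 then 0 else if 0 < x then 1 else - 1)"

instance
proof
  fix a b c :: "'a completion"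
  show assoc: "a + b + c = a + (b + c)" for a b c :: "'a completion"
    by transfer (auto simp: completion_rel_def add.assoc intro!: cauchy_fun_add)
  show comm: "a + b = b + a" for a b :: "'a completion"
    by transfer (auto simp: completion_rel_def add.commute intro!: cauchy_fun_add)
  show zero: "0 + a = a" for a :: "'a completion"
    by transfer (auto simp: completion_rel_def)
  show linv: "- a + a = 0" for a :: "'a completion"
    by transfer (auto simp: completion_rel_def cauchy_fun_const intro!: cauchy_fun_add cauchy_fun_minus)
  show "a - b = a + - b"
    by (rule minus_completion_def)
  show "a * b * c = a * (b * c)"
    by transfer (auto simp: completion_rel_def mult.assoc intro!: cauchy_fun_mult)
  show "a * b = b * a"
    by transfer (auto simp: completion_rel_def mult.commute intro!: cauchy_fun_mult)
  show "1 * a = a"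
    by transfer (auto simp: completion_rel_def)
  show "(a + b) * c = a * c + b * c"
    by transfer (auto simp: completion_rel_def algebra_simps intro!: cauchy_fun_mult cauchy_fun_add)
  show "(0::'a completion) \<noteq> 1"
  proof (transfer, unfold completion_rel_def, safe)
    assume "null_fun (\<lambda>x::'a. 0 - 1 :: 'a)"
    from null_funD[OF this, of 1] show False by simp
  qed
  show "inverse a * a = 1" if "a \<noteq> 0"
    using that
  proof transfer
    fix f :: "'a \<Rightarrow> 'a"
    assume f: "completion_rel f f" "\<not> completion_rel f (\<lambda>_. 0)"
    then have n: "cauchy_fun f" "\<not> null_fun f" by (auto simp: completion_rel_def cauchy_fun_const)
    have nz: "\<forall>\<^sub>F x in zero_right. f x \<noteq> 0"
      using cauchy_fun_nonzero[OF n] .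
    have "null_fun (\<lambda>x. inverse (f x) * f x - 1)"
      unfolding null_fun_def by (auto intro!: eventually_mono[OF nz])
    with n show "completion_rel (\<lambda>x. (if null_fun f then (\<lambda>_. 0) else (\<lambda>x. inverse (f x))) x * f x) (\<lambda>_. 1)"
      by (auto simp: completion_rel_def cauchy_fun_const cauchy_fun_inverse intro!: cauchy_fun_mult)
  qed
  have neg: "- (b + c) = - b + - c"
    by transfer (auto simp: completion_rel_def intro!: cauchy_fun_diff cauchy_fun_minus)
  show "a + b - a = b"
    unfolding minus_completion_def by (metis assoc comm zero linv)
  show "a - b - c = a - (b + c)"
    unfolding minus_completion_def by (simp add: neg assoc)
  show "0 * a = 0" "a * 0 = 0"
    by (transfer, auto simp: completion_rel_def cauchy_fun_const)+
  show "a div b = a * inverse b"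
    by (rule divide_completion_def)
  show "inverse (0::'a completion) = 0"
    by transfer (auto simp: completion_rel_def cauchy_fun_const)
  show irrefl: "(a < b) = (a \<le> b \<and> \<not> b \<le> a)" for a b :: "'a completion"
  proof -
    have "\<not> (a < b \<and> b < a)"
    proof transfer
      fix f g :: "'a \<Rightarrow> 'a"
      show "\<not> ((\<exists>d>0. \<forall>\<^sub>F x in zero_right. f x + d < g x) \<and> (\<exists>d>0. \<forall>\<^sub>F x in zero_right. g x + d < f x))"
      proof safe
        fix d e :: 'a
        assume de: "0 < d" "0 < e"
        assume "\<forall>\<^sub>F x in zero_right. f x + d < g x" "\<forall>\<^sub>F x in zero_right. g x + e < f x"
        then have "\<forall>\<^sub>F x::'a in zero_right. False"
          by eventually_elim (use de in auto)
        then show False by simp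
      qed
    qed
    then show ?thesis by (auto simp: less_eq_completion_def)
  qed
  show "a \<le> a" by (simp add: less_eq_completion_def)
  have trans: "a < c" if "a < b" "b < c" for a b c :: "'a completion"
    using that
  proof transfer
    fix f g h :: "'a \<Rightarrow> 'a"
    assume "\<exists>d>0. \<forall>\<^sub>F x in zero_right. f x + d < g x" "\<exists>d>0. \<forall>\<^sub>F x in zero_right. g x + d < h x"
    then obtain d e where de: "d > 0" "e > 0" "\<forall>\<^sub>F x in zero_right. f x + d < g x"
      "\<forall>\<^sub>F x in zero_right. g x + e < h x" by blast
    have "\<forall>\<^sub>F x in zero_right. f x + d < h x"
      using de(3,4) by eventually_elim (use de in auto)
    with de show "\<exists>d>0. \<forall>\<^sub>F x in zero_right. f x + d < h x" by blast
  qed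
  show "a \<le> c" if "a \<le> b" "b \<le> c"
    using that trans by (auto simp: less_eq_completion_def)
  show "a = b" if "a \<le> b" "b \<le> a"
    using that by (metis irrefl less_eq_completion_def)
  show "a \<le> b \<or> b \<le> a"
    unfolding less_eq_completion_def
  proof transfer
    fix f g :: "'a \<Rightarrow> 'a"
    assume fg: "completion_rel f f" "completion_rel g g"
    have "completion_rel f g \<or> (\<exists>d>0. \<forall>\<^sub>F x in zero_right. f x + d < g x)
        \<or> (\<exists>d>0. \<forall>\<^sub>F x in zero_right. g x + d < f x)"
    proof (cases "null_fun (\<lambda>x. f x - g x)")
      case True
      then show ?thesis using fg by (simp add: completion_rel_def)
    next
      case False
      moreover have "cauchy_fun (\<lambda>x. f x - g x)"
        using cauchy_fun_diff[of f g] fg by (simp add: completion_rel_def)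
      ultimately obtain d where "d > 0"
        "(\<forall>\<^sub>F x in zero_right. f x - g x > d) \<or> (\<forall>\<^sub>F x in zero_right. f x - g x < - d)"
        using cauchy_fun_not_null by blast
      then show ?thesis by (auto simp: algebra_simps)
    qed
    then show "((\<exists>d>0. \<forall>\<^sub>F x in zero_right. f x + d < g x) \<or> completion_rel f g)
       \<or> ((\<exists>d>0. \<forall>\<^sub>F x in zero_right. g x + d < f x) \<or> completion_rel g f)"
      by blast
  qed
  show "c + a \<le> c + b" if "a \<le> b"
  proof -
    have "a < b \<Longrightarrow> c + a < c + b"
      by transfer (auto simp: algebra_simps)
    with that show ?thesis by (auto simp: less_eq_completion_def)
  qed
  show "c * a < c * b" if "a < b" "0 < c"
    using that
  proof transfer
    fix f g h :: "'a \<Rightarrow> 'a"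
    assume "\<exists>d>0. \<forall>\<^sub>F x in zero_right. f x + d < g x" "\<exists>d>0. \<forall>\<^sub>F x in zero_right. 0 + d < h x"
    then obtain d e where de: "d > 0" "e > 0" "\<forall>\<^sub>F x in zero_right. f x + d < g x"
      "\<forall>\<^sub>F x in zero_right. e < h x" by auto
    have "\<forall>\<^sub>F x in zero_right. h x * f x + e * d < h x * g x"
      using de(3,4)
    proof eventually_elim
      case (elim x)
      have "e * d < h x * (g x - f x)"
        using elim de(1,2) by (intro mult_strict_mono) auto
      then show ?case by (simp add: algebra_simps)
    qed
    then show "\<exists>d>0. \<forall>\<^sub>F x in zero_right. h x * f x + d < h x * g x"
      using de(1,2) by (intro exI[of _ "e * d"]) auto
  qed
  show "\<bar>a\<bar> = (if a < 0 then - a else a)" by (rule abs_completion_def)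
  show "sgn a = (if a = 0 then 0 else if 0 < a then 1 else - 1)" by (rule sgn_completion_def)
qed

end

lift_definition of_base :: "'k::linordered_field \<Rightarrow> 'k completion" is "\<lambda>c _. c"
  by (simp add: completion_rel_def cauchy_fun_const)

lemma of_base_simps [simp]:
  "of_base 0 = 0" "of_base 1 = 1" "of_base (x + y) = of_base x + of_base y"
  "of_base (x * y) = of_base x * of_base y"
  by (transfer, simp add: completion_rel_def cauchy_fun_const)+

lemma of_base_less_iff [simp]: "of_base x < of_base y \<longleftrightarrow> x < y"
proof transfer
  fix x y :: 'a
  show "(\<exists>d>0. \<forall>\<^sub>F _::'a in zero_right. x + d < y) \<longleftrightarrow> x < y"
    by (auto intro!: exI[of _ "(y - x) / 2"] simp: field_simps)
qed

lemma of_base_le_iff [simp]: "of_base x \<le> of_base y \<longleftrightarrow> x \<le> y"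
  using of_base_less_iff[of y x] by (metis not_le)

lemma of_base_minus [simp]: "of_base (- x) = - of_base x"
  by (metis add_eq_0_iff2 of_base_simps(1,3) ab_group_add_class.ab_left_minus)

lemma of_base_diff [simp]: "of_base (x - y) = of_base x - of_base y"
  using of_base_simps(3)[of x "- y"] by simp

lemma of_base_inverse [simp]: "of_base (inverse x) = inverse (of_base x)"
proof (cases "x = 0")
  case False
  then have "of_base (inverse x) * of_base x = 1" by (simp flip: of_base_simps)
  then show ?thesis by (metis inverse_unique mult.commute)
qed simp

lemma of_base_divide [simp]: "of_base (x / y) = of_base x / of_base y"
  by (simp add: divide_inverse)

text \<open>A constant within \<open>d / 4\<close> of \<open>f\<close>, raised by
  \<open>d / 2\<close>, keeps distance \<open>d / 4\<close> from both representatives.\<close>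

lemma of_base_dense:
  assumes "x < y"
  shows "\<exists>c. x < of_base c \<and> of_base c < y"
  using assms
proof transfer
  fix f g :: "'a \<Rightarrow> 'a"
  assume fg: "completion_rel f f" "completion_rel g g" "\<exists>d>0. \<forall>\<^sub>F x in zero_right. f x + d < g x"
  then obtain d where d: "d > 0" "\<forall>\<^sub>F x in zero_right. f x + d < g x" by blast
  obtain c where c: "\<forall>\<^sub>F x in zero_right. \<bar>f x - c\<bar> < d / 4"
    using cauchy_funD[of f "d / 4"] fg d by (auto simp: completion_rel_def)
  have "\<forall>\<^sub>F x in zero_right. f x + d / 4 < c + d / 2" "\<forall>\<^sub>F x in zero_right. c + d / 2 + d / 4 < g x"
    using c d(2) by (eventually_elim, auto simp: abs_if field_simps split: if_splits)+
  then show "\<exists>c. (\<exists>d>0. \<forall>\<^sub>F x in zero_right. f x + d < c) \<and> (\<exists>d>0. \<forall>\<^sub>F x in zero_right. c + d < g x)"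
    using d(1) by (intro exI[of _ "c + d / 2"] conjI exI[of _ "d / 4"]) auto
qed

text \<open>The filling element is represented by a function \<open>f\<close> whose value at
  \<open>e\<close> is a base element within \<open>e\<close> of a pair from \<open>A\<close> and
  \<open>B\<close> that is less than \<open>e\<close> apart. The hypothesis on small gaps supplies
  these pairs and makes \<open>f\<close> Cauchy.\<close>

lemma completion_complete:
  fixes A B :: "'k::linordered_field completion set"
  assumes AB: "\<And>a b. a \<in> A \<Longrightarrow> b \<in> B \<Longrightarrow> a \<le> b"
    and close: "\<And>e. 0 < e \<Longrightarrow> \<exists>a\<in>A. \<exists>b\<in>B. b - a < e"
  shows "\<exists>x. (\<forall>a\<in>A. a \<le> x) \<and> (\<forall>b\<in>B. x \<le> b)"
proof -
  define P where "P e q \<longleftrightarrow> (\<exists>a\<in>A. \<exists>b\<in>B. a - of_base e < of_base q \<and> of_base q < b + of_base e \<and> b - a < of_base e)"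
    for e q :: 'k
  have "\<exists>q. P e q" if "e > 0" for e
  proof -
    have e: "0 < (of_base e :: 'k completion)"
      using that of_base_less_iff[of 0 e] by simp
    obtain a b where ab: "a \<in> A" "b \<in> B" "b - a < of_base e" using close[OF e] by blast
    have "a - of_base e < a" using e by simp
    from of_base_dense[OF this] obtain q where "a - of_base e < of_base q" "of_base q < a" by blast
    moreover have "of_base q < b + of_base e"
      using AB[OF ab(1,2)] e \<open>of_base q < a\<close> by linarith
    ultimately have "P e q" using ab unfolding P_def by blast
    then show ?thesis ..
  qed
  then obtain f where f: "\<And>e. e > 0 \<Longrightarrow> P e (f e)" by metis
  \<comment> \<open>The pair chosen for \<open>e\<close> is narrow and its lower member lies below
    every element of \<open>B\<close>, so a base element above some \<open>b\<close> is above
    \<open>f e\<close> up to \<open>2 * e\<close>.\<close>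
  have near: "f e < q + 2 * e" if e: "e > 0" and q: "\<exists>b\<in>B. b < of_base q" for e q
  proof -
    obtain b where b: "b \<in> B" "b < of_base q" using q by blast
    obtain a' b' where *: "a' \<in> A" "b' \<in> B" "of_base (f e) < b' + of_base e" "b' - a' < of_base e"
      using f[OF e] by (auto simp: P_def)
    have "of_base (f e) < of_base (q + 2 * e)"
      using * AB[OF *(1) b(1)] b(2) unfolding mult_2 of_base_simps by linarith
    then show ?thesis by (simp only: of_base_less_iff)
  qed
  have near': "q - 2 * e < f e" if e: "e > 0" and q: "\<exists>a\<in>A. of_base q < a" for e q
  proof -
    obtain a where a: "a \<in> A" "of_base q < a" using q by blast
    obtain a' b' where *: "a' \<in> A" "b' \<in> B" "a' - of_base e < of_base (f e)" "b' - a' < of_base e"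
      using f[OF e] by (auto simp: P_def)
    have "of_base (q - 2 * e) < of_base (f e)"
      using * AB[OF a(1) *(2)] a(2) unfolding mult_2 of_base_simps of_base_diff by linarith
    then show ?thesis by (simp only: of_base_less_iff)
  qed
  have diff: "f d < f e + (2 * d + 2 * e)" if d: "d > 0" and e: "e > 0" for d e
  proof -
    obtain a b where 1: "a \<in> A" "b \<in> B" "of_base (f d) < b + of_base d" "b - a < of_base d"
      using f[OF d] by (auto simp: P_def)
    obtain a' b' where 2: "a' \<in> A" "b' \<in> B" "a' - of_base e < of_base (f e)" "b' - a' < of_base e"
      using f[OF e] by (auto simp: P_def)
    have "of_base (f d) < of_base (f e + (2 * d + 2 * e))"
      using 1(3,4) 2(3,4) AB[OF 1(1) 2(2)] unfolding mult_2 of_base_simps by linarith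
    then show ?thesis by (simp only: of_base_less_iff)
  qed
  have "cauchy_fun f"
    unfolding cauchy_fun_def
  proof safe
    fix e :: 'k assume e: "e > 0"
    have "\<bar>f x - f (e / 4)\<bar> < e" if "0 < x" "x < e / 4" for x
      using diff[of x "e / 4"] diff[of "e / 4" x] that e by (auto simp: abs_if field_simps)
    then show "\<exists>c. \<forall>\<^sub>F x in zero_right. \<bar>f x - c\<bar> < e"
      unfolding eventually_zero_right using e by (metis divide_pos_pos zero_less_numeral)
  qed
  \<comment> \<open>The class of \<open>f\<close> enters only through its comparisons with base
    elements; their density turns these into bounds against \<open>A\<close> and
    \<open>B\<close>.\<close>
  then have "\<exists>x. \<forall>c. (of_base c < x \<longrightarrow> (\<exists>d>0. \<forall>\<^sub>F e in zero_right. c + d < f e))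
      \<and> (x < of_base c \<longrightarrow> (\<exists>d>0. \<forall>\<^sub>F e in zero_right. f e + d < c))"
    by transfer (auto simp: completion_rel_def)
  then obtain x where x: "\<And>c. of_base c < x \<Longrightarrow> \<exists>d>0. \<forall>\<^sub>F e in zero_right. c + d < f e"
      "\<And>c. x < of_base c \<Longrightarrow> \<exists>d>0. \<forall>\<^sub>F e in zero_right. f e + d < c"
    by blast
  have small: "\<forall>\<^sub>F e in zero_right. 0 < e \<and> 2 * e < d" if "d > 0" for d :: 'k
    unfolding eventually_zero_right using that by (intro exI[of _ "d / 2"]) (auto simp: field_simps)
  show ?thesis
  proof (intro exI[of _ x] conjI ballI)
    fix a assume a: "a \<in> A"
    show "a \<le> x"
    proof (rule ccontr)
      assume "\<not> ?thesis"
      then obtain c where c: "x < of_base c" "of_base c < a" using of_base_dense[of x a] by auto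
      obtain d where d: "d > 0" "\<forall>\<^sub>F e in zero_right. f e + d < c" using x(2)[OF c(1)] by blast
      obtain e where "f e + d < c" "0 < e" "2 * e < d"
        using eventually_happens'[OF zero_right_neq_bot eventually_conj[OF d(2) small[OF d(1)]]] by blast
      then show False using near'[of e c] a c by force
    qed
  next
    fix b assume b: "b \<in> B"
    show "x \<le> b"
    proof (rule ccontr)
      assume "\<not> ?thesis"
      then obtain c where c: "b < of_base c" "of_base c < x" using of_base_dense[of b x] by auto
      obtain d where d: "d > 0" "\<forall>\<^sub>F e in zero_right. c + d < f e" using x(1)[OF c(2)] by blast
      obtain e where "c + d < f e" "0 < e" "2 * e < d"
        using eventually_happens'[OF zero_right_neq_bot eventually_conj[OF d(2) small[OF d(1)]]] by blast
      then show False using near[of e c] b c by force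
    qed
  qed
qed

section \<open>Intermediate values in real closed fields\<close>

locale subfield_set =
  fixes S :: "'a::field set"
  assumes zero: "0 \<in> S" and one: "1 \<in> S"
    and add: "x \<in> S \<Longrightarrow> y \<in> S \<Longrightarrow> x + y \<in> S"
    and uminus: "x \<in> S \<Longrightarrow> - x \<in> S"
    and mult: "x \<in> S \<Longrightarrow> y \<in> S \<Longrightarrow> x * y \<in> S"
    and inverse: "x \<in> S \<Longrightarrow> inverse x \<in> S"
begin

lemma diff: "x \<in> S \<Longrightarrow> y \<in> S \<Longrightarrow> x - y \<in> S"
  using add[OF _ uminus] by fastforce

lemma divide: "x \<in> S \<Longrightarrow> y \<in> S \<Longrightarrow> x / y \<in> S"
  using mult[OF _ inverse] by (simp add: field_class.field_divide_inverse)

lemma power: "x \<in> S \<Longrightarrow> x ^ n \<in> S"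
  by (induction n) (auto intro: one mult)

lemma sum: "(\<And>i. i \<in> I \<Longrightarrow> f i \<in> S) \<Longrightarrow> sum f I \<in> S"
  by (induction I rule: infinite_finite_induct) (auto intro: zero add)

lemma of_nat: "of_nat n \<in> S"
  by (induction n) (auto intro: zero one add)

lemma numeral: "numeral n \<in> S"
  using of_nat[of "numeral n"] by simp

lemmas closed = zero one add uminus mult inverse diff divide power sum of_nat

end

definition poly_over :: "'a::zero set \<Rightarrow> 'a poly set" where
  "poly_over S = {p. \<forall>i. Polynomial.coeff p i \<in> S}"

context subfield_set
begin

lemma poly_over_smult: "c \<in> S \<Longrightarrow> p \<in> poly_over S \<Longrightarrow> Polynomial.smult c p \<in> poly_over S"
  by (auto simp: poly_over_def mult)

text \<open>Division by a monic polynomial never divides coefficients: in descending order of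
  \<open>i\<close>, the coefficient of \<open>D * q\<close> at \<open>i + degree D\<close> is that
  of \<open>q\<close> at \<open>i\<close> plus products of coefficients of \<open>D\<close> with
  higher coefficients of \<open>q\<close>.\<close>

lemma poly_over_monic_factor:
  assumes "D * q \<in> poly_over S" "D \<in> poly_over S" "Polynomial.lead_coeff D = 1"
  shows "q \<in> poly_over S"
proof -
  let ?m = "Polynomial.degree D"
  have "Polynomial.coeff q i \<in> S" for i
  proof (induction "Polynomial.degree q + 1 - i" arbitrary: i rule: less_induct)
    case less
    show ?case
    proof (cases "i > Polynomial.degree q")
      case True
      then show ?thesis by (simp add: coeff_eq_0 zero)
    next
      case False
      have "Polynomial.coeff (D * q) (i + ?m)
          = (\<Sum>l\<le>i + ?m. Polynomial.coeff D l * Polynomial.coeff q (i + ?m - l))"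
        by (simp add: coeff_mult)
      also have "\<dots> = (\<Sum>l\<le>?m. Polynomial.coeff D l * Polynomial.coeff q (i + ?m - l))"
        by (rule sum.mono_neutral_right) (auto simp: coeff_eq_0)
      also have "\<dots> = (\<Sum>l<?m. Polynomial.coeff D l * Polynomial.coeff q (i + ?m - l))
          + Polynomial.coeff q i"
        using assms(3) by (simp add: lessThan_Suc_atMost[symmetric])
      finally have eq: "Polynomial.coeff q i = Polynomial.coeff (D * q) (i + ?m)
          - (\<Sum>l<?m. Polynomial.coeff D l * Polynomial.coeff q (i + ?m - l))"
        by simp
      have "(\<Sum>l<?m. Polynomial.coeff D l * Polynomial.coeff q (i + ?m - l)) \<in> S"
        using False less assms(2) by (intro sum mult) (auto simp: poly_over_def)
      then show ?thesis
        using assms(1) unfolding eq by (auto simp: poly_over_def intro: diff)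
    qed
  qed
  then show ?thesis by (simp add: poly_over_def)
qed

end

section \<open>Newton's identities and Laplace's root theorem\<close>

text \<open>The logarithmic derivative: the factor \<open>1 - z X\<close> contributes
  \<open>- z / (1 - z X)\<close>, a geometric series. Newton's identities become one equation
  between power series.\<close>

lemma newton_power_sums:
  fixes z :: "'i \<Rightarrow> 'a::field_char_0"
  assumes "finite I"
  shows "fps_deriv (\<Prod>i\<in>I. 1 - fps_const (z i) * fps_X)
    = - (\<Prod>i\<in>I. 1 - fps_const (z i) * fps_X) * Abs_fps (\<lambda>m. \<Sum>i\<in>I. z i ^ Suc m)"
  using assms
proof (induction I)
  case empty
  then show ?case by (auto simp: fps_eq_iff)
next
  case (insert j I)
  let ?P = "\<Prod>i\<in>I. 1 - fps_const (z i) * fps_X"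
  let ?A = "Abs_fps (\<lambda>m. \<Sum>i\<in>I. z i ^ Suc m)"
  let ?B = "Abs_fps (\<lambda>m. z j ^ Suc m)"
  let ?l = "1 - fps_const (z j) * fps_X"
  have A: "Abs_fps (\<lambda>m. \<Sum>i\<in>insert j I. z i ^ Suc m) = ?A + ?B"
    using insert by (auto simp: fps_eq_iff)
  have B: "?l * ?B = fps_const (z j)"
  proof (rule fps_ext)
    fix n show "fps_nth (?l * ?B) n = fps_nth (fps_const (z j)) n"
      by (cases n) (auto simp: algebra_simps mult.assoc)
  qed
  have "fps_deriv (?l * ?P) = ?l * fps_deriv ?P - fps_const (z j) * ?P"
    by (simp add: fps_const_neg[symmetric] del: fps_const_neg)
  also have "\<dots> = ?l * (- ?P * ?A) - (?l * ?B) * ?P"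
    by (simp only: insert.IH B)
  also have "\<dots> = - (?l * ?P) * (?A + ?B)"
    by (simp add: algebra_simps)
  finally show ?case
    using insert by (simp only: A prod.insert[OF insert.hyps])
qed

context
  fixes k :: "'a::field_char_0 set" and z :: "'i \<Rightarrow> 'a" and I :: "'i set"
  assumes k: "subfield_set k" and I: "finite I"
begin

private definition "Q = (\<Prod>i\<in>I. 1 - fps_const (z i) * fps_X)"

private lemma nth_rec:
  "of_nat (Suc n) * fps_nth Q (Suc n) = - (\<Sum>j\<le>n. fps_nth Q j * (\<Sum>i\<in>I. z i ^ Suc (n - j)))"
proof -
  have "fps_nth (fps_deriv Q) n = fps_nth (- Q * Abs_fps (\<lambda>m. \<Sum>i\<in>I. z i ^ Suc m)) n"
    unfolding Q_def by (subst newton_power_sums[OF I]) simp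
  then show ?thesis
    by (simp add: fps_mult_nth sum_negf atLeast0AtMost)
qed

private lemma nth_0: "fps_nth Q 0 = 1"
  unfolding Q_def using I by (induction I) auto

private lemma coeff_eq:
  "Polynomial.coeff (\<Prod>i\<in>I. [:- z i, 1:]) n
   = (if n \<le> card I then fps_nth Q (card I - n) else 0)"
proof -
  let ?p = "\<Prod>i\<in>I. [:- z i, 1:]"
  have "Q = fps_of_poly (\<Prod>i\<in>I. [:1, - z i:])"
    unfolding Q_def fps_of_poly_prod by (intro prod.cong) (auto simp: fps_of_poly_pCons)
  moreover have "(\<Prod>i\<in>I. [:1, - z i:]) = reflect_poly ?p"
    by (simp add: reflect_poly_prod) (simp add: reflect_poly_def)
  moreover have "Polynomial.degree ?p = card I"
    by (subst degree_prod_eq_sum_degree) auto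
  ultimately show ?thesis
    by (auto simp: coeff_reflect_poly coeff_eq_0)
qed

text \<open>The coefficients are those of the reversed product \<open>Q\<close>, and Newton's
  identities compute them and the power sums from each other, dividing by \<open>n + 1\<close> in
  characteristic 0. This takes the place of the theorem on symmetric polynomials: for roots built
  from pairs, power sums are easy to compute.\<close>

lemma prod_linear_in_poly_over_iff:
  "(\<Prod>i\<in>I. [:- z i, 1:]) \<in> poly_over k \<longleftrightarrow> (\<forall>m. (\<Sum>i\<in>I. z i ^ Suc m) \<in> k)"
proof -
  interpret k: subfield_set k by (rule k)
  have "(\<Prod>i\<in>I. [:- z i, 1:]) \<in> poly_over k \<longleftrightarrow> (\<forall>n\<le>card I. fps_nth Q n \<in> k)"
    unfolding poly_over_def mem_Collect_eq coeff_eq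
    by (auto simp: k.zero) (metis diff_diff_cancel diff_le_self)
  also have "\<dots> \<longleftrightarrow> (\<forall>n. fps_nth Q n \<in> k)"
  proof -
    have "fps_nth Q n = 0" if "n > card I" for n
    proof -
      have "Q = fps_of_poly (\<Prod>i\<in>I. [:1, - z i:])"
        unfolding Q_def fps_of_poly_prod by (intro prod.cong) (auto simp: fps_of_poly_pCons)
      moreover have "Polynomial.degree (\<Prod>i\<in>I. [:1, - z i:]) \<le> card I"
        using degree_prod_sum_le[OF I, of "\<lambda>i. [:1, - z i:]"]
          sum_mono[of I "\<lambda>i. Polynomial.degree [:1, - z i:]" "\<lambda>_. 1"]
        by (auto intro: order_trans)
      ultimately show ?thesis using that by (simp add: coeff_eq_0)
    qed
    then show ?thesis using k.zero by (metis not_le)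
  qed
  also have "\<dots> \<longleftrightarrow> (\<forall>m. (\<Sum>i\<in>I. z i ^ Suc m) \<in> k)"
  proof safe
    fix m assume Q: "\<forall>n. fps_nth Q n \<in> k"
    show "(\<Sum>i\<in>I. z i ^ Suc m) \<in> k"
    proof (induction m rule: less_induct)
      case (less m)
      have "(\<Sum>j\<le>m. fps_nth Q j * (\<Sum>i\<in>I. z i ^ Suc (m - j))) =
         (\<Sum>i\<in>I. z i ^ Suc m) + (\<Sum>j\<in>{1..m}. fps_nth Q j * (\<Sum>i\<in>I. z i ^ Suc (m - j)))"
        by (subst atMost_atLeast0, subst sum.atLeast_Suc_atMost) (auto simp: nth_0)
      moreover have "x = - y \<Longrightarrow> y = s + r \<Longrightarrow> s = - x - r" for x y s r :: 'a by simp
      ultimately have "(\<Sum>i\<in>I. z i ^ Suc m) = - (of_nat (Suc m) * fps_nth Q (Suc m))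
         - (\<Sum>j\<in>{1..m}. fps_nth Q j * (\<Sum>i\<in>I. z i ^ Suc (m - j)))"
        using nth_rec[of m] by blast
      also have "\<dots> \<in> k"
        using Q less by (intro k.diff k.uminus k.sum[where I="{1..m}"] k.mult[OF k.of_nat] k.mult)
          (auto simp del: power_Suc)
      finally show ?case .
    qed
  next
    fix n assume *: "\<forall>m. (\<Sum>i\<in>I. z i ^ Suc m) \<in> k"
    show "fps_nth Q n \<in> k"
    proof (induction n rule: less_induct)
      case (less n)
      show ?case
      proof (cases n)
        case 0
        then show ?thesis by (simp add: nth_0 k.one)
      next
        case (Suc n')
        have "fps_nth Q (Suc n') =
          (- (\<Sum>j\<le>n'. fps_nth Q j * (\<Sum>i\<in>I. z i ^ Suc (n' - j)))) / of_nat (Suc n')"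
          using nth_rec[of n'] by (simp add: field_simps del: of_nat_Suc)
        also have "\<dots> \<in> k"
          using less * Suc by (intro k.divide k.uminus k.sum[where I="{..n'}"] k.mult k.of_nat) auto
        finally show ?thesis using Suc by simp
      qed
    qed
  qed
  finally show ?thesis .
qed

end

text \<open>Applied to \<open>u i ^ n\<close>, it expresses the power sums of the products over
  pairs by power sums of the \<open>u i\<close>; applied to the constant 1, it counts the
  pairs.\<close>

lemma sum_pairs:
  fixes f :: "nat \<Rightarrow> 'a::comm_ring_1"
  shows "2 * (\<Sum>(j, i)\<in>(SIGMA j:{..<d}. {..<j}). f j * f i) = (\<Sum>i<d. f i)\<^sup>2 - (\<Sum>i<d. (f i)\<^sup>2)"
proof -
  have "2 * (\<Sum>j<d. \<Sum>i<j. f j * f i) = (\<Sum>i<d. f i)\<^sup>2 - (\<Sum>i<d. (f i)\<^sup>2)"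
    by (induction d) (auto simp: algebra_simps power2_eq_square sum_distrib_left)
  then show ?thesis by (simp add: sum.Sigma)
qed

text \<open>
  Laplace's induction on the exponent of 2 in the degree. If \<open>z\<^sub>i\<close> are the roots of \<open>p\<close>, the
  polynomial with roots \<open>(1 + t z\<^sub>i) (1 + t z\<^sub>j)\<close>, \<open>i < j\<close>, again has coefficients in \<open>k\<close>; two values
  of \<open>t\<close> that give a root in \<open>C\<close> for the same pair put \<open>z\<^sub>i + z\<^sub>j\<close> and \<open>z\<^sub>i z\<^sub>j\<close> in \<open>C\<close>.
\<close>

theorem laplace_root_exists:
  fixes k C :: "'a::{alg_closed_field, field_char_0} set"
  assumes k: "subfield_set k" and C: "subfield_set C" and kC: "k \<subseteq> C"
    and sqrt: "\<And>c. c \<in> C \<Longrightarrow> \<exists>d\<in>C. d * d = c"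
    and odd: "\<And>p. p \<in> poly_over k \<Longrightarrow> odd (Polynomial.degree p) \<Longrightarrow> \<exists>x\<in>C. poly p x = 0"
    and p: "p \<in> poly_over k" "Polynomial.degree p > 0"
  shows "\<exists>x\<in>C. poly p x = 0"
proof -
  interpret k: subfield_set k by (rule k)
  interpret C: subfield_set C by (rule C)
  have "\<exists>x\<in>C. poly p x = 0"
    if "p \<in> poly_over k" "Polynomial.degree p = 2 ^ e * m" "odd m" for p e m
    using that
  proof (induction e arbitrary: p m)
    case 0
    then show ?case using odd by simp
  next
    case (Suc e)
    define d where "d = Polynomial.degree p"
    have d: "d = 2 ^ Suc e * m" "d > 0"
      using Suc.prems by (auto simp: d_def intro: odd_pos)
    then have p0: "p \<noteq> 0" by (auto simp: d_def)
    obtain A where A: "size A = d"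
      "p = Polynomial.smult (Polynomial.lead_coeff p) (\<Prod>x\<in>#A. [:- x, 1:])"
      using alg_closed_imp_factorization[OF p0] by (auto simp: d_def)
    obtain zs where zs: "mset zs = A" using ex_mset by blast
    define z where "z i = zs ! i" for i
    define p1 where "p1 = (\<Prod>i<d. [:- z i, 1:])"
    have len: "length zs = d" using zs A by auto
    have "(\<Prod>x\<in>#A. [:- x, 1:]) = p1"
      unfolding zs[symmetric] p1_def z_def using len
      by (simp add: mset_map[symmetric] prod_mset_prod_list prod.list_conv_set_nth atLeast0LessThan
          del: mset_map)
    then have pp1: "p = Polynomial.smult (Polynomial.lead_coeff p) p1"
      using A by simp
    have "p1 = Polynomial.smult (1 / Polynomial.lead_coeff p) p"
      using p0 by (subst pp1) simp
    also have "\<dots> \<in> poly_over k"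
      using Suc.prems by (intro k.poly_over_smult k.divide k.one) (auto simp: poly_over_def)
    finally have p1k: "p1 \<in> poly_over k" .
    have root: "poly p (z i) = 0" if "i < d" for i
      using that by (subst pp1) (auto simp: p1_def poly_prod)
    have zsum: "(\<Sum>i<d. z i ^ n) \<in> k" for n
    proof (cases n)
      case 0
      then show ?thesis by (simp add: k.of_nat)
    next
      case (Suc n')
      then show ?thesis
        using prod_linear_in_poly_over_iff[OF k, of "{..<d}" z] p1k unfolding p1_def by auto
    qed
    let ?I = "SIGMA j:{..<d}. {..<j}"
    have ex: "\<exists>x\<in>?I. (1 + of_nat t * z (fst x)) * (1 + of_nat t * z (snd x)) \<in> C" for t :: nat
    proof -
      define u where "u i = 1 + of_nat t * z i" for i
      have usum: "(\<Sum>i<d. u i ^ n) \<in> k" for n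
      proof -
        have "(\<Sum>i<d. u i ^ n) = (\<Sum>i<d. \<Sum>j\<le>n. of_nat (n choose j) * of_nat t ^ j * z i ^ j)"
          unfolding u_def
          by (subst add.commute, subst binomial_ring) (simp add: power_mult_distrib mult.assoc)
        also have "\<dots> = (\<Sum>j\<le>n. of_nat (n choose j) * of_nat t ^ j * (\<Sum>i<d. z i ^ j))"
          by (subst sum.swap) (simp add: sum_distrib_left)
        also have "\<dots> \<in> k"
          by (intro k.sum k.mult k.of_nat k.power zsum)
        finally show ?thesis .
      qed
      define q where "q = (\<Prod>x\<in>?I. [:- (u (fst x) * u (snd x)), 1:])"
      have "(\<Sum>x\<in>?I. (u (fst x) * u (snd x)) ^ n) \<in> k" for n
      proof -
        have "2 * (\<Sum>x\<in>?I. (u (fst x) * u (snd x)) ^ n) \<in> k"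
          using sum_pairs[of "\<lambda>i. u i ^ n" d]
          by (auto simp: power_mult_distrib case_prod_unfold power_mult[symmetric]
              intro!: k.diff k.power usum)
        from k.divide[OF this k.of_nat[of 2]] show ?thesis by simp
      qed
      then have "q \<in> poly_over k"
        unfolding q_def
        by (subst prod_linear_in_poly_over_iff[OF k, of ?I "\<lambda>x. u (fst x) * u (snd x)"])
          (auto simp del: power_Suc)
      \<comment> \<open>There are \<open>d * (d - 1) / 2\<close> pairs. As \<open>d\<close> is even,
        \<open>d - 1\<close> is odd, and the exponent of 2 drops by exactly one.\<close>
      moreover have "Polynomial.degree q = 2 ^ e * (m * (d - 1))"
      proof -
        have "Polynomial.degree q = card ?I"
          unfolding q_def by (subst degree_prod_eq_sum_degree) auto
        moreover have "2 * int (card ?I) = int d ^ 2 - int d"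
          using sum_pairs[of "\<lambda>i. 1 :: int" d] by (simp add: case_prod_unfold)
        then have "2 * int (card ?I) = int (2 * (2 ^ e * (m * (d - 1))))"
          using d by (simp add: of_nat_diff power2_eq_square algebra_simps)
        ultimately show ?thesis by linarith
      qed
      moreover have "odd (m * (d - 1))"
        using Suc.prems d by auto
      ultimately obtain c where "c \<in> C" "poly q c = 0"
        using Suc.IH by blast
      then show ?thesis
        by (auto simp: q_def poly_prod u_def)
    qed
    then obtain f where f: "\<And>t. f t \<in> ?I"
      "\<And>t. (1 + of_nat t * z (fst (f t))) * (1 + of_nat t * z (snd (f t))) \<in> C"
      by metis
    have "finite (f ` {0<..})"
      by (rule finite_subset[OF image_subsetI[OF f(1)]]) auto
    \<comment> \<open>Infinitely many \<open>t\<close> share finitely many pairs. The value 0 is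
      left out because the resulting relations are divided by \<open>t\<close>.\<close>
    then obtain t0 where t0: "t0 > 0" "infinite {t \<in> {0<..}. f t = f t0}"
      using pigeonhole_infinite[of "{0<..} :: nat set" f] infinite_Ioi by auto
    then obtain t1 where t1: "t1 > 0" "t1 \<noteq> t0" "f t1 = f t0"
      using infinite_imp_nonempty[of "{t \<in> {0<..}. f t = f t0} - {t0}"] by auto
    define a b where "a = z (fst (f t0))" and "b = z (snd (f t0))"
    define x y :: 'a where "x = of_nat t0" and "y = of_nat t1"
    have xy: "x \<in> C" "y \<in> C" "x \<noteq> 0" "y \<noteq> 0" "x - y \<noteq> 0"
      using t0 t1 by (auto simp: x_def y_def C.of_nat)
    have ax: "(1 + x * a) * (1 + x * b) \<in> C"
      using f(2)[of t0] by (simp add: a_def b_def x_def)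
    have ay: "(1 + y * a) * (1 + y * b) \<in> C"
      using f(2)[of t1] t1 by (simp add: a_def b_def y_def)
    \<comment> \<open>Expanding \<open>(1 + x a) (1 + x b) = 1 + x ((a + b) + x a b)\<close> shows
      that \<open>g\<close> and \<open>h\<close> are two linear equations for \<open>a + b\<close>
      and \<open>a * b\<close>, solvable because \<open>x\<close> and \<open>y\<close>
      differ.\<close>
    define g h where "g = ((1 + x * a) * (1 + x * b) - 1) / x"
      and "h = ((1 + y * a) * (1 + y * b) - 1) / y"
    have gh: "g \<in> C" "h \<in> C"
      unfolding g_def h_def using ax ay xy by (auto intro!: C.divide C.diff C.one)
    have g: "g = (a + b) + x * (a * b)" and h: "h = (a + b) + y * (a * b)"
      unfolding g_def h_def using xy by (auto simp: field_simps)
    have "a * b = (g - h) / (x - y)"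
      using xy unfolding g h by (simp add: field_simps)
    then have ab: "a * b \<in> C" using gh xy by (auto intro!: C.divide C.diff)
    have "a + b = g - x * (a * b)" by (simp add: g)
    then have apb: "a + b \<in> C" using gh xy ab by (auto intro!: C.mult C.diff)
    \<comment> \<open>\<open>w\<close> is a square root of the discriminant of the quadratic with
      roots \<open>a\<close> and \<open>b\<close>.\<close>
    obtain w where w: "w \<in> C" "w * w = (a + b) * (a + b) - 4 * (a * b)"
      using sqrt[of "(a + b) * (a + b) - 4 * (a * b)"] ab apb C.of_nat[of 4]
      by (auto intro!: C.mult C.diff)
    have "(w - (a - b)) * (w + (a - b)) = 0"
      using w(2) by (simp add: algebra_simps)
    then have "w = a - b \<or> w = - (a - b)"
      by (metis add_eq_0_iff2 eq_iff_diff_eq_0 mult_eq_0_iff)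
    then have "2 * a = (a + b) + w \<or> 2 * a = (a + b) - w"
      by auto
    then have "2 * a \<in> C" using apb w C.add C.diff by metis
    from C.divide[OF this C.of_nat[of 2]] have "a \<in> C" by simp
    moreover have "poly p a = 0"
      unfolding a_def using f(1)[of t0] root by auto
    ultimately show ?case by blast
  qed
  moreover obtain m where "Polynomial.degree p = 2 ^ multiplicity 2 (Polynomial.degree p) * m" "odd m"
    by (rule multiplicity_decompose'[of "Polynomial.degree p" 2]) (use p(2) in auto)
  ultimately show ?thesis using p(1) by blast
qed


section \<open>Adjoining a square root of -1, and the intermediate value property\<close>

lemma map_poly_to_ac_simps [simp]:
  "map_poly to_ac (p + q) = map_poly to_ac p + map_poly to_ac q"
  "map_poly to_ac (p * q) = map_poly to_ac p * map_poly to_ac q"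
  by (simp_all add: poly_eq_iff coeff_map_poly coeff_mult to_ac_sum)

lemma poly_map_poly_to_ac: "poly (map_poly to_ac p) (to_ac x) = to_ac (poly p x)"
  by (induction p) (auto simp: map_poly_pCons)

text \<open>
  Real closedness is stated for a subset \<open>S\<close> of an ordered field, since \<open>S\<close> will be the image of
  a carrier.
\<close>

locale real_closed_subfield = subfield_set S
  for S :: "'a::linordered_field set" +
  assumes sqrt_exists: "x \<in> S \<Longrightarrow> 0 \<le> x \<Longrightarrow> \<exists>y\<in>S. y * y = x"
    and odd_root_exists:
      "p \<in> poly_over S \<Longrightarrow> odd (Polynomial.degree p) \<Longrightarrow> \<exists>x\<in>S. poly p x = 0"
begin

text \<open>The complex extension \<open>S + S i\<close> is formed inside the algebraic closure of
  the whole ordered field. There 1 and \<open>i\<close> are independent even over the whole field,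
  since a sum of two squares vanishes only trivially. Square roots of nonnegative elements of
  \<open>S\<close> yield square roots of all elements of \<open>S + S i\<close>, as Laplace's
  argument requires.\<close>

lemma real_closed_complexification:
  obtains i :: "'a alg_closure" where "i * i = -1"
    and "\<And>a b. to_ac a + to_ac b * i = 0 \<Longrightarrow> a = 0 \<and> b = 0"
    and "\<And>p. p \<in> poly_over S \<Longrightarrow> Polynomial.degree p > 0 \<Longrightarrow>
          \<exists>a\<in>S. \<exists>b\<in>S. poly (map_poly to_ac p) (to_ac a + to_ac b * i) = 0"
proof -
  obtain i :: "'a alg_closure" where i: "i * i = -1"
    using nth_root_exists[of 2 "-1 :: 'a alg_closure"] by (auto simp: power2_eq_square)
  have indep: "a = 0 \<and> b = 0" if "to_ac a + to_ac b * i = 0" for a b :: 'a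
  proof -
    have "to_ac (a * a + b * b) = to_ac a * to_ac a - (to_ac b * i) * (to_ac b * i)"
    proof -
      have "(to_ac b * i) * (to_ac b * i) = to_ac b * to_ac b * (i * i)" by (simp only: mult_ac)
      then show ?thesis by (simp add: i)
    qed
    also have "\<dots> = (to_ac a + to_ac b * i) * (to_ac a - to_ac b * i)"
      by (simp add: algebra_simps)
    finally have "a * a + b * b = 0" using that by (simp only: mult_zero_left to_ac_eq_0_iff)
    then show ?thesis by (simp add: sum_squares_eq_zero_iff)
  qed
  define k where "k = to_ac ` S"
  define C where "C = (\<lambda>(a, b). to_ac a + to_ac b * i) ` (S \<times> S)"
  have CI: "to_ac a + to_ac b * i \<in> C" if "a \<in> S" "b \<in> S" for a b
    using that by (auto simp: C_def)
  have CE: "\<exists>a\<in>S. \<exists>b\<in>S. c = to_ac a + to_ac b * i" if "c \<in> C" for c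
    using that by (auto simp: C_def)
  have k: "subfield_set k"
    by standard (auto simp: k_def closed image_iff
        simp flip: to_ac_add to_ac_mult to_ac_minus to_ac_inverse to_ac_0 to_ac_1
        intro!: closed)
  have Cmult: "x * y \<in> C" if xy: "x \<in> C" "y \<in> C" for x y
  proof -
    obtain a b c d where *: "a \<in> S" "b \<in> S" "c \<in> S" "d \<in> S"
      "x = to_ac a + to_ac b * i" "y = to_ac c + to_ac d * i"
      using CE[OF xy(1)] CE[OF xy(2)] by blast
    have "x * y = to_ac (a * c) + to_ac b * to_ac d * (i * i) + to_ac (a * d + b * c) * i"
      using * by (simp add: algebra_simps)
    also have "\<dots> = to_ac (a * c - b * d) + to_ac (a * d + b * c) * i"
      by (simp add: i)
    also have "\<dots> \<in> C" using * by (intro CI diff add mult)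
    finally show ?thesis .
  qed
  have C: "subfield_set C"
  proof
    show "0 \<in> C" "1 \<in> C"
      using CI[of 0 0] CI[of 1 0] by (auto simp: closed)
    fix x y assume "x \<in> C"
    then obtain a b where x: "a \<in> S" "b \<in> S" "x = to_ac a + to_ac b * i"
      using CE by meson
    show "- x \<in> C" using CI[of "-a" "-b"] x by (auto simp: closed)
    show "inverse x \<in> C"
    proof (cases "x = 0")
      case True
      then show ?thesis using CI[of 0 0] by (simp add: closed)
    next
      case False
      then have n: "a * a + b * b \<noteq> 0" using x by (auto simp: sum_squares_eq_zero_iff)
      have "x * (to_ac a - to_ac b * i) = to_ac a * to_ac a - to_ac b * to_ac b * (i * i)"
        by (simp add: x algebra_simps)
      also have "\<dots> = to_ac (a * a + b * b)"
        by (simp add: i)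
      finally have prod: "x * (to_ac a - to_ac b * i) = to_ac (a * a + b * b)" .
      have "to_ac (a * a + b * b) \<noteq> 0" using n by (simp only: to_ac_eq_0_iff not_False_eq_True)
      then have "inverse x = (to_ac a - to_ac b * i) / to_ac (a * a + b * b)"
        using False unfolding prod[symmetric] by (simp add: divide_simps)
      also have "\<dots> = to_ac (a / (a * a + b * b)) + to_ac (- b / (a * a + b * b)) * i"
        by (simp add: diff_divide_distrib)
      also have "\<dots> \<in> C" using x by (intro CI divide add mult uminus)
      finally show ?thesis .
    qed
    assume "y \<in> C"
    then obtain c d where y: "c \<in> S" "d \<in> S" "y = to_ac c + to_ac d * i"
      using CE by meson
    show "x + y \<in> C" using CI[of "a + c" "b + d"] x y by (auto simp: closed algebra_simps)
    show "x * y \<in> C" using Cmult \<open>x \<in> C\<close> \<open>y \<in> C\<close> by blast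
  qed
  have kC: "k \<subseteq> C"
    using CI[of _ 0] by (auto simp: k_def closed)
  have sqrt: "\<exists>d\<in>C. d * d = c" if c: "c \<in> C" for c
  proof -
    obtain a b where ab: "a \<in> S" "b \<in> S" "c = to_ac a + to_ac b * i"
      using CE[OF c] by blast
    \<comment> \<open>Half-angle formulas: with \<open>r\<close> the modulus of
      \<open>a + b i\<close>, a root is \<open>x + y i\<close> with
      \<open>x * x = (r + a) / 2\<close> and \<open>y * y = (r - a) / 2\<close>. Then
      \<open>2 * x * y\<close> is \<open>b\<close> up to sign, and the sign of \<open>y\<close> is
      chosen to fit.\<close>
    obtain r0 where "r0 \<in> S" "r0 * r0 = a * a + b * b"
      using sqrt_exists[of "a * a + b * b"] ab by (auto simp: closed)
    define r where "r = \<bar>r0\<bar>"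
    have r: "r \<in> S" "r * r = a * a + b * b" "r \<ge> 0"
      using \<open>r0 \<in> S\<close> \<open>r0 * r0 = _\<close> by (auto simp: r_def abs_if closed)
    have ra: "\<bar>a\<bar> \<le> r"
      using r by (intro abs_le_square_iff[THEN iffD2, of a r, simplified abs_of_nonneg[OF r(3)]])
        (simp add: power2_eq_square)
    obtain x where x: "x \<in> S" "x * x = (r + a) / 2"
      using sqrt_exists[of "(r + a) / 2"] divide[OF add[OF r(1) ab(1)] numeral] ra by force
    obtain y0 where y0: "y0 \<in> S" "y0 * y0 = (r - a) / 2"
      using sqrt_exists[of "(r - a) / 2"] divide[OF diff[OF r(1) ab(1)] numeral] ra by force
    have "(2 * x * y0) * (2 * x * y0) = 4 * (x * x) * (y0 * y0)" by simp
    also have "\<dots> = r * r - a * a"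
      unfolding x(2) y0(2) by (simp add: field_simps)
    finally have "(2 * x * y0)\<^sup>2 = b\<^sup>2" using r by (simp add: power2_eq_square)
    then have "2 * x * y0 = b \<or> 2 * x * (- y0) = b"
      by (auto simp: power2_eq_iff)
    moreover have "- y0 \<in> S" "- y0 * - y0 = (r - a) / 2" using y0 by (auto simp: closed)
    ultimately obtain y where y: "y \<in> S" "y * y = (r - a) / 2" "2 * x * y = b"
      using y0 by blast
    define d where "d = to_ac x + to_ac y * i"
    have "d * d = to_ac (x * x) + to_ac (y * y) * (i * i) + to_ac (2 * x * y) * i"
      by (simp add: d_def algebra_simps)
    also have "\<dots> = to_ac (x * x - y * y) + to_ac b * i"
      using y(3) by (simp add: i)
    also have "x * x - y * y = a"
      unfolding x(2) y(2) by (simp add: field_simps)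
    finally show ?thesis using CI[of x y] x y ab d_def by auto
  qed
  have overk: "map_poly to_ac p \<in> poly_over k \<longleftrightarrow> p \<in> poly_over S" for p
    by (auto simp: k_def poly_over_def coeff_map_poly image_iff)
  have kpoly: "\<exists>q\<in>poly_over S. p = map_poly to_ac q" if p: "p \<in> poly_over k" for p
  proof -
    have "p = map_poly to_ac (map_poly of_ac p)"
    proof (rule poly_eqI)
      fix n
      have "Polynomial.coeff p n \<in> k" using p by (simp add: poly_over_def)
      then show "Polynomial.coeff p n = Polynomial.coeff (map_poly to_ac (map_poly of_ac p)) n"
        by (auto simp: coeff_map_poly k_def)
    qed
    then show ?thesis using overk p by metis
  qed
  have deg: "Polynomial.degree (map_poly to_ac p) = Polynomial.degree p" for p :: "'a poly"
    by (rule degree_map_poly) auto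
  have odd: "\<exists>x\<in>C. poly p x = 0" if p: "p \<in> poly_over k" "odd (Polynomial.degree p)" for p
  proof -
    obtain q where "q \<in> poly_over S" "p = map_poly to_ac q" using kpoly p by blast
    moreover from this obtain x where "x \<in> S" "poly q x = 0"
      using odd_root_exists[of q] p deg[of q] by auto
    ultimately show ?thesis
      using kC by (intro bexI[of _ "to_ac x"]) (auto simp: k_def poly_map_poly_to_ac)
  qed
  have "\<exists>a\<in>S. \<exists>b\<in>S. poly (map_poly to_ac p) (to_ac a + to_ac b * i) = 0"
    if "p \<in> poly_over S" "Polynomial.degree p > 0" for p
    using laplace_root_exists[OF k C kC sqrt odd, of "map_poly to_ac p"] that overk[of p] deg[of p] CE
    by metis
  with i indep that show thesis by blast
qed

text \<open>Factors whose values at \<open>a\<close> and \<open>b\<close> have equal signs are split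
  off, which lowers the degree and preserves the sign change: \<open>X - x\<close> for a root
  \<open>x\<close> outside the interval, and a positive quadratic for a non-real root. The end
  points may lie outside \<open>S\<close>; the root found lies in \<open>S\<close>.\<close>

theorem poly_IVT:
  assumes "p \<in> poly_over S" "a \<le> b" "poly p a * poly p b < 0"
  shows "\<exists>x\<in>S. a \<le> x \<and> x \<le> b \<and> poly p x = 0"
proof -
  obtain i :: "'a alg_closure" where i: "i * i = -1"
    and indep: "\<And>a b. to_ac a + to_ac b * i = 0 \<Longrightarrow> a = 0 \<and> b = 0"
    and root: "\<And>p. p \<in> poly_over S \<Longrightarrow> Polynomial.degree p > 0 \<Longrightarrow>
          \<exists>a\<in>S. \<exists>b\<in>S. poly (map_poly to_ac p) (to_ac a + to_ac b * i) = 0"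
    using real_closed_complexification by metis
  show ?thesis
    using assms(1,3)
  proof (induction "Polynomial.degree p" arbitrary: p rule: less_induct)
    case less
    have "Polynomial.degree p \<noteq> 0"
    proof
      assume "Polynomial.degree p = 0"
      then obtain c where "p = [:c:]" by (metis degree_eq_zeroE)
      then show False using less.prems by (auto simp: mult_less_0_iff)
    qed
    then obtain x y where xy: "x \<in> S" "y \<in> S" "poly (map_poly to_ac p) (to_ac x + to_ac y * i) = 0"
      using root less.prems by blast
    have p0: "p \<noteq> 0" using less.prems by auto
    have step: ?case
      if D: "p = D * q" "D \<in> poly_over S" "Polynomial.lead_coeff D = 1" "Polynomial.degree D > 0"
        "poly D a * poly D b > 0" for D q
    proof -
      have "q \<in> poly_over S"
        using D less.prems poly_over_monic_factor[of D q] by simp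
      moreover have "Polynomial.degree q < Polynomial.degree p"
        using p0 D by (auto simp: degree_mult_eq)
      moreover have "(poly D a * poly D b) * (poly q a * poly q b) < 0"
        using less.prems by (simp add: D(1) mult_ac)
      then have "poly q a * poly q b < 0"
        using D(5) unfolding mult_less_0_iff[of "poly D a * poly D b"] by (auto dest: less_asym)
      ultimately obtain x where "x \<in> S" "a \<le> x" "x \<le> b" "poly q x = 0"
        using less.hyps[of q] by blast
      then show ?thesis by (auto simp: D(1))
    qed
    show ?case
    proof (cases "y = 0")
      case True
      then have px: "poly p x = 0" using xy(3) by (simp add: poly_map_poly_to_ac)
      show ?thesis
      proof (cases "a \<le> x \<and> x \<le> b")
        case True
        then show ?thesis using px xy by blast
      next
        case False
        obtain q where "p = [:-x, 1:] * q" using px by (metis poly_eq_0_iff_dvd dvdE)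
        moreover have "[:-x, 1:] \<in> poly_over S"
          using xy by (auto simp: poly_over_def coeff_pCons closed split: nat.splits)
        moreover have "poly [:-x, 1:] a * poly [:-x, 1:] b > 0"
          using False assms(2) by (auto simp: zero_less_mult_iff)
        ultimately show ?thesis by (intro step) auto
      qed
    next
      case False
      \<comment> \<open>The quadratic with roots \<open>w\<close> and its conjugate. The remainder
        of \<open>p\<close> modulo \<open>D\<close> is linear and vanishes at \<open>w\<close>, so
        the independence of 1 and \<open>i\<close> makes it 0.\<close>
      define D where "D = [:x * x + y * y, - 2 * x, 1:]"
      define w where "w = to_ac x + to_ac y * i"
      have "w * w = to_ac (x * x) + to_ac (y * y) * (i * i) + to_ac (2 * x) * (to_ac y * i)"
        by (simp add: w_def algebra_simps)
      also have "\<dots> = to_ac (2 * x) * w - to_ac (x * x + y * y)"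
        by (simp add: i w_def algebra_simps)
      finally have Dw: "poly (map_poly to_ac D) w = 0"
        by (simp add: D_def map_poly_pCons algebra_simps)
      define r where "r = p mod D"
      have D0: "D \<noteq> 0" "Polynomial.degree D = 2" by (auto simp: D_def)
      have "Polynomial.degree r < 2"
        using degree_mod_less[OF D0(1), of p] D0 by (auto simp: r_def)
      then have r: "r = [:Polynomial.coeff r 0, Polynomial.coeff r 1:]"
        by (intro poly_eqI) (auto simp: coeff_pCons coeff_eq_0 split: nat.splits)
      have pD: "p = D * (p div D) + r" by (simp add: r_def)
      have "poly (map_poly to_ac r) w = 0"
        using xy(3) Dw unfolding w_def[symmetric] by (subst (asm) pD) simp
      then have "to_ac (Polynomial.coeff r 0) + w * to_ac (Polynomial.coeff r 1) = 0"
        by (subst (asm) r) (simp add: map_poly_pCons)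
      then have "to_ac (Polynomial.coeff r 0 + x * Polynomial.coeff r 1)
          + to_ac (y * Polynomial.coeff r 1) * i = 0"
        by (simp add: w_def algebra_simps)
      from indep[OF this] have "Polynomial.coeff r 0 = 0" "Polynomial.coeff r 1 = 0"
        using False by auto
      then have "r = 0" using r by (metis pCons_0_0)
      then have "p = D * (p div D)" using pD by simp
      moreover have "poly D t > 0" for t
      proof -
        have "poly D t = (t - x) * (t - x) + y * y" by (simp add: D_def algebra_simps)
        then show ?thesis using False by (simp add: sum_squares_gt_zero_iff)
      qed
      moreover have "D \<in> poly_over S"
        using xy of_nat[of 2] by (auto simp: D_def poly_over_def coeff_pCons closed split: nat.splits)
      ultimately show ?thesis by (intro step[of D "p div D"]) (auto simp: D_def)
    qed
  qed
qed

end

section \<open>From integer parts to models\<close>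

lemma discretely_ordered_less_iff: "x < y \<longleftrightarrow> x + 1 \<le> (y::'a::discretely_ordered_ring)"
  using one_least_positive[of "y - x"] by (auto simp: algebra_simps intro: less_le_trans[of x "x + 1"])

lemma nonneg_part_simps:
  "universe (nonneg_part pw) = {x. 0 \<le> x}" "arith_zero (nonneg_part pw) = 0"
  "arith_suc (nonneg_part pw) = (\<lambda>x. x + 1)" "arith_add (nonneg_part pw) = (+)"
  "arith_mult (nonneg_part pw) = (*)" "arith_le (nonneg_part pw) = (\<le>)"
  "arith_power (nonneg_part pw) = pw" "arith_less (nonneg_part pw) x y \<longleftrightarrow> x < y"
  by (auto simp: nonneg_part_def arith_less_def)

locale embedded_ring =
  fixes \<iota> :: "'a::discretely_ordered_ring \<Rightarrow> 'k::linordered_field"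
  assumes one [simp]: "\<iota> 1 = 1"
    and add [simp]: "\<iota> (x + y) = \<iota> x + \<iota> y"
    and mult [simp]: "\<iota> (x * y) = \<iota> x * \<iota> y"
    and le_iff [simp]: "\<iota> x \<le> \<iota> y \<longleftrightarrow> x \<le> y"
begin

lemma zero [simp]: "\<iota> 0 = 0"
  using add[of 0 0] by simp

lemma less_iff [simp]: "\<iota> x < \<iota> y \<longleftrightarrow> x < y"
  by (simp add: less_le_not_le)

lemma eq_iff [simp]: "\<iota> x = \<iota> y \<longleftrightarrow> x = y"
  by (simp add: order_eq_iff)

lemma zero_less_iff [simp]: "0 < \<iota> x \<longleftrightarrow> 0 < x"
  using less_iff[of 0 x] by simp

lemma zero_le_iff [simp]: "0 \<le> \<iota> x \<longleftrightarrow> 0 \<le> x"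
  using le_iff[of 0 x] by simp

lemma le_zero_iff [simp]: "\<iota> x \<le> 0 \<longleftrightarrow> x \<le> 0"
  using le_iff[of x 0] by simp

lemma eq_zero_iff [simp]: "\<iota> x = 0 \<longleftrightarrow> x = 0"
  using eq_iff[of x 0] by simp

lemma one_le_iff [simp]: "1 \<le> \<iota> x \<longleftrightarrow> 1 \<le> x"
  using le_iff[of 1 x] by simp

lemma minus [simp]: "\<iota> (- x) = - \<iota> x"
  using add[of x "- x"] by (simp add: eq_neg_iff_add_eq_0 add.commute)

lemma diff [simp]: "\<iota> (x - y) = \<iota> x - \<iota> y"
  using add[of x "- y"] by simp

lemma hom_of_nat: "\<iota> (of_nat n) = of_nat n"
  by (induction n) auto

lemma hom_numeral: "\<iota> (numeral n) = numeral n"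
  using hom_of_nat[of "numeral n"] by simp

lemma poly_map [simp]: "poly (map_poly \<iota> p) (\<iota> x) = \<iota> (poly p x)"
  by (induction p) (auto simp: map_poly_pCons)

lemma map_poly_eq_0_iff [simp]: "map_poly \<iota> p = 0 \<longleftrightarrow> p = 0"
  by (auto simp: poly_eq_iff coeff_map_poly)

end

section \<open>Open induction from finitely many sign changes\<close>

fun term_poly :: "nat \<Rightarrow> (nat \<Rightarrow> 'a::comm_ring_1) \<Rightarrow> arith_term \<Rightarrow> 'a poly" where
  "term_poly v e (TVar i) = (if i = v then [:0, 1:] else [:e i:])"
| "term_poly v e TZero = 0"
| "term_poly v e (TSuc t) = term_poly v e t + 1"
| "term_poly v e (TAdd s t) = term_poly v e s + term_poly v e t"
| "term_poly v e (TMult s t) = term_poly v e s * term_poly v e t"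

lemma term_val_conv_poly:
  "term_val (nonneg_part pw) (e(v := x)) t = poly (term_poly v e t) x"
  by (induction t) (auto simp: nonneg_part_def)

locale integer_part_subfield = embedded_ring \<iota> + real_closed_subfield S
  for \<iota> :: "'a::discretely_ordered_ring \<Rightarrow> 'k::linordered_field" and S :: "'k set" +
  assumes in_S [simp]: "\<iota> x \<in> S"
    and floor_exists: "r \<in> S \<Longrightarrow> \<exists>m. \<iota> m \<le> r \<and> r < \<iota> (m + 1)"
begin

text \<open>
  Quantifier-free properties change their truth value only at finitely many points; the integer
  part then locates the first integer after such a point.
\<close>

definition tame :: "('a \<Rightarrow> bool) \<Rightarrow> bool" where
  "tame P \<longleftrightarrow> (\<exists>Z. finite Z \<and> Z \<subseteq> S \<and> (\<forall>x y. x \<le> y \<longrightarrow> Z \<inter> {\<iota> x..\<iota> y} = {} \<longrightarrow> P x = P y))"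

text \<open>The exceptional points are the roots in \<open>S\<close>: opposite signs at
  \<open>x\<close> and \<open>y\<close> force one between them by the intermediate value property.
  An arbitrary condition \<open>Q\<close> on the sign covers equations and inequalities at
  once.\<close>

lemma tame_poly: "tame (\<lambda>x. Q (sgn (poly p x)))"
proof (cases "p = 0")
  case True
  then show ?thesis by (auto simp: tame_def intro!: exI[of _ "{}"])
next
  case False
  let ?p = "map_poly \<iota> p"
  have over: "?p \<in> poly_over S" by (simp add: poly_over_def coeff_map_poly)
  define Z where "Z = {z \<in> S. poly ?p z = 0}"
  have "sgn (poly p x) = sgn (poly p y)" if xy: "x \<le> y" "Z \<inter> {\<iota> x..\<iota> y} = {}" for x y
  proof (rule ccontr)
    assume *: "sgn (poly p x) \<noteq> sgn (poly p y)"
    have "poly p t \<noteq> 0" if "x \<le> t" "t \<le> y" for t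
      using xy(2) that by (auto simp: Z_def dest!: equals0D[of _ "\<iota> t"])
    then have "poly p x \<noteq> 0" "poly p y \<noteq> 0" using xy by auto
    with * have "poly p x * poly p y < 0"
      by (auto simp: sgn_if mult_less_0_iff split: if_splits)
    then have "\<iota> (poly p x * poly p y) < \<iota> 0" by (simp only: less_iff)
    then have "poly ?p (\<iota> x) * poly ?p (\<iota> y) < 0" by simp
    from poly_IVT[OF over _ this] xy show False by (auto simp: Z_def)
  qed
  moreover have "finite Z"
    unfolding Z_def by (rule finite_subset[OF _ poly_roots_finite[of ?p]]) (use False in auto)
  ultimately show ?thesis
    unfolding tame_def by (intro exI[of _ Z]) (auto simp: Z_def)
qed

lemma tame_not: "tame P \<Longrightarrow> tame (\<lambda>x. \<not> P x)"
  unfolding tame_def by metis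

lemma tame_binary:
  assumes "tame P" "tame Q"
  shows "tame (\<lambda>x. f (P x) (Q x))"
proof -
  obtain Y Z where "finite Y" "Y \<subseteq> S" "\<And>x y. x \<le> y \<Longrightarrow> Y \<inter> {\<iota> x..\<iota> y} = {} \<Longrightarrow> P x = P y"
     "finite Z" "Z \<subseteq> S" "\<And>x y. x \<le> y \<Longrightarrow> Z \<inter> {\<iota> x..\<iota> y} = {} \<Longrightarrow> Q x = Q y"
    using assms unfolding tame_def by metis
  then show ?thesis
    unfolding tame_def by (intro exI[of _ "Y \<union> Z"]) (auto simp: Int_Un_distrib2)
qed

lemma tame_qf_sat: "tame (\<lambda>x. qf_sat (nonneg_part pw) (e(v := x)) p)"
proof (induction p)
  case (FEq s t)
  have "tame (\<lambda>x. sgn (poly (term_poly v e s - term_poly v e t) x) = 0)"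
    by (rule tame_poly)
  then show ?case unfolding qf_sat.simps term_val_conv_poly by (simp add: sgn_0_0)
next
  case (FLe s t)
  have "tame (\<lambda>x. sgn (poly (term_poly v e s - term_poly v e t) x) \<le> 0)"
    by (rule tame_poly)
  moreover have "arith_le (nonneg_part pw) = (\<le>)" by (simp add: nonneg_part_def)
  moreover have "sgn z \<le> 0 \<longleftrightarrow> z \<le> 0" for z :: 'a by (simp add: sgn_if)
  ultimately show ?case unfolding qf_sat.simps term_val_conv_poly by simp
qed (auto intro: tame_not tame_binary)

text \<open>Induction on the number of exceptional points between \<open>x\<close> and
  \<open>y\<close>. If \<open>m\<close> is the integer part of the least of them, \<open>z\<close>,
  then \<open>P\<close> keeps its value from \<open>x\<close> to \<open>m - 1\<close>, and at most
  two uses of the step, to \<open>m\<close> and to \<open>m + 1\<close>, carry it past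
  \<open>z\<close>.\<close>

lemma tame_induction:
  assumes "tame P" and step: "\<And>x. 0 \<le> x \<Longrightarrow> P x \<Longrightarrow> P (x + 1)"
    and "0 \<le> x" "x \<le> y" "P x"
  shows "P y"
proof -
  obtain Z where Z: "finite Z" "Z \<subseteq> S"
    "\<And>x y. x \<le> y \<Longrightarrow> Z \<inter> {\<iota> x..\<iota> y} = {} \<Longrightarrow> P x = P y"
    using assms(1) unfolding tame_def by metis
  show ?thesis
    using assms(3-)
  proof (induction "card (Z \<inter> {\<iota> x..\<iota> y})" arbitrary: x rule: less_induct)
    case less
    show ?case
    proof (cases "Z \<inter> {\<iota> x..\<iota> y} = {}")
      case True
      then show ?thesis using Z(3) less.prems by blast
    next
      case False
      define z where "z = Min (Z \<inter> {\<iota> x..\<iota> y})"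
      have z: "z \<in> Z" "\<iota> x \<le> z" "z \<le> \<iota> y"
        using Min_in[of "Z \<inter> {\<iota> x..\<iota> y}"] False Z(1) by (auto simp: z_def)
      have zmin: "z \<le> w" if "w \<in> Z" "\<iota> x \<le> w" "w \<le> \<iota> y" for w
        using Min_le[of "Z \<inter> {\<iota> x..\<iota> y}" w] Z(1) that by (auto simp: z_def)
      obtain m where m: "\<iota> m \<le> z" "z < \<iota> (m + 1)" using floor_exists z Z(2) by blast
      have "\<iota> x < \<iota> (m + 1)" using z m by (meson le_less_trans)
      then have xm: "x \<le> m" unfolding less_iff by (metis discretely_ordered_less_iff add_le_cancel_right)
      have my: "m \<le> y" using m z by (meson le_iff order_trans)
      have "P m"
      proof (cases "x = m")
        case False
        then have "x \<le> m - 1" using xm discretely_ordered_less_iff[of x m] by (simp add: algebra_simps)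
        moreover have "\<iota> (m - 1) < z" using m by (metis less_iff diff_add_cancel discretely_ordered_less_iff
              order_refl less_le_trans)
        then have "Z \<inter> {\<iota> x..\<iota> (m - 1)} = {}"
          using zmin z by (auto simp del: diff) (meson not_le order_trans less_imp_le le_less_trans)
        ultimately have "P (m - 1)" using Z(3) less.prems by blast
        then show ?thesis using step[of "m - 1"] less.prems \<open>x \<le> m - 1\<close> by auto
      qed (use less.prems in simp)
      show ?thesis
      proof (cases "m = y")
        case False
        then have "m + 1 \<le> y" using my discretely_ordered_less_iff[of m y] by simp
        moreover have "P (m + 1)" using step \<open>P m\<close> xm less.prems by auto
        moreover have "card (Z \<inter> {\<iota> (m + 1)..\<iota> y}) < card (Z \<inter> {\<iota> x..\<iota> y})"
        proof (rule psubset_card_mono)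
          have "x \<le> m + 1" using xm by (simp add: add_increasing2)
          then have "\<iota> x \<le> \<iota> (m + 1)" by (simp only: le_iff)
          then have "Z \<inter> {\<iota> (m + 1)..\<iota> y} \<subseteq> Z \<inter> {\<iota> x..\<iota> y}" by force
          moreover have "z \<notin> {\<iota> (m + 1)..\<iota> y}" using m by auto
          ultimately show "Z \<inter> {\<iota> (m + 1)..\<iota> y} \<subset> Z \<inter> {\<iota> x..\<iota> y}" using z by auto
        qed (use Z in auto)
        ultimately show ?thesis using less.hyps[of "m + 1"] less.prems xm by auto
      qed (use \<open>P m\<close> in simp)
    qed
  qed
qed

theorem IOpen_model_nonneg_part: "IOpen_model (nonneg_part (pw :: 'a \<Rightarrow> 'a \<Rightarrow> 'a))"
proof
  let ?A = "nonneg_part pw"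
  show "\<forall>p v e. (\<forall>i. e i \<in> universe ?A) \<longrightarrow> qf_sat ?A (e(v := arith_zero ?A)) p \<longrightarrow>
     (\<forall>x\<in>universe ?A. qf_sat ?A (e(v := x)) p \<longrightarrow> qf_sat ?A (e(v := arith_suc ?A x)) p) \<longrightarrow>
     (\<forall>x\<in>universe ?A. qf_sat ?A (e(v := x)) p)"
  proof safe
    fix p v e x
    assume "qf_sat ?A (e(v := arith_zero ?A)) p" "x \<in> universe ?A"
      "\<forall>x\<in>universe ?A. qf_sat ?A (e(v := x)) p \<longrightarrow> qf_sat ?A (e(v := arith_suc ?A x)) p"
    then show "qf_sat ?A (e(v := x)) p"
      by (intro tame_induction[OF tame_qf_sat, of pw e v p 0 x]) (auto simp: nonneg_part_def)
  qed
  show "\<forall>x\<in>universe ?A. arith_suc ?A x \<noteq> arith_zero ?A"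
    by (auto simp: nonneg_part_def add_nonneg_eq_0_iff)
  show "\<forall>x\<in>universe ?A. x \<noteq> arith_zero ?A \<longrightarrow> (\<exists>y\<in>universe ?A. x = arith_suc ?A y)"
  proof safe
    fix x assume "x \<in> universe ?A" "x \<noteq> arith_zero ?A"
    then have "0 < x" by (auto simp: nonneg_part_def)
    then show "\<exists>y\<in>universe ?A. x = arith_suc ?A y"
      using one_least_positive[of x] by (intro bexI[of _ "x - 1"]) (auto simp: nonneg_part_def)
  qed
  show "\<forall>x\<in>universe ?A. \<forall>y\<in>universe ?A. arith_le ?A x y = (\<exists>r\<in>universe ?A. arith_add ?A r x = y)"
  proof safe
    fix x y assume "arith_le ?A x y"
    then show "\<exists>r\<in>universe ?A. arith_add ?A r x = y"
      by (intro bexI[of _ "y - x"]) (auto simp: nonneg_part_def)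
  qed (auto simp: nonneg_part_def)
qed (auto simp: nonneg_part_def algebra_simps)

end

section \<open>The axioms on powers from the exponential laws\<close>

locale exp_integer_part_subfield = integer_part_subfield \<iota> S
  for \<iota> :: "'a::discretely_ordered_ring \<Rightarrow> 'k::linordered_field" and S :: "'k set" +
  fixes e lg :: "'k \<Rightarrow> 'k" and pw :: "'a \<Rightarrow> 'a \<Rightarrow> 'a"
  assumes e_in: "x \<in> S \<Longrightarrow> e x \<in> S"
    and e_pos: "x \<in> S \<Longrightarrow> 0 < e x"
    and e_add: "x \<in> S \<Longrightarrow> y \<in> S \<Longrightarrow> e (x + y) = e x * e y"
    and e_mono: "x \<in> S \<Longrightarrow> y \<in> S \<Longrightarrow> x \<le> y \<Longrightarrow> e x \<le> e y"
    and lg_in: "x \<in> S \<Longrightarrow> 0 < x \<Longrightarrow> lg x \<in> S"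
    and e_lg: "x \<in> S \<Longrightarrow> 0 < x \<Longrightarrow> e (lg x) = x"
    and lg_e: "x \<in> S \<Longrightarrow> lg (e x) = x"
    and bernoulli: "x \<in> S \<Longrightarrow> y \<in> S \<Longrightarrow> 0 < x \<Longrightarrow> 1 \<le> y \<Longrightarrow> 1 + x * y \<le> e (y * lg (1 + x))"
    and pw_eq: "0 < n \<Longrightarrow> 0 \<le> m \<Longrightarrow> \<iota> (pw n m) = e (\<iota> m * lg (\<iota> n))"
    and pw_0_0: "pw 0 0 = 1"
    and pw_0: "0 < m \<Longrightarrow> pw 0 m = 0"
begin

lemma e_less_iff: "x \<in> S \<Longrightarrow> y \<in> S \<Longrightarrow> e x < e y \<longleftrightarrow> x < y"
  using e_mono lg_e by (metis leD leI order_less_le)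

lemma e_le_iff: "x \<in> S \<Longrightarrow> y \<in> S \<Longrightarrow> e x \<le> e y \<longleftrightarrow> x \<le> y"
  using e_less_iff[of y x] by (simp add: not_less[symmetric])

lemma e_0: "e 0 = 1"
  using e_add[of 0 0] e_pos[of 0] closed(1) by simp

lemma lg_1: "lg 1 = 0"
  using lg_e[of 0] e_0 closed(1) by simp

lemma lg_mult:
  assumes "x \<in> S" "y \<in> S" "0 < x" "0 < y"
  shows "lg (x * y) = lg x + lg y"
  using assms lg_e[of "lg x + lg y"] e_add[of "lg x" "lg y"] by (simp add: closed(3) lg_in e_lg)

lemma lg_le_iff: "x \<in> S \<Longrightarrow> y \<in> S \<Longrightarrow> 0 < x \<Longrightarrow> 0 < y \<Longrightarrow> lg x \<le> lg y \<longleftrightarrow> x \<le> y"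
  using e_le_iff[of "lg x" "lg y"] by (simp add: e_lg lg_in)

lemma lg_less_iff: "x \<in> S \<Longrightarrow> y \<in> S \<Longrightarrow> 0 < x \<Longrightarrow> 0 < y \<Longrightarrow> lg x < lg y \<longleftrightarrow> x < y"
  using lg_le_iff[of y x] by (simp add: not_le[symmetric])

lemma lg_pos_iff: "x \<in> S \<Longrightarrow> 0 < x \<Longrightarrow> 0 < lg x \<longleftrightarrow> 1 < x"
  using lg_less_iff[of 1 x] closed(2) by (simp add: lg_1)

abbreviation ell :: "'a \<Rightarrow> 'k" where "ell n \<equiv> lg (\<iota> n)"

lemma l_in: "0 < n \<Longrightarrow> ell n \<in> S"
  by (simp add: lg_in)

lemma l_mult: "0 < m \<Longrightarrow> 0 < n \<Longrightarrow> ell (m * n) = ell m + ell n"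
  by (simp add: lg_mult)

lemma pw_pos: "0 < n \<Longrightarrow> 0 \<le> m \<Longrightarrow> 0 < pw n m"
  using pw_eq[of n m] e_pos[of "\<iota> m * ell n"] closed(5) l_in by (metis in_S zero_less_iff)

lemma l_pw: "0 < n \<Longrightarrow> 0 \<le> m \<Longrightarrow> ell (pw n m) = \<iota> m * ell n"
  using pw_eq[of n m] by (simp add: lg_e closed(5) l_in)

lemma l_le_iff: "0 < m \<Longrightarrow> 0 < n \<Longrightarrow> ell m \<le> ell n \<longleftrightarrow> m \<le> n"
  by (simp add: lg_le_iff)

lemma l_less_iff: "0 < m \<Longrightarrow> 0 < n \<Longrightarrow> ell m < ell n \<longleftrightarrow> m < n"
  by (simp add: lg_less_iff)

lemma l_inj: "0 < m \<Longrightarrow> 0 < n \<Longrightarrow> ell m = ell n \<Longrightarrow> m = n"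
  using l_less_iff by (metis linorder_neqE less_irrefl)

lemma pw_zero_left: "0 \<le> m \<Longrightarrow> pw 0 m = (if m = 0 then 1 else 0)"
  using pw_0_0 pw_0 by auto

lemma pw_nonneg: "0 \<le> n \<Longrightarrow> 0 \<le> m \<Longrightarrow> 0 \<le> pw n m"
  using pw_pos[of n m] by (cases "n = 0") (auto simp: pw_zero_left)

lemma pw_T1: "0 \<le> x \<Longrightarrow> pw x 0 = 1"
  using l_inj[of "pw x 0" 1] pw_pos[of x 0] l_pw[of x 0] by (cases "x = 0") (auto simp: pw_0_0 lg_1)

lemma pw_T2: "0 \<le> x \<Longrightarrow> pw x 1 = x"
  using l_inj[of "pw x 1" x] pw_pos[of x 1] l_pw[of x 1] by (cases "x = 0") (auto simp: pw_0)

lemma pw_T3: "0 \<le> x \<Longrightarrow> pw 1 x = 1"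
  using l_inj[of "pw 1 x" 1] pw_pos[of 1 x] l_pw[of 1 x] by (auto simp: lg_1)

lemma pw_T4: "0 \<le> x \<Longrightarrow> 0 \<le> y \<Longrightarrow> 0 \<le> z \<Longrightarrow> pw x (y + z) = pw x y * pw x z"
  using l_inj[of "pw x (y + z)" "pw x y * pw x z"] pw_pos[of x y] pw_pos[of x z] pw_pos[of x "y + z"]
  by (cases "x = 0") (auto simp: pw_zero_left add_nonneg_eq_0_iff lg_mult l_pw distrib_right)

lemma pw_T5: "0 \<le> x \<Longrightarrow> 0 \<le> y \<Longrightarrow> 0 \<le> z \<Longrightarrow> pw (x * y) z = pw x z * pw y z"
  using l_inj[of "pw (x * y) z" "pw x z * pw y z"] pw_pos[of x z] pw_pos[of y z] pw_pos[of "x * y" z]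
    l_pw[of "x * y" z]
  by (cases "x = 0"; cases "y = 0") (auto simp: pw_zero_left pw_T1 lg_mult l_pw distrib_left)

lemma pw_T6: "0 \<le> x \<Longrightarrow> 0 \<le> y \<Longrightarrow> 0 \<le> z \<Longrightarrow> pw (pw x y) z = pw x (y * z)"
  using l_inj[of "pw (pw x y) z" "pw x (y * z)"] pw_pos[of x y] pw_pos[of x "y * z"] pw_pos[of "pw x y" z]
    l_pw[of x "y * z"]
  by (cases "x = 0") (auto simp: pw_zero_left pw_T3 l_pw)

lemma pw_T7: "1 < x \<Longrightarrow> 0 \<le> y \<Longrightarrow> 0 \<le> z \<Longrightarrow> y < z \<longleftrightarrow> pw x y < pw x z"
  using l_less_iff[of "pw x y" "pw x z"] pw_pos[of x y] pw_pos[of x z] lg_pos_iff[of "\<iota> x"] less_iff[of 1 x]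
  by (simp add: l_pw del: less_iff) simp

lemma pw_T8: "0 < x \<Longrightarrow> 0 \<le> y \<Longrightarrow> 0 \<le> z \<Longrightarrow> y < z \<longleftrightarrow> pw y x < pw z x"
  using l_less_iff[of "pw y x" "pw z x"] pw_pos[of y x] pw_pos[of z x]
  by (cases "y = 0"; cases "z = 0") (auto simp: pw_0 l_pw l_less_iff)

lemma pw_T9:
  assumes "0 < k"
  shows "\<exists>d\<ge>0. pw 2 d \<le> k \<and> k < pw 2 (d + 1)"
proof -
  have "1 \<le> k" using assms one_least_positive by blast
  then have k: "0 \<le> ell k" using lg_le_iff[of 1 "\<iota> k"] closed(2) assms by (simp add: lg_1)
  have l2: "0 < ell 2" using l_less_iff[of 1 2] by (simp add: lg_1)
  obtain d where d: "\<iota> d \<le> ell k / ell 2" "ell k / ell 2 < \<iota> (d + 1)"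
    using floor_exists[of "ell k / ell 2"] closed(8) l_in assms by force
  have "0 \<le> ell k / ell 2" using k l2 by simp
  then have "0 < \<iota> (d + 1)" using d by linarith
  then have d0: "d \<ge> 0"
    unfolding zero_less_iff using discretely_ordered_less_iff[of 0 "d + 1"] by simp
  have "ell (pw 2 d) \<le> ell k" "ell k < ell (pw 2 (d + 1))"
    using d d0 l2 by (auto simp: l_pw field_simps simp del: add)
  then have "pw 2 d \<le> k \<and> k < pw 2 (d + 1)"
    using pw_pos[of 2 d] pw_pos[of 2 "d + 1"] assms d0 by (simp add: lg_le_iff lg_less_iff del: add)
  with d0 show ?thesis by blast
qed

text \<open>\<open>m\<close> is the integer part of the \<open>c\<close>-th root of
  \<open>x\<close>, computed as \<open>e (ell x / \<iota> c)\<close>. The case \<open>x = 0\<close>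
  is separate because 0 has no logarithm.\<close>

lemma pw_T10:
  assumes "0 \<le> x" "0 < c"
  shows "\<exists>m\<ge>0. pw m c \<le> x \<and> x < pw (m + 1) c"
proof (cases "x = 0")
  case True
  then show ?thesis using assms pw_0[of c] pw_T3[of c] by (intro exI[of _ 0]) auto
next
  case False
  then have x: "1 \<le> x" "0 < x" using assms one_least_positive[of x] by auto
  then have lx: "0 \<le> ell x" using lg_le_iff[of 1 "\<iota> x"] closed(2) by (simp add: lg_1)
  define r where "r = ell x / \<iota> c"
  have r: "r \<in> S" "0 \<le> r" using lx assms x by (auto simp: r_def closed(8) l_in)
  have e1: "1 \<le> e r" using e_le_iff[of 0 r] r closed(1) by (simp add: e_0)
  obtain m where m: "\<iota> m \<le> e r" "e r < \<iota> (m + 1)" using floor_exists e_in r by blast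
  have "1 < \<iota> (m + 1)" using e1 m by linarith
  then have m1: "0 < m" using less_iff[of 1 "m + 1"] by simp
  have "ell m \<le> r" "r < ell (m + 1)"
  proof -
    have "0 < \<iota> m" "0 < \<iota> (m + 1)" using m1 by (simp_all add: add_pos_pos)
    then have "ell m \<le> lg (e r)" "lg (e r) < ell (m + 1)"
      using lg_le_iff[OF in_S e_in _ e_pos] lg_less_iff[OF e_in in_S e_pos] m r(1) by blast+
    then show "ell m \<le> r" "r < ell (m + 1)" using r(1) by (simp_all only: lg_e)
  qed
  then have "ell (pw m c) \<le> ell x" "ell x < ell (pw (m + 1) c)"
    using m1 assms by (auto simp: l_pw r_def field_simps simp del: add)
  then have "pw m c \<le> x \<and> x < pw (m + 1) c"
    using pw_pos[of m c] pw_pos[of "m + 1" c] assms x m1 by (simp add: lg_le_iff lg_less_iff del: add)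
  with m1 show ?thesis by (meson less_imp_le)
qed

text \<open>This is Bernoulli's inequality for \<open>a / b\<close> and the exponent
  \<open>x / y\<close>, raised to the power \<open>y\<close> and cleared of denominators. In terms
  of logarithms, raising to the power \<open>y\<close> is multiplication by
  \<open>\<iota> y\<close>.\<close>

lemma pw_T11:
  assumes "0 < a" "0 < b" "0 < y" "y \<le> x"
  shows "pw (b * y + a * x) y * pw b x \<le> pw (b + a) x * pw (b * y) y"
proof -
  have x: "0 < x" using assms by simp
  have pos: "0 < b * y + a * x" "0 < b + a" "0 < b * y"
    using assms x by (auto intro: add_pos_pos)
  define s t where "s = \<iota> a / \<iota> b" and "t = \<iota> x / \<iota> y"
  have st: "s \<in> S" "t \<in> S" "0 < s" "1 \<le> t"
    using assms by (auto simp: s_def t_def closed(8))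
  have "1 + s * t \<le> e (t * lg (1 + s))" using bernoulli st by blast
  moreover have S: "1 + s * t \<in> S" "1 + s \<in> S" "0 < 1 + s * t" "0 < 1 + s" "t * lg (1 + s) \<in> S"
    using st by (auto simp: closed(2,3,5) lg_in intro: add_pos_pos mult_pos_pos)
  ultimately have "lg (1 + s * t) \<le> t * lg (1 + s)"
    using e_le_iff[of "lg (1 + s * t)" "t * lg (1 + s)"] by (simp add: e_lg lg_in)
  then have "\<iota> y * lg (1 + s * t) \<le> \<iota> y * (t * lg (1 + s))"
    using assms by (intro mult_left_mono) auto
  then have *: "\<iota> y * lg (1 + s * t) \<le> \<iota> x * lg (1 + s)"
    using assms by (simp add: t_def)
  have "\<iota> (b * y + a * x) = \<iota> (b * y) * (1 + s * t)" "\<iota> (b + a) = \<iota> b * (1 + s)"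
    using assms by (simp_all add: s_def t_def field_simps)
  then have l: "ell (b * y + a * x) = ell (b * y) + lg (1 + s * t)" "ell (b + a) = ell b + lg (1 + s)"
    using lg_mult[OF in_S S(1), of "b * y"] lg_mult[OF in_S S(2), of b] S pos assms
    by (simp_all only: zero_less_iff)
  have "ell (pw (b * y + a * x) y * pw b x) = \<iota> y * ell (b * y + a * x) + \<iota> x * ell b"
    using assms pos x pw_pos[of "b * y + a * x" y] pw_pos[of b x] by (subst l_mult) (auto simp: l_pw)
  moreover have "ell (pw (b + a) x * pw (b * y) y) = \<iota> x * ell (b + a) + \<iota> y * ell (b * y)"
    using assms pos x pw_pos[of "b + a" x] pw_pos[of "b * y" y] by (subst l_mult) (auto simp: l_pw)
  ultimately have "ell (pw (b * y + a * x) y * pw b x) \<le> ell (pw (b + a) x * pw (b * y) y)"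
    using * unfolding l by (simp add: algebra_simps del: add mult)
  then show ?thesis
    using assms pos x pw_pos[of "b * y + a * x" y] pw_pos[of b x] pw_pos[of "b + a" x] pw_pos[of "b * y" y]
    by (subst (asm) l_le_iff) auto
qed

theorem T_xy_model_nonneg_part: "T_xy_model (nonneg_part pw)"
proof -
  show ?thesis
  proof (unfold_locales, unfold nonneg_part_simps Ball_def Bex_def mem_Collect_eq add_0_left one_add_one, goal_cases)
    case 7 show ?case using pw_T7 by blast
  next
    case 8 show ?case using pw_T8 by blast
  next
    case 9 show ?case using pw_T9 by blast
  next
    case 10 show ?case using pw_T10 by blast
  next
    case 11 show ?case using pw_T11 by blast
  qed (simp_all add: pw_T1 pw_T2 pw_T3 pw_T4 pw_T5 pw_T6)
qed

end

section \<open>Embedding an ordered field into the completion\<close>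

context linearly_ordered_field
begin

lemma le_iff_diff: "x \<in> carrier R \<Longrightarrow> y \<in> carrier R \<Longrightarrow> x \<preceq> y \<longleftrightarrow> \<zero> \<preceq> y \<ominus> x"
  using le_add[of x y "\<ominus> x"] le_add[of \<zero> "y \<ominus> x" x]
  by (auto simp: r_neg minus_eq a_assoc l_neg)

lemma mult_right_mono:
  assumes "x \<in> carrier R" "y \<in> carrier R" "z \<in> carrier R" "x \<preceq> y" "\<zero> \<preceq> z"
  shows "x \<otimes> z \<preceq> y \<otimes> z"
proof -
  have "\<zero> \<preceq> (y \<ominus> x) \<otimes> z"
    using assms by (intro le_mult) (auto simp: le_iff_diff[symmetric])
  also have "(y \<ominus> x) \<otimes> z = y \<otimes> z \<ominus> x \<otimes> z"
    using assms by (simp add: minus_eq l_distr l_minus)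
  finally show ?thesis using assms by (subst le_iff_diff) auto
qed

lemma mult_mono_nonneg:
  assumes "x \<in> carrier R" "y \<in> carrier R" "z \<in> carrier R" "w \<in> carrier R"
    "x \<preceq> y" "z \<preceq> w" "\<zero> \<preceq> z" "\<zero> \<preceq> y"
  shows "x \<otimes> z \<preceq> y \<otimes> w"
proof (rule le_trans[of _ "y \<otimes> z"])
  show "y \<otimes> z \<preceq> y \<otimes> w"
    using mult_right_mono[of z w y] assms by (simp add: m_comm)
qed (use assms mult_right_mono in auto)

lemma add_mono:
  assumes "x \<in> carrier R" "y \<in> carrier R" "z \<in> carrier R" "w \<in> carrier R" "x \<preceq> y" "z \<preceq> w"
  shows "x \<oplus> z \<preceq> y \<oplus> w"
proof (rule le_trans[of _ "y \<oplus> z"])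
  show "y \<oplus> z \<preceq> y \<oplus> w"
    using le_add[of z w y] assms by (simp add: a_comm)
qed (use assms le_add in auto)

lemma nonneg_uminus: "x \<in> carrier R \<Longrightarrow> \<not> \<zero> \<preceq> x \<Longrightarrow> \<zero> \<preceq> \<ominus> x"
  using le_total[of \<zero> x] le_add[of x \<zero> "\<ominus> x"] by (auto simp: r_neg)

end

text \<open>Carrier polynomials are lists with the leading coefficient first, whereas
  \<open>Poly\<close> reads the constant coefficient first; hence the reversal.\<close>

lemma (in cring) eval_hom:
  assumes hom: "\<And>x y. x \<in> carrier R \<Longrightarrow> y \<in> carrier R \<Longrightarrow> h (x \<oplus> y) = h x + h y"
    "\<And>x y. x \<in> carrier R \<Longrightarrow> y \<in> carrier R \<Longrightarrow> h (x \<otimes> y) = h x * h y"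
    "h \<zero> = 0" "h \<one> = 1"
    and x: "x \<in> carrier R" and p: "set p \<subseteq> carrier R"
  shows "h (eval p x) = poly (Poly (rev (map h p))) (h x :: 'q::comm_ring_1)"
proof -
  have pow: "h (x [^] (n::nat)) = h x ^ n" for n
    using x by (induction n) (auto simp: hom mult.commute)
  show ?thesis
    using p
  proof (induction p)
    case Nil
    then show ?case by (simp add: hom)
  next
    case (Cons a p)
    then have "eval p x \<in> carrier R" using x eval_in_carrier by auto
    then show ?case
      using Cons x by (simp add: hom pow Poly_append poly_monom)
  qed
qed

section \<open>Dense fractions and filled cuts\<close>

text \<open>From here on the completion is used through these two properties alone. Bounded
  completeness is not among them: a cut has to have arbitrarily small gaps in order to be
  filled.\<close>

locale complete_extension = embedded_ring \<iota>
  for \<iota> :: "'a::discretely_ordered_ring \<Rightarrow> 'k::linordered_field" +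
  assumes fraction_dense: "x < y \<Longrightarrow> \<exists>a b. 0 < b \<and> x < \<iota> a / \<iota> b \<and> \<iota> a / \<iota> b < y"
    and cut_complete: "\<lbrakk>\<And>a b :: 'k. a \<in> A \<Longrightarrow> b \<in> B \<Longrightarrow> a \<le> b; \<And>e. 0 < e \<Longrightarrow> \<exists>a\<in>A. \<exists>b\<in>B. b - a < e\<rbrakk>
      \<Longrightarrow> \<exists>x. (\<forall>a\<in>A. a \<le> x) \<and> (\<forall>b\<in>B. x \<le> b)"
begin

lemma inverse_small:
  assumes "0 < e"
  shows "\<exists>c>0. 1 / \<iota> c < e"
proof -
  obtain a b where ab: "0 < b" "0 < \<iota> a / \<iota> b" "\<iota> a / \<iota> b < e"
    using fraction_dense[OF assms] by blast
  then have "0 < a" by (simp add: pos_less_divide_eq)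
  then have "1 \<le> \<iota> a" by (simp add: one_least_positive)
  then have "1 / \<iota> b \<le> \<iota> a / \<iota> b" using ab by (simp add: divide_right_mono)
  then show ?thesis using ab by (intro exI[of _ b]) auto
qed

lemma unbounded: "\<exists>c>0. x < \<iota> c"
proof -
  obtain c where "0 < c" "1 / \<iota> c < 1 / (\<bar>x\<bar> + 1)"
    using inverse_small[of "1 / (\<bar>x\<bar> + 1)"] by (auto simp: add_nonneg_pos)
  then have "\<bar>x\<bar> + 1 < \<iota> c" by (simp add: field_simps)
  then show ?thesis using \<open>0 < c\<close> by (intro exI[of _ c]) auto
qed

text \<open>The image of \<open>M\<close> is cofinal, so 0 is the only element bounded by
  \<open>y / \<iota> c\<close> for all \<open>c\<close>. Equations between elements known through
  approximations are proved in this form, with a bound \<open>y\<close> independent of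
  \<open>c\<close>.\<close>

lemma zero_if_small:
  assumes "\<And>c. 0 < c \<Longrightarrow> \<bar>x\<bar> * \<iota> c \<le> y"
  shows "x = 0"
proof (rule ccontr)
  assume "x \<noteq> 0"
  moreover obtain c where "0 < c" "y / \<bar>x\<bar> < \<iota> c" using unbounded by blast
  ultimately show False using assms[of c] by (simp add: field_simps)
qed

end

interpretation fract_completion: complete_extension
  "\<lambda>x :: 'a::discretely_ordered_ring. of_base (to_fract x)"
proof
  fix x y :: 'a
  show "of_base (to_fract x) \<le> of_base (to_fract y) \<longleftrightarrow> x \<le> y"
    by (simp add: to_fract_def)
next
  fix x y :: "'a fract completion" assume "x < y"
  then obtain q where q: "x < of_base q" "of_base q < y" using of_base_dense by blast
  obtain a b where "b > 0" "q = Fract a b" by (induction q rule: fract_induct_pos) auto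
  then show "\<exists>a b. 0 < b \<and> x < of_base (to_fract a) / of_base (to_fract b)
      \<and> of_base (to_fract a) / of_base (to_fract b) < y"
    using q by (intro exI[of _ a] exI[of _ b]) (simp add: Fract_conv_to_fract)
next
  fix A B :: "'a fract completion set"
  assume "\<And>a b. a \<in> A \<Longrightarrow> b \<in> B \<Longrightarrow> a \<le> b" "\<And>e. 0 < e \<Longrightarrow> \<exists>a\<in>A. \<exists>b\<in>B. b - a < e"
  then show "\<exists>x. (\<forall>a\<in>A. a \<le> x) \<and> (\<forall>b\<in>B. x \<le> b)" by (rule completion_complete)
qed auto

locale integer_part_embedding = complete_extension \<iota> + R: linearly_ordered_field R
  for \<iota> :: "'a::discretely_ordered_ring \<Rightarrow> 'k::linordered_field"
    and R :: "('r, 'm) ordered_ring_scheme" (structure) +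
  fixes J :: "'a \<Rightarrow> 'r"
  assumes integer_part: "integer_part R J"
begin

lemma J_in [simp]: "J a \<in> carrier R"
  and J_0: "J 0 = \<zero>" and J_1: "J 1 = \<one>"
  and J_add: "J (a + b) = J a \<oplus> J b"
  and J_mult: "J (a * b) = J a \<otimes> J b"
  and J_le_iff: "J a \<preceq> J b \<longleftrightarrow> a \<le> b"
  using integer_part by (auto simp: integer_part_def ordered_ring_embedding_def)

lemma J_nonneg: "0 \<le> a \<Longrightarrow> \<zero> \<preceq> J a"
  using J_le_iff[of 0 a] by (simp add: J_0)

lemma J_floor: "r \<in> carrier R \<Longrightarrow> \<exists>m. J m \<preceq> r \<and> r \<preceq> J (m + 1) \<and> r \<noteq> J (m + 1)"
  using integer_part by (force simp: integer_part_def ring_less_def)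

text \<open>Equal position relative to every fraction \<open>a / b\<close>, with denominators
  cleared so that no division in \<open>R\<close> occurs.\<close>

definition represents :: "'r \<Rightarrow> 'k \<Rightarrow> bool" where
  "represents r x \<longleftrightarrow> (\<forall>a b. 0 < b \<longrightarrow> (J a \<preceq> r \<otimes> J b \<longrightarrow> \<iota> a \<le> x * \<iota> b)
     \<and> (r \<otimes> J b \<preceq> J a \<longrightarrow> x * \<iota> b \<le> \<iota> a))"

lemma represents_exists:
  assumes r: "r \<in> carrier R"
  shows "\<exists>x. represents r x"
proof -
  define A where "A = {\<iota> a / \<iota> b | a b. 0 < b \<and> J a \<preceq> r \<otimes> J b}"
  define B where "B = {\<iota> a / \<iota> b | a b. 0 < b \<and> r \<otimes> J b \<preceq> J a}"
  have "\<exists>x. (\<forall>a\<in>A. a \<le> x) \<and> (\<forall>b\<in>B. x \<le> b)"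
  proof (rule cut_complete)
    fix x y assume "x \<in> A" "y \<in> B"
    then obtain a b c d where x: "x = \<iota> a / \<iota> b" "0 < b" "J a \<preceq> r \<otimes> J b"
      and y: "y = \<iota> c / \<iota> d" "0 < d" "r \<otimes> J d \<preceq> J c" by (auto simp: A_def B_def)
    have "J a \<otimes> J d \<preceq> (r \<otimes> J b) \<otimes> J d"
      using x y r by (intro R.mult_right_mono J_nonneg) auto
    moreover have "(r \<otimes> J d) \<otimes> J b \<preceq> J c \<otimes> J b"
      using x y r by (intro R.mult_right_mono J_nonneg) auto
    moreover have "(r \<otimes> J d) \<otimes> J b = (r \<otimes> J b) \<otimes> J d"
      using r by (simp add: R.m_ac)
    ultimately have "J a \<otimes> J d \<preceq> J c \<otimes> J b"
      using r R.le_trans[of "J a \<otimes> J d" "(r \<otimes> J b) \<otimes> J d" "J c \<otimes> J b"] by auto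
    then have "a * d \<le> c * b" by (simp flip: J_mult add: J_le_iff)
    then have "\<iota> (a * d) \<le> \<iota> (c * b)" by (simp only: le_iff)
    then show "x \<le> y" using x y by (simp add: pos_divide_le_eq pos_le_divide_eq)
  next
    fix e :: 'k assume "0 < e"
    then obtain c where c: "0 < c" "1 / \<iota> c < e" using inverse_small by blast
    obtain m where m: "J m \<preceq> r \<otimes> J c" "r \<otimes> J c \<preceq> J (m + 1)"
      using J_floor[of "r \<otimes> J c"] r by auto
    have "\<iota> m / \<iota> c \<in> A" "\<iota> (m + 1) / \<iota> c \<in> B"
      using m c by (auto simp: A_def B_def simp del: add)
    moreover have "\<iota> (m + 1) / \<iota> c - \<iota> m / \<iota> c < e"
      using c by (simp add: diff_divide_distrib[symmetric])
    ultimately show "\<exists>a\<in>A. \<exists>b\<in>B. b - a < e" by blast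
  qed
  then obtain x where x: "\<And>a. a \<in> A \<Longrightarrow> a \<le> x" "\<And>b. b \<in> B \<Longrightarrow> x \<le> b" by blast
  have "represents r x"
    unfolding represents_def
  proof (intro allI impI conjI)
    fix a b :: 'a assume b: "0 < b"
    show "\<iota> a \<le> x * \<iota> b" if "J a \<preceq> r \<otimes> J b"
      using x(1)[of "\<iota> a / \<iota> b"] b that by (auto simp: A_def pos_divide_le_eq)
    show "x * \<iota> b \<le> \<iota> a" if "r \<otimes> J b \<preceq> J a"
      using x(2)[of "\<iota> a / \<iota> b"] b that by (auto simp: B_def pos_le_divide_eq)
  qed
  then show ?thesis ..
qed

definition emb :: "'r \<Rightarrow> 'k" where
  "emb r = (SOME x. represents r x)"

lemma emb_lower: "r \<in> carrier R \<Longrightarrow> 0 < b \<Longrightarrow> J a \<preceq> r \<otimes> J b \<Longrightarrow> \<iota> a \<le> emb r * \<iota> b"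
  and emb_upper: "r \<in> carrier R \<Longrightarrow> 0 < b \<Longrightarrow> r \<otimes> J b \<preceq> J a \<Longrightarrow> emb r * \<iota> b \<le> \<iota> a"
  using someI_ex[OF represents_exists] by (auto simp: emb_def represents_def)

text \<open>\<open>m\<close> is the integer part of \<open>r\<close> scaled by \<open>c\<close>, so
  \<open>r\<close> and \<open>emb r\<close> lie in corresponding intervals of length
  \<open>1 / c\<close>. The last clause serves products, where the bounds have to be nonnegative to
  be multiplied.\<close>

lemma emb_bracket:
  assumes "r \<in> carrier R" "0 < c"
  obtains m where "J m \<preceq> r \<otimes> J c" "r \<otimes> J c \<preceq> J (m + 1)" "\<iota> m \<le> emb r * \<iota> c" "emb r * \<iota> c \<le> \<iota> m + 1"
    "\<zero> \<preceq> r \<longrightarrow> 0 \<le> m"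
proof -
  obtain m where m: "J m \<preceq> r \<otimes> J c" "r \<otimes> J c \<preceq> J (m + 1)" "r \<otimes> J c \<noteq> J (m + 1)"
    using J_floor[of "r \<otimes> J c"] assms by auto
  have "0 \<le> m" if "\<zero> \<preceq> r"
  proof -
    have rc: "\<zero> \<preceq> r \<otimes> J c" using that assms J_nonneg[of c] R.le_mult by auto
    then have "\<zero> \<preceq> J (m + 1)" using R.le_trans[OF _ _ _ rc m(2)] assms by simp
    then have "0 \<le> m + 1" using J_le_iff[of 0 "m + 1"] by (simp add: J_0)
    moreover have "m + 1 \<noteq> 0"
      using m R.le_antisym[OF _ _ m(2)] rc assms by (auto simp: J_0)
    ultimately show ?thesis using discretely_ordered_less_iff[of 0 "m + 1"] by (simp add: order_less_le)
  qed
  with m show ?thesis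
    using that[of m] emb_lower[of r c m] emb_upper[of r c "m + 1"] assms by simp
qed

lemma emb_J: "emb (J a) = \<iota> a"
  using emb_lower[of "J a" 1 a] emb_upper[of "J a" 1 a] R.le_refl[of "J a"] by (simp add: J_1)

lemma emb_0: "emb \<zero> = 0" and emb_1: "emb \<one> = 1"
  using emb_J[of 0] emb_J[of 1] by (simp_all add: J_0 J_1)

lemma emb_add:
  assumes r: "r \<in> carrier R" and s: "s \<in> carrier R"
  shows "emb (r \<oplus> s) = emb r + emb s"
proof -
  have "emb (r \<oplus> s) - (emb r + emb s) = 0"
  proof (rule zero_if_small)
    fix c :: 'a assume c: "0 < c"
    obtain m where m: "J m \<preceq> r \<otimes> J c" "r \<otimes> J c \<preceq> J (m + 1)" "\<iota> m \<le> emb r * \<iota> c" "emb r * \<iota> c \<le> \<iota> m + 1"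
      by (rule emb_bracket[OF r c])
    obtain n where n: "J n \<preceq> s \<otimes> J c" "s \<otimes> J c \<preceq> J (n + 1)" "\<iota> n \<le> emb s * \<iota> c" "emb s * \<iota> c \<le> \<iota> n + 1"
      by (rule emb_bracket[OF s c])
    have "J (m + n) \<preceq> (r \<oplus> s) \<otimes> J c"
      using R.add_mono[OF _ _ _ _ m(1) n(1)] r s by (simp add: J_add R.l_distr)
    then have 1: "\<iota> (m + n) \<le> emb (r \<oplus> s) * \<iota> c" using emb_lower c r s by (simp del: add)
    have "(r \<oplus> s) \<otimes> J c \<preceq> J ((m + 1) + (n + 1))"
      using R.add_mono[OF _ _ _ _ m(2) n(2)] r s by (simp only: J_add[of "m + 1" "n + 1"]) (simp add: R.l_distr)
    then have 2: "emb (r \<oplus> s) * \<iota> c \<le> \<iota> ((m + 1) + (n + 1))" using emb_upper c r s by (simp del: add)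
    have "\<bar>emb (r \<oplus> s) - (emb r + emb s)\<bar> * \<iota> c = \<bar>(emb (r \<oplus> s) - (emb r + emb s)) * \<iota> c\<bar>"
      using c by (simp add: abs_mult)
    also have "\<dots> \<le> 2"
      using 1 2 m(3,4) n(3,4) by (simp add: algebra_simps abs_le_iff hom_numeral)
    finally show "\<bar>emb (r \<oplus> s) - (emb r + emb s)\<bar> * \<iota> c \<le> 2" .
  qed
  then show ?thesis by simp
qed

lemma emb_uminus: "r \<in> carrier R \<Longrightarrow> emb (\<ominus> r) = - emb r"
  using emb_add[of r "\<ominus> r"] by (simp add: R.r_neg emb_0 eq_neg_iff_add_eq_0 add.commute)

lemma emb_nonneg: "r \<in> carrier R \<Longrightarrow> \<zero> \<preceq> r \<Longrightarrow> 0 \<le> emb r"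
  using emb_lower[of r 1 0] by (simp add: J_0 J_1)

text \<open>Scaled by \<open>c * c\<close>, both sides lie between \<open>m * n\<close> and
  \<open>(m + 1) * (n + 1)\<close>. They differ by at most \<open>m + n + 1\<close>, which is at
  most a constant times \<open>c\<close>; dividing by \<open>c\<close> leaves one factor
  \<open>c\<close> for \<open>zero_if_small\<close>.\<close>

lemma emb_mult_nonneg:
  assumes r: "r \<in> carrier R" "\<zero> \<preceq> r" and s: "s \<in> carrier R" "\<zero> \<preceq> s"
  shows "emb (r \<otimes> s) = emb r * emb s"
proof -
  have "emb (r \<otimes> s) - emb r * emb s = 0"
  proof (rule zero_if_small)
    fix c :: 'a assume c: "0 < c"
    obtain m where m: "J m \<preceq> r \<otimes> J c" "r \<otimes> J c \<preceq> J (m + 1)" "\<iota> m \<le> emb r * \<iota> c" "emb r * \<iota> c \<le> \<iota> m + 1"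
      "\<zero> \<preceq> r \<longrightarrow> 0 \<le> m"
      by (rule emb_bracket[OF r(1) c])
    obtain n where n: "J n \<preceq> s \<otimes> J c" "s \<otimes> J c \<preceq> J (n + 1)" "\<iota> n \<le> emb s * \<iota> c" "emb s * \<iota> c \<le> \<iota> n + 1"
      "\<zero> \<preceq> s \<longrightarrow> 0 \<le> n"
      by (rule emb_bracket[OF s(1) c])
    have rc: "\<zero> \<preceq> r \<otimes> J c" and sc: "\<zero> \<preceq> s \<otimes> J c"
      using r s c J_nonneg[of c] R.le_mult by auto
    have mn: "0 \<le> m" "0 \<le> n" using m(5) n(5) r s by auto
    have assoc: "(r \<otimes> J c) \<otimes> (s \<otimes> J c) = (r \<otimes> s) \<otimes> J (c * c)"
      using r s by (simp add: J_mult R.m_ac)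
    have "(r \<otimes> J c) \<otimes> (s \<otimes> J c) \<preceq> J (m + 1) \<otimes> J (n + 1)"
      using mn m n r s sc by (intro R.mult_mono_nonneg J_nonneg) auto
    then have "(r \<otimes> s) \<otimes> J (c * c) \<preceq> J ((m + 1) * (n + 1))"
      unfolding assoc J_mult[of "m + 1" "n + 1"] .
    then have 2: "emb (r \<otimes> s) * \<iota> (c * c) \<le> \<iota> ((m + 1) * (n + 1))"
      using c r s by (intro emb_upper) auto
    have "J m \<otimes> J n \<preceq> (r \<otimes> J c) \<otimes> (s \<otimes> J c)"
      using mn m n r s rc by (intro R.mult_mono_nonneg J_nonneg) auto
    then have "J (m * n) \<preceq> (r \<otimes> s) \<otimes> J (c * c)"
      unfolding assoc J_mult[of m n] .
    then have 1: "\<iota> (m * n) \<le> emb (r \<otimes> s) * \<iota> (c * c)"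
      using c r s by (intro emb_lower) auto
    define p q x where "p = emb r * \<iota> c" and "q = emb s * \<iota> c" and "x = emb (r \<otimes> s) * \<iota> (c * c)"
    have "\<iota> m * \<iota> n \<le> p * q" "p * q \<le> (\<iota> m + 1) * (\<iota> n + 1)"
      using m n mn order_trans[OF _ m(3), of 0] order_trans[OF _ n(3), of 0] unfolding p_def q_def
      by (auto intro!: mult_mono simp del: mult_nonneg_nonneg)
    then have "\<bar>x - p * q\<bar> \<le> \<iota> m + \<iota> n + 1"
      using 1 2 unfolding x_def[symmetric] by (simp add: algebra_simps abs_le_iff)
    also have "\<dots> \<le> (emb r + emb s + 1) * \<iota> c"
    proof -
      have "1 \<le> \<iota> c" using one_least_positive[OF c] by simp
      then show ?thesis using m(3) n(3) unfolding distrib_right mult_1 by linarith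
    qed
    also have "x - p * q = (emb (r \<otimes> s) - emb r * emb s) * \<iota> c * \<iota> c"
      by (simp add: x_def p_def q_def algebra_simps)
    finally have "(\<bar>emb (r \<otimes> s) - emb r * emb s\<bar> * \<iota> c) * \<iota> c \<le> (emb r + emb s + 1) * \<iota> c"
      using c by (simp add: abs_mult)
    then show "\<bar>emb (r \<otimes> s) - emb r * emb s\<bar> * \<iota> c \<le> emb r + emb s + 1"
      using c by simp
  qed
  then show ?thesis by simp
qed

lemma emb_mult:
  assumes r: "r \<in> carrier R" and s: "s \<in> carrier R"
  shows "emb (r \<otimes> s) = emb r * emb s"
proof -
  have *: "emb (r \<otimes> s) = emb r * emb s" if "r \<in> carrier R" "\<zero> \<preceq> r" "s \<in> carrier R" for r s
  proof (cases "\<zero> \<preceq> s")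
    case False
    then have "emb (r \<otimes> (\<ominus> s)) = emb r * emb (\<ominus> s)"
      using that R.nonneg_uminus by (intro emb_mult_nonneg) auto
    then show ?thesis using that by (simp add: emb_uminus R.r_minus)
  qed (use that emb_mult_nonneg in auto)
  show ?thesis
  proof (cases "\<zero> \<preceq> r")
    case False
    then have "emb ((\<ominus> r) \<otimes> s) = emb (\<ominus> r) * emb s"
      using r s R.nonneg_uminus by (intro *) auto
    then show ?thesis using r s by (simp add: emb_uminus R.l_minus)
  qed (use * r s in auto)
qed

lemma emb_eq_0_iff:
  assumes "r \<in> carrier R"
  shows "emb r = 0 \<longleftrightarrow> r = \<zero>"
proof
  assume "emb r = 0"
  show "r = \<zero>"
  proof (rule ccontr)
    assume "r \<noteq> \<zero>"
    then have "r \<in> Units R" using assms by (simp add: R.field_Units)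
    then have "emb r * emb (inv r) = 1"
      using emb_mult[of r "inv r"] assms by (simp add: R.Units_r_inv emb_1)
    with \<open>emb r = 0\<close> show False by simp
  qed
qed (simp add: emb_0)

lemma emb_diff: "r \<in> carrier R \<Longrightarrow> s \<in> carrier R \<Longrightarrow> emb (r \<ominus> s) = emb r - emb s"
  by (simp add: R.minus_eq emb_add emb_uminus)

lemma emb_inj: "r \<in> carrier R \<Longrightarrow> s \<in> carrier R \<Longrightarrow> emb r = emb s \<longleftrightarrow> r = s"
  using emb_eq_0_iff[of "r \<ominus> s"] by (simp add: emb_diff)

lemma emb_le_iff:
  assumes "r \<in> carrier R" "s \<in> carrier R"
  shows "emb r \<le> emb s \<longleftrightarrow> r \<preceq> s"
proof -
  have mono: "emb r \<le> emb s" if "r \<in> carrier R" "s \<in> carrier R" "r \<preceq> s" for r s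
    using emb_nonneg[of "s \<ominus> r"] that R.le_iff_diff[of r s] by (simp add: emb_diff)
  show ?thesis
    using mono[OF assms] mono[OF assms(2,1)] R.le_total[OF assms] R.le_refl[OF assms(1)]
      emb_inj[OF assms]
    by (auto dest: order_antisym)
qed

definition unemb :: "'k \<Rightarrow> 'r" where
  "unemb = inv_into (carrier R) emb"

abbreviation image :: "'k set" where
  "image \<equiv> emb ` carrier R"

lemma unemb_emb [simp]: "r \<in> carrier R \<Longrightarrow> unemb (emb r) = r"
  unfolding unemb_def by (rule inv_into_f_f) (auto simp: inj_on_def emb_inj)

lemma emb_unemb [simp]: "x \<in> image \<Longrightarrow> emb (unemb x) = x"
  unfolding unemb_def by (rule f_inv_into_f)

lemma unemb_in [simp]: "x \<in> image \<Longrightarrow> unemb x \<in> carrier R"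
  unfolding unemb_def by (rule inv_into_into)

lemma subfield_image: "subfield_set image"
proof
  show "0 \<in> image" "1 \<in> image"
    by (metis emb_0 emb_1 imageI R.zero_closed R.one_closed)+
  fix x y assume x: "x \<in> image"
  then obtain r where r: "r \<in> carrier R" "x = emb r" by blast
  show "- x \<in> image" using r by (metis emb_uminus imageI R.a_inv_closed)
  show "inverse x \<in> image"
  proof (cases "x = 0")
    case False
    then have "r \<in> Units R" using r by (auto simp: R.field_Units emb_0)
    then have "emb r * emb (inv r) = 1"
      using emb_mult[of r "inv r"] r by (simp add: R.Units_r_inv emb_1)
    then have "inverse x = emb (inv r)" using r by (simp add: inverse_unique)
    then show ?thesis using \<open>r \<in> Units R\<close> by blast
  qed (use x in simp)
  assume "y \<in> image"
  then obtain s where s: "s \<in> carrier R" "y = emb s" by blast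
  show "x + y \<in> image" using r s by (metis emb_add imageI R.add.m_closed)
  show "x * y \<in> image" using r s by (metis emb_mult imageI R.m_closed)
qed

lemma real_closed_image:
  assumes "real_closed_field R"
  shows "real_closed_subfield image"
proof (intro real_closed_subfield.intro subfield_image real_closed_subfield_axioms.intro)
  interpret RC: real_closed_field R by (rule assms)
  fix x assume x: "x \<in> image" "0 \<le> x"
  then obtain y where "y \<in> carrier R" "y \<otimes> y = unemb x"
    using RC.sqrt_exists[of "unemb x"] emb_le_iff[of \<zero> "unemb x"] by (auto simp: emb_0)
  then show "\<exists>y\<in>image. y * y = x" using x by (intro bexI[of _ "emb y"]) (auto simp: emb_mult[symmetric])
next
  interpret RC: real_closed_field R by (rule assms)
  fix p assume p: "p \<in> poly_over image" "odd (Polynomial.degree p)"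
  then have p0: "p \<noteq> 0" by auto
  define q where "q = rev (map unemb (coeffs p))"
  have coeffs: "set (coeffs p) \<subseteq> image"
    using p(1) by (auto simp: poly_over_def coeffs_def)
  have set_q: "set q \<subseteq> carrier R"
    using coeffs by (auto simp: q_def)
  have "hd q = unemb (Polynomial.lead_coeff p)"
    using p0 by (simp add: q_def hd_rev last_map last_coeffs_eq_coeff_degree)
  moreover have "emb (unemb (Polynomial.lead_coeff p)) \<noteq> 0"
    using p p0 by (subst emb_unemb) (auto simp: poly_over_def)
  ultimately have "polynomial (carrier R) q"
    using set_q by (auto simp: polynomial_def emb_0)
  moreover have "length q = Suc (Polynomial.degree p)"
    using p0 by (simp add: q_def length_coeffs_degree)
  ultimately obtain x where x: "x \<in> carrier R" "R.eval q x = \<zero>"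
    using RC.odd_degree_root[of q] p(2) by auto
  have "map (emb \<circ> unemb) (coeffs p) = coeffs p"
    using coeffs by (intro map_idI) auto
  then have "Poly (rev (map emb q)) = p"
    by (simp add: q_def rev_map)
  then have "poly p (emb x) = emb (R.eval q x)"
    using R.eval_hom[of emb x q] x(1) set_q emb_add emb_mult emb_0 emb_1 by simp
  then show "\<exists>x\<in>image. poly p x = 0"
    using x by (auto simp: emb_0)
qed

lemma integer_part_subfield_image:
  assumes "real_closed_field R"
  shows "integer_part_subfield \<iota> image"
proof -
  interpret S: real_closed_subfield image by (rule real_closed_image[OF assms])
  show ?thesis
  proof
    show "\<iota> x \<in> image" for x
      using imageI[OF J_in, of emb x] by (simp add: emb_J)
    fix x assume "x \<in> image"
    then obtain r where r: "r \<in> carrier R" "x = emb r" by blast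
    obtain m where "J m \<preceq> r" "r \<preceq> J (m + 1)" "r \<noteq> J (m + 1)" using J_floor r by blast
    then have "emb (J m) \<le> emb r" "emb r \<le> emb (J (m + 1))" "emb r \<noteq> emb (J (m + 1))"
      using r(1) by (simp_all only: emb_le_iff emb_inj J_in not_False_eq_True)
    then show "\<exists>m. \<iota> m \<le> x \<and> x < \<iota> (m + 1)"
      unfolding emb_J r(2) order_less_le by blast
  qed
qed

lemma exp_integer_part_subfield_image:
  assumes "real_closed_field R" "exponential_field R E" "xy_integer_part R E pw J"
    and "Bernoulli_inequality R E"
  shows "exp_integer_part_subfield \<iota> image (\<lambda>x. emb (E (unemb x)))
    (\<lambda>x. emb (exp_field_log R E (unemb x))) pw"
proof -
  interpret S: integer_part_subfield \<iota> image by (rule integer_part_subfield_image[OF assms(1)])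
  interpret X: exponential_field R E by (rule assms(2))
  have pos_iff: "r \<in> positives R \<longleftrightarrow> r \<in> carrier R \<and> 0 < emb r" for r
    using emb_le_iff[of \<zero> r] emb_eq_0_iff[of r]
    by (auto simp: positives_def ring_less_def emb_0 order_less_le)
  have E_pos: "E r \<in> positives R" if "r \<in> carrier R" for r
    using bij_betwE[OF X.exp_bij] that by blast
  have E_in [simp]: "E r \<in> carrier R" if "r \<in> carrier R" for r
    using E_pos[OF that] pos_iff by blast
  have log_in [simp]: "exp_field_log R E r \<in> carrier R" and E_log: "E (exp_field_log R E r) = r"
    if "r \<in> positives R" for r
    using that X.exp_bij unfolding exp_field_log_def
    by (auto simp: bij_betw_def intro: inv_into_into f_inv_into_f)
  have log_E: "exp_field_log R E (E r) = r" if "r \<in> carrier R" for r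
    using that X.exp_bij unfolding exp_field_log_def by (simp add: bij_betw_inv_into_left)
  have unemb_pos: "unemb x \<in> positives R" if "x \<in> image" "0 < x" for x
    using that by (auto simp: pos_iff)
  have unemb_add: "unemb (x + y) = unemb x \<oplus> unemb y" if "x \<in> image" "y \<in> image" for x y
    using that by (metis emb_add emb_unemb unemb_emb unemb_in R.add.m_closed)
  have unemb_mult: "unemb (x * y) = unemb x \<otimes> unemb y" if "x \<in> image" "y \<in> image" for x y
    using that by (metis emb_mult emb_unemb unemb_emb unemb_in R.m_closed)
  show ?thesis
  proof
    fix x assume x: "x \<in> image"
    then show "emb (E (unemb x)) \<in> image" "0 < emb (E (unemb x))"
      using E_pos[of "unemb x"] pos_iff by auto
    show "emb (exp_field_log R E (unemb (emb (E (unemb x))))) = x"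
      using x by (simp add: log_E)
    show "emb (exp_field_log R E (unemb x)) \<in> image"
      "emb (E (unemb (emb (exp_field_log R E (unemb x))))) = x" if "0 < x"
      using unemb_pos[OF x that] x by (auto simp: E_log)
    fix y assume y: "y \<in> image"
    show "emb (E (unemb (x + y))) = emb (E (unemb x)) * emb (E (unemb y))"
      using x y by (simp add: unemb_add X.exp_add emb_mult)
    show "emb (E (unemb x)) \<le> emb (E (unemb y))" if "x \<le> y"
      using x y that X.exp_mono[of "unemb x" "unemb y"] emb_le_iff[of "unemb x" "unemb y"]
      by (simp add: emb_le_iff)
    show "1 + x * y \<le> emb (E (unemb (y * emb (exp_field_log R E (unemb (1 + x))))))"
      if "0 < x" "1 \<le> y"
    proof -
      have 1: "1 + x \<in> image" using x S.closed(2,3) by blast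
      have "\<zero> \<prec> unemb x" using unemb_pos[OF x that(1)] by (simp add: positives_def)
      moreover have "\<one> \<preceq> unemb y" using that y emb_le_iff[of \<one> "unemb y"] by (simp add: emb_1)
      ultimately have "\<one> \<oplus> unemb x \<otimes> unemb y \<preceq> exp_field_power R E (\<one> \<oplus> unemb x) (unemb y)"
        using assms(4) x y by (simp add: Bernoulli_inequality_def)
      moreover have u1: "unemb 1 = \<one>" using unemb_emb[of \<one>] by (simp add: emb_1)
      have "\<one> \<oplus> unemb x = unemb (1 + x)" using unemb_add[of 1 x] S.closed(2) x u1 by simp
      moreover have pos: "unemb (1 + x) \<in> positives R"
        using unemb_pos[OF 1] that by simp
      ultimately have "emb (\<one> \<oplus> unemb x \<otimes> unemb y) \<le>
          emb (E (unemb y \<otimes> exp_field_log R E (unemb (1 + x))))"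
        using x y by (simp add: emb_le_iff exp_field_power_def)
      then show ?thesis
        using x y pos by (simp add: emb_add emb_mult emb_1 unemb_mult)
    qed
  next
    fix n m :: 'a assume nm: "0 < n" "0 \<le> m"
    have "J (pw n m) = exp_field_power R E (J n) (J m)"
      using assms(3) nm by (simp add: xy_integer_part_def)
    moreover have un: "unemb (\<iota> a) = J a" for a using unemb_emb[of "J a"] by (simp add: emb_J)
    moreover have "J n \<in> positives R" using nm by (simp add: pos_iff emb_J)
    ultimately have "\<iota> (pw n m) = emb (E (J m \<otimes> exp_field_log R E (J n)))"
      by (metis emb_J exp_field_power_def)
    then show "\<iota> (pw n m) = emb (E (unemb (\<iota> m * emb (exp_field_log R E (unemb (\<iota> n))))))"
      using \<open>J n \<in> positives R\<close> by (simp add: unemb_mult un)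
  next
    show "pw 0 0 = 1" "\<And>m. 0 < m \<Longrightarrow> pw 0 m = 0"
      using assms(3) by (auto simp: xy_integer_part_def)
  qed
qed

end

theorem exponential_field_imp_models:
  fixes pw :: "'a::discretely_ordered_ring \<Rightarrow> 'a \<Rightarrow> 'a" and R :: "('r, 'm) ordered_ring_scheme"
  assumes "exponential_field R E" "xy_integer_part R E pw J" "real_closed_field R"
    and "Bernoulli_inequality R E"
  shows "IOpen_model (nonneg_part pw)" "T_xy_model (nonneg_part pw)"
proof -
  interpret X: exponential_field R E by (rule assms(1))
  interpret I: integer_part_embedding "\<lambda>x :: 'a. of_base (to_fract x)" R J
    using assms(2) by unfold_locales (simp add: xy_integer_part_def)
  interpret exp_integer_part_subfield "\<lambda>x :: 'a. of_base (to_fract x)" I.image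
    "\<lambda>x. I.emb (E (I.unemb x))" "\<lambda>x. I.emb (exp_field_log R E (I.unemb x))" pw
    by (rule I.exp_integer_part_subfield_image[OF assms(3,1,2,4)])
  show "IOpen_model (nonneg_part pw)" "T_xy_model (nonneg_part pw)"
    by (rule IOpen_model_nonneg_part T_xy_model_nonneg_part)+
qed

section \<open>Open induction makes the completion real closed\<close>

primrec power_term :: "nat \<Rightarrow> arith_term" where
  "power_term 0 = TSuc TZero"
| "power_term (Suc n) = TMult (TVar 0) (power_term n)"

primrec poly_term :: "(nat \<Rightarrow> nat) \<Rightarrow> nat \<Rightarrow> arith_term" where
  "poly_term f 0 = TZero"
| "poly_term f (Suc n) = TAdd (poly_term f n) (TMult (TVar (f n)) (power_term n))"

lemma term_val_power_term: "term_val (nonneg_part pw) e (power_term n) = e 0 ^ n"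
  by (induction n) (auto simp: nonneg_part_def)

lemma term_val_poly_term:
  "term_val (nonneg_part pw) e (poly_term f n) = (\<Sum>i<n. e (f i) * e 0 ^ i)"
  by (induction n) (simp add: nonneg_part_def, simp add: term_val_power_term, simp add: nonneg_part_def)

text \<open>The language has no subtraction and the structure no negative elements, so
  \<open>P\<close> is split into two polynomials with nonnegative coefficients, and
  \<open>P x \<le> 0\<close> becomes an inequality between terms. If no sign change existed,
  \<open>P x \<le> 0 \<and> x < n\<close> would be inductive and hold at
  \<open>x = n\<close>.\<close>

lemma open_sign_change:
  fixes P :: "'a::discretely_ordered_ring poly"
  assumes "IOpen_model (nonneg_part (pw :: 'a \<Rightarrow> 'a \<Rightarrow> 'a))"
    and "0 < n" "poly P 0 \<le> 0" "0 < poly P n"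
  shows "\<exists>z\<ge>0. z < n \<and> poly P z \<le> 0 \<and> 0 < poly P (z + 1)"
proof (rule ccontr)
  interpret IOpen_model "nonneg_part pw" by (rule assms(1))
  assume *: "\<not> ?thesis"
  let ?A = "nonneg_part pw"
  define d where "d = Suc (Polynomial.degree P)"
  \<comment> \<open>Variable 0 is the argument and variable 1 the bound \<open>n\<close>; variables
    \<open>2 * i + 2\<close> and \<open>2 * i + 3\<close> hold the positive and negative parts of
    coefficient \<open>i\<close>.\<close>
  define e :: "nat \<Rightarrow> 'a" where
    "e i = (if i = 1 then n else if even i then max (Polynomial.coeff P (i div 2 - 1)) 0
      else max (- Polynomial.coeff P (i div 2 - 1)) 0)" for i
  define s t where "s = poly_term (\<lambda>i. 2 * i + 2) d" and "t = poly_term (\<lambda>i. 2 * i + 3) d"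
  define p where "p = FAnd (FLe s t) (FNot (FLe (TVar 1) (TVar 0)))"
  have "term_val ?A (e(0 := x)) s - term_val ?A (e(0 := x)) t = poly P x" for x
  proof -
    have "term_val ?A (e(0 := x)) s - term_val ?A (e(0 := x)) t
       = (\<Sum>i<d. (e (2 * i + 2) - e (2 * i + 3)) * x ^ i)"
      by (simp add: s_def t_def term_val_poly_term sum_subtractf left_diff_distrib)
    also have "\<dots> = (\<Sum>i<d. Polynomial.coeff P i * x ^ i)"
      by (intro sum.cong) (auto simp: e_def max_def)
    also have "\<dots> = poly P x"
      by (simp add: poly_altdef d_def lessThan_Suc_atMost)
    finally show ?thesis .
  qed
  then have sat: "qf_sat ?A (e(0 := x)) p \<longleftrightarrow> poly P x \<le> 0 \<and> x < n" for x
    by (auto simp: p_def nonneg_part_def e_def not_le) (metis diff_le_0_iff_le)+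
  have "n \<in> universe ?A" using assms(2) by (simp add: nonneg_part_def)
  then have "qf_sat ?A (e(0 := n)) p"
  proof (rule open_induction[rule_format, where x = n and p = p and v = 0 and e = e, rotated 3])
    show "e i \<in> universe ?A" for i using assms(2) by (auto simp: nonneg_part_def e_def)
    show "qf_sat ?A (e(0 := arith_zero ?A)) p" using assms(2,3) by (simp add: sat) (simp add: nonneg_part_def)
    fix x assume "x \<in> universe ?A" "qf_sat ?A (e(0 := x)) p"
    then have x: "0 \<le> x" "poly P x \<le> 0" "x < n" by (auto simp: sat) (simp add: nonneg_part_def)
    then have "poly P (x + 1) \<le> 0" using * not_le by blast
    moreover have "x + 1 \<noteq> n" using calculation assms(4) by auto
    then have "x + 1 < n" using x discretely_ordered_less_iff[of x n] by (simp add: order_less_le)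
    ultimately show "qf_sat ?A (e(0 := arith_suc ?A x)) p" by (simp add: sat) (simp add: nonneg_part_def)
  qed
  then show False by (simp add: sat)
qed

section \<open>Estimates for polynomials over ordered fields\<close>

lemma poly_lipschitz:
  fixes p :: "'a::linordered_field poly"
  shows "\<exists>L\<ge>0. \<forall>x y. \<bar>x\<bar> \<le> b \<longrightarrow> \<bar>y\<bar> \<le> b \<longrightarrow> \<bar>poly p x - poly p y\<bar> \<le> L * \<bar>x - y\<bar>"
proof (induction p)
  case 0
  then show ?case by auto
next
  case (pCons c p)
  then obtain L where L: "L \<ge> 0" "\<And>x y. \<bar>x\<bar> \<le> b \<Longrightarrow> \<bar>y\<bar> \<le> b \<Longrightarrow> \<bar>poly p x - poly p y\<bar> \<le> L * \<bar>x - y\<bar>"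
    by blast
  show ?case
  proof (intro exI conjI allI impI)
    show "\<bar>b\<bar> * L + (\<bar>poly p 0\<bar> + L * \<bar>b\<bar>) \<ge> 0" using L by simp
    fix x y assume xy: "\<bar>x\<bar> \<le> b" "\<bar>y\<bar> \<le> b"
    have "\<bar>poly p y\<bar> \<le> \<bar>poly p 0\<bar> + \<bar>poly p y - poly p 0\<bar>" by (simp add: abs_if)
    also have "\<bar>poly p y - poly p 0\<bar> \<le> L * \<bar>y\<bar>" using L(2)[of y 0] xy by auto
    also have "\<dots> \<le> L * \<bar>b\<bar>" using L xy by (intro mult_left_mono) auto
    finally have py: "\<bar>poly p y\<bar> \<le> \<bar>poly p 0\<bar> + L * \<bar>b\<bar>" by simp
    have "\<bar>poly (pCons c p) x - poly (pCons c p) y\<bar> = \<bar>x * (poly p x - poly p y) + (x - y) * poly p y\<bar>"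
      by (simp add: algebra_simps)
    also have "\<dots> \<le> \<bar>x\<bar> * \<bar>poly p x - poly p y\<bar> + \<bar>x - y\<bar> * \<bar>poly p y\<bar>"
      by (metis abs_mult abs_triangle_ineq)
    also have "\<dots> \<le> \<bar>b\<bar> * (L * \<bar>x - y\<bar>) + \<bar>x - y\<bar> * (\<bar>poly p 0\<bar> + L * \<bar>b\<bar>)"
      using xy L py by (intro add_mono mult_mono) auto
    finally show "\<bar>poly (pCons c p) x - poly (pCons c p) y\<bar>
       \<le> (\<bar>b\<bar> * L + (\<bar>poly p 0\<bar> + L * \<bar>b\<bar>)) * \<bar>x - y\<bar>" by (simp add: algebra_simps)
  qed
qed

lemma poly_bounded:
  fixes p :: "'a::linordered_field poly"
  shows "\<exists>K>0. \<forall>x. \<bar>x\<bar> \<le> b \<longrightarrow> \<bar>poly p x\<bar> \<le> K"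
proof -
  obtain L where L: "L \<ge> 0" "\<And>x y. \<bar>x\<bar> \<le> b \<Longrightarrow> \<bar>y\<bar> \<le> b \<Longrightarrow> \<bar>poly p x - poly p y\<bar> \<le> L * \<bar>x - y\<bar>"
    using poly_lipschitz by blast
  have "\<bar>poly p x\<bar> \<le> \<bar>poly p 0\<bar> + L * \<bar>b\<bar> + 1" if "\<bar>x\<bar> \<le> b" for x
  proof -
    have "\<bar>poly p x\<bar> \<le> \<bar>poly p 0\<bar> + \<bar>poly p x - poly p 0\<bar>" by (simp add: abs_if)
    also have "\<bar>poly p x - poly p 0\<bar> \<le> L * \<bar>x\<bar>" using L(2)[of x 0] that by auto
    also have "\<dots> \<le> L * \<bar>b\<bar>" using L that by (intro mult_left_mono) auto
    finally show ?thesis by simp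
  qed
  then show ?thesis using L by (intro exI[of _ "\<bar>poly p 0\<bar> + L * \<bar>b\<bar> + 1"]) (auto simp: add_nonneg_pos)
qed

text \<open>In Horner form the error for \<open>c + X p\<close> is \<open>x\<close> times the error
  for \<open>p\<close> plus \<open>(y - x) (p y - p x)\<close>, and the latter is quadratic in
  \<open>y - x\<close> by the Lipschitz bound.\<close>

lemma poly_taylor_bound:
  fixes p :: "'a::linordered_field poly"
  shows "\<exists>C\<ge>0. \<forall>x y. \<bar>x\<bar> \<le> b \<longrightarrow> \<bar>y\<bar> \<le> b \<longrightarrow>
    \<bar>poly p y - poly p x - (y - x) * poly (pderiv p) x\<bar> \<le> C * \<bar>y - x\<bar> * \<bar>y - x\<bar>"
proof (induction p)
  case 0
  then show ?case by (auto intro!: exI[of _ 0])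
next
  case (pCons c p)
  then obtain C where C: "C \<ge> 0" "\<And>x y. \<bar>x\<bar> \<le> b \<Longrightarrow> \<bar>y\<bar> \<le> b \<Longrightarrow>
    \<bar>poly p y - poly p x - (y - x) * poly (pderiv p) x\<bar> \<le> C * \<bar>y - x\<bar> * \<bar>y - x\<bar>" by blast
  obtain L where L: "L \<ge> 0" "\<And>x y. \<bar>x\<bar> \<le> b \<Longrightarrow> \<bar>y\<bar> \<le> b \<Longrightarrow> \<bar>poly p x - poly p y\<bar> \<le> L * \<bar>x - y\<bar>"
    using poly_lipschitz by blast
  show ?case
  proof (intro exI conjI allI impI)
    show "\<bar>b\<bar> * C + L \<ge> 0" using C L by simp
    fix x y assume xy: "\<bar>x\<bar> \<le> b" "\<bar>y\<bar> \<le> b"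
    have "poly (pCons c p) y - poly (pCons c p) x - (y - x) * poly (pderiv (pCons c p)) x
      = x * (poly p y - poly p x - (y - x) * poly (pderiv p) x) + (y - x) * (poly p y - poly p x)"
      by (simp add: pderiv_pCons algebra_simps)
    also have "\<bar>\<dots>\<bar> \<le> \<bar>x\<bar> * \<bar>poly p y - poly p x - (y - x) * poly (pderiv p) x\<bar> + \<bar>y - x\<bar> * \<bar>poly p y - poly p x\<bar>"
      by (metis abs_mult abs_triangle_ineq)
    also have "\<dots> \<le> \<bar>b\<bar> * (C * \<bar>y - x\<bar> * \<bar>y - x\<bar>) + \<bar>y - x\<bar> * (L * \<bar>y - x\<bar>)"
      using xy L C by (intro add_mono mult_mono) auto
    finally show "\<bar>poly (pCons c p) y - poly (pCons c p) x - (y - x) * poly (pderiv (pCons c p)) x\<bar>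
      \<le> (\<bar>b\<bar> * C + L) * \<bar>y - x\<bar> * \<bar>y - x\<bar>" by (simp add: algebra_simps)
  qed
qed

lemma poly_bezout:
  fixes p q :: "'a::field poly"
  shows "\<exists>g u v. g = u * p + v * q \<and> g dvd p \<and> g dvd q"
\<comment> \<open>The zero polynomial and nonzero constants both have degree 0; the measure
  separates them, so that the last division step decreases it too.\<close>
proof (induction "if q = 0 then 0 else Suc (Polynomial.degree q)" arbitrary: p q rule: less_induct)
  case less
  show ?case
  proof (cases "q = 0")
    case True
    then show ?thesis by (intro exI[of _ p] exI[of _ 1] exI[of _ 0]) auto
  next
    case False
    then have "(if p mod q = 0 then 0 else Suc (Polynomial.degree (p mod q)))
        < (if q = 0 then 0 else Suc (Polynomial.degree q))"
      using degree_mod_less[OF False, of p] by auto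
    from less[OF this] obtain g u v where g: "g = u * q + v * (p mod q)" "g dvd q" "g dvd p mod q"
      by blast
    have "u * q + v * r = v * (d * q + r) + (u - v * d) * q" for d r :: "'a poly"
      by (simp add: algebra_simps)
    from this[of "p mod q" "p div q"] have "g = v * p + (u - v * (p div q)) * q"
      by (simp add: g(1))
    moreover have "g dvd p" using g(2,3) by (metis dvd_mod_iff)
    ultimately show ?thesis using g(2) by blast
  qed
qed

text \<open>Multiplying by the leading coefficient treats both signs at once. The uniform bound
  \<open>d\<close> carries the induction: for \<open>c + X p\<close> the contribution of
  \<open>X p\<close> is at least \<open>x * d\<close>, which outgrows that of
  \<open>c\<close>.\<close>

lemma poly_sign_at_infinity:
  fixes p :: "'a::linordered_field poly"
  assumes "p \<noteq> 0"
  shows "\<exists>b. \<exists>d>0. \<forall>x\<ge>b. d \<le> poly p x * Polynomial.lead_coeff p"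
  using assms
proof (induction p)
  case (pCons c p)
  show ?case
  proof (cases "p = 0")
    case True
    then show ?thesis using pCons by (auto intro!: exI[of _ "c * c"] simp: zero_less_mult_iff)
  next
    case False
    then obtain b d where bd: "d > 0" "\<And>x. x \<ge> b \<Longrightarrow> d \<le> poly p x * Polynomial.lead_coeff p"
      using pCons by blast
    define k where "k = Polynomial.lead_coeff p"
    have "d \<le> poly (pCons c p) x * Polynomial.lead_coeff (pCons c p)"
      if x: "x \<ge> max b (1 + \<bar>c * k\<bar> / d)" for x
    proof -
      have "1 + \<bar>c * k\<bar> / d \<le> x" using x by simp
      then have "(1 + \<bar>c * k\<bar> / d) * d \<le> x * d" using bd(1) by (intro mult_right_mono) auto
      then have "d + \<bar>c * k\<bar> \<le> x * d" using bd(1) by (simp add: distrib_right)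
      also have "0 \<le> \<bar>c * k\<bar> / d" using bd(1) by simp
      then have "0 \<le> x" using \<open>1 + \<bar>c * k\<bar> / d \<le> x\<close> by linarith
      then have "x * d \<le> x * (poly p x * k)"
        using bd(2)[of x] x by (intro mult_left_mono) (auto simp: k_def)
      finally have "d \<le> c * k + x * (poly p x * k)" by (simp add: abs_if split: if_splits)
      then show ?thesis using False by (simp add: k_def algebra_simps)
    qed
    then show ?thesis using bd(1) by blast
  qed
qed simp

lemma poly_odd_degree_sign_change:
  fixes p :: "'a::linordered_field poly"
  assumes "odd (Polynomial.degree p)"
  shows "\<exists>b. \<forall>x\<ge>b. poly p (- x) * poly p x < 0"
proof -
  define q where "q = pcompose p [:0, -1:]"
  have p0: "p \<noteq> 0" using assms by auto
  have "Polynomial.lead_coeff q = - Polynomial.lead_coeff p"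
    unfolding q_def by (subst lead_coeff_comp) (use assms in auto)
  then have "q \<noteq> 0" using p0 by auto
  obtain b d where b: "d > 0" "\<And>x. x \<ge> b \<Longrightarrow> d \<le> poly p x * Polynomial.lead_coeff p"
    using poly_sign_at_infinity[OF p0] by blast
  obtain b' d' where b': "d' > 0" "\<And>x. x \<ge> b' \<Longrightarrow> d' \<le> poly q x * Polynomial.lead_coeff q"
    using poly_sign_at_infinity[OF \<open>q \<noteq> 0\<close>] by blast
  have "poly p (- x) * poly p x < 0" if "x \<ge> max b b'" for x
  proof -
    have "0 < poly p x * Polynomial.lead_coeff p" using b(2)[of x] b(1) that by simp
    moreover have "0 < poly p (- x) * - Polynomial.lead_coeff p"
      using b'(2)[of x] b'(1) that \<open>Polynomial.lead_coeff q = _\<close> by (simp add: q_def poly_pcompose)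
    ultimately show ?thesis by (auto simp: zero_less_mult_iff mult_less_0_iff)
  qed
  then show ?thesis by blast
qed

section \<open>Roots of polynomials with a sign change\<close>

text \<open>Open induction enters through \<open>sign_change\<close> alone, a statement about
  polynomials over \<open>M\<close> at neighbouring elements of \<open>M\<close>.\<close>

locale iopen_extension = complete_extension \<iota>
  for \<iota> :: "'a::discretely_ordered_ring \<Rightarrow> 'k::linordered_field" +
  assumes sign_change: "\<lbrakk>0 < n; poly P 0 \<le> 0; 0 < poly P n\<rbrakk> \<Longrightarrow>
    \<exists>z\<ge>0. z < n \<and> poly P z \<le> 0 \<and> 0 < poly P (z + (1::'a))"
begin

text \<open>For a fraction \<open>a / b\<close>, the sign change of \<open>b X - a\<close> gives the
  integer part \<open>z\<close>. If the fraction lies between \<open>x\<close> and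
  \<open>x + 1\<close>, the integer part of \<open>x\<close> is \<open>z\<close> or
  \<open>z - 1\<close>.\<close>

lemma floor_nonneg:
  assumes "0 \<le> x"
  shows "\<exists>m\<ge>0. \<iota> m \<le> x \<and> x < \<iota> (m + 1)"
proof -
  obtain a b where ab: "0 < b" "x < \<iota> a / \<iota> b" "\<iota> a / \<iota> b < x + 1"
    using fraction_dense[of x "x + 1"] by auto
  have "0 < a" using ab assms by (simp add: pos_less_divide_eq)
      (metis le_less_trans mult_nonneg_nonneg zero_le_iff zero_less_iff less_imp_le)
  have "\<exists>z\<ge>0. z < a + 1 \<and> poly [:-a, b:] z \<le> 0 \<and> 0 < poly [:-a, b:] (z + 1)"
  proof (rule sign_change)
    have "a < a + 1" by simp
    also have "\<dots> \<le> (a + 1) * b"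
      using mult_left_mono[OF one_least_positive[OF ab(1)], of "a + 1"] \<open>0 < a\<close> by simp
    finally show "0 < poly [:-a, b:] (a + 1)" by simp
  qed (use \<open>0 < a\<close> in auto)
  then obtain z where z: "0 \<le> z" "z * b \<le> a" "a < (z + 1) * b" by auto
  then have "\<iota> (z * b) \<le> \<iota> a" "\<iota> a < \<iota> ((z + 1) * b)" by (simp_all only: le_iff less_iff)
  then have q: "\<iota> z \<le> \<iota> a / \<iota> b" "\<iota> a / \<iota> b < \<iota> z + 1"
    using ab(1) by (simp_all add: pos_le_divide_eq pos_divide_less_eq)
  show ?thesis
  proof (cases "\<iota> z \<le> x")
    case True
    then show ?thesis using z q ab by (intro exI[of _ z]) auto
  next
    case False
    then have "0 < z" using assms z by (metis not_less order_le_less zero)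
    then show ?thesis using False q ab one_least_positive[of z] by (intro exI[of _ "z - 1"]) auto
  qed
qed

lemma floor: "\<exists>m. \<iota> m \<le> x \<and> x < \<iota> (m + 1)"
proof -
  obtain c where "0 < c" "- x < \<iota> c" using unbounded by blast
  then obtain m where "\<iota> m \<le> x + \<iota> c" "x + \<iota> c < \<iota> (m + 1)" using floor_nonneg[of "x + \<iota> c"] by auto
  then show ?thesis by (intro exI[of _ "m - c"]) auto
qed

lemma fraction_near:
  assumes "0 < e"
  shows "\<exists>a b. 0 < b \<and> \<bar>x - \<iota> a / \<iota> b\<bar> < e"
proof -
  obtain a b where "0 < b" "x < \<iota> a / \<iota> b" "\<iota> a / \<iota> b < x + e"
    using fraction_dense[of x "x + e"] assms by auto
  then show ?thesis by (intro exI[of _ a] exI[of _ b]) (simp add: abs_less_iff algebra_simps)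
qed

text \<open>\<open>sign_change\<close> speaks of coefficients in \<open>M\<close>; here arbitrary
  coefficients are replaced by fractions with a common denominator \<open>D\<close>, uniformly on a
  bounded set.\<close>

lemma poly_approx:
  assumes "0 < e"
  shows "\<exists>D P. 0 < D \<and> (\<forall>x. \<bar>x\<bar> \<le> b \<longrightarrow> \<bar>poly p x - poly (map_poly \<iota> P) x / \<iota> D\<bar> \<le> e)"
  using assms
proof (induction p arbitrary: e)
  case 0
  then show ?case by (intro exI[of _ 1] exI[of _ 0]) auto
next
  case (pCons c p)
  define e' where "e' = e / (2 * (\<bar>b\<bar> + 1))"
  have "0 < e'" using pCons.prems by (simp add: e'_def add_nonneg_pos)
  then obtain D P where DP: "0 < D" "\<And>x. \<bar>x\<bar> \<le> b \<Longrightarrow> \<bar>poly p x - poly (map_poly \<iota> P) x / \<iota> D\<bar> \<le> e'"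
    using pCons.IH by blast
  obtain u v where uv: "0 < v" "\<bar>c - \<iota> u / \<iota> v\<bar> < e / 2" using fraction_near[of "e / 2" c] pCons.prems by auto
  have "\<bar>poly (pCons c p) x - poly (map_poly \<iota> (pCons (u * D) (Polynomial.smult v P))) x / \<iota> (v * D)\<bar> \<le> e"
    if x: "\<bar>x\<bar> \<le> b" for x
  proof -
    have sm: "map_poly \<iota> (Polynomial.smult v P) = Polynomial.smult (\<iota> v) (map_poly \<iota> P)"
      by (simp add: poly_eq_iff coeff_map_poly)
    have "poly (map_poly \<iota> (pCons (u * D) (Polynomial.smult v P))) x / \<iota> (v * D)
        = \<iota> u / \<iota> v + x * (poly (map_poly \<iota> P) x / \<iota> D)"
      using uv DP(1) by (simp add: map_poly_pCons sm field_simps)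
    then have "\<bar>poly (pCons c p) x - poly (map_poly \<iota> (pCons (u * D) (Polynomial.smult v P))) x / \<iota> (v * D)\<bar>
      = \<bar>(c - \<iota> u / \<iota> v) + x * (poly p x - poly (map_poly \<iota> P) x / \<iota> D)\<bar>"
      by (simp add: algebra_simps)
    also have "\<dots> \<le> \<bar>c - \<iota> u / \<iota> v\<bar> + \<bar>x\<bar> * \<bar>poly p x - poly (map_poly \<iota> P) x / \<iota> D\<bar>"
      by (metis abs_mult abs_triangle_ineq)
    also have "\<dots> \<le> e / 2 + (\<bar>b\<bar> + 1) * e'"
      using x DP(2)[OF x] uv by (intro add_mono mult_mono) auto
    also have "\<dots> = e"
    proof -
      have "c * (e / (2 * c)) = e / 2" if "c \<noteq> 0" for c using that by simp
      moreover have "\<bar>b\<bar> + 1 \<noteq> 0" by (metis abs_ge_zero add_nonneg_pos less_irrefl zero_less_one)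
      ultimately have eq: "(\<bar>b\<bar> + 1) * (e / (2 * (\<bar>b\<bar> + 1))) = e / 2" by blast
      show ?thesis unfolding e'_def eq by simp
    qed
    finally show ?thesis .
  qed
  moreover have "0 < v * D" using uv DP by simp
  ultimately show ?case by blast
qed

text \<open>Along a grid of mesh \<open>1 / N\<close> starting at \<open>v / N\<close>, clearing the
  powers of \<open>N\<close> turns the values into those of a polynomial over \<open>M\<close> in
  the grid index, to which \<open>sign_change\<close> applies.\<close>

lemma poly_homogenize:
  assumes "0 < N"
  shows "\<exists>Q d. \<forall>z. \<iota> (poly Q z) = \<iota> N ^ d * poly (map_poly \<iota> P) ((\<iota> v + \<iota> z) / \<iota> N)"
proof (induction P)
  case 0
  then show ?case by (intro exI[of _ 0]) auto
next
  case (pCons c P)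
  then obtain Q d where Q: "\<And>z. \<iota> (poly Q z) = \<iota> N ^ d * poly (map_poly \<iota> P) ((\<iota> v + \<iota> z) / \<iota> N)"
    by blast
  have pow: "\<iota> (N ^ n) = \<iota> N ^ n" for n by (induction n) auto
  show ?case
    using assms
    by (intro exI[of _ "[:N ^ Suc d * c:] + [:v, 1:] * Q"] exI[of _ "Suc d"])
      (simp add: map_poly_pCons Q pow field_simps)
qed

text \<open>A polynomial over \<open>M\<close> close to \<open>p\<close> changes sign between two
  neighbouring points of a fine grid; the Lipschitz bound makes \<open>p\<close> small
  there.\<close>

lemma almost_root_aux:
  assumes "0 < n" "u < w" and neg: "poly p (\<iota> u / \<iota> n) < 0" and pos: "0 < poly p (\<iota> w / \<iota> n)" and "0 < e"
  shows "\<exists>a b. 0 < b \<and> \<iota> u / \<iota> n \<le> \<iota> a / \<iota> b \<and> \<iota> a / \<iota> b \<le> \<iota> w / \<iota> n \<and> \<bar>poly p (\<iota> a / \<iota> b)\<bar> \<le> e"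
proof -
  define \<alpha> \<beta> B where "\<alpha> = \<iota> u / \<iota> n" and "\<beta> = \<iota> w / \<iota> n" and "B = max \<bar>\<alpha>\<bar> \<bar>\<beta>\<bar>"
  have "\<alpha> \<le> \<beta>" using assms by (simp add: \<alpha>_def \<beta>_def divide_right_mono)
  have B: "\<bar>x\<bar> \<le> B" if "\<alpha> \<le> x" "x \<le> \<beta>" for x using that by (auto simp: B_def abs_if max_def)
  \<comment> \<open>The last two bounds let the approximation keep the signs at
    \<open>\<alpha>\<close> and \<open>\<beta>\<close>. At \<open>\<beta>\<close> the sign has to be
    strict, hence the factor 1/2.\<close>
  define e' where "e' = min (e / 2) (min (- poly p \<alpha>) (poly p \<beta> / 2))"
  have e': "0 < e'" "e' \<le> e / 2" "e' \<le> - poly p \<alpha>" "e' \<le> poly p \<beta> / 2"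
    using assms by (auto simp: e'_def \<alpha>_def \<beta>_def)
  obtain D P where D: "0 < D" and P: "\<And>x. \<bar>x\<bar> \<le> B \<Longrightarrow> \<bar>poly p x - poly (map_poly \<iota> P) x / \<iota> D\<bar> \<le> e'"
    using poly_approx[OF e'(1)] by metis
  define P' where "P' x = poly (map_poly \<iota> P) x" for x
  have P'sgn: "P' x \<le> 0 \<longleftrightarrow> P' x / \<iota> D \<le> 0" "0 < P' x \<longleftrightarrow> 0 < P' x / \<iota> D" for x
    using D by (simp_all add: pos_divide_le_eq pos_less_divide_eq)
  obtain L where L: "L \<ge> 0" "\<And>x y. \<bar>x\<bar> \<le> B \<Longrightarrow> \<bar>y\<bar> \<le> B \<Longrightarrow> \<bar>poly p x - poly p y\<bar> \<le> L * \<bar>x - y\<bar>"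
    using poly_lipschitz by metis
  \<comment> \<open>The mesh will be \<open>1 / (n * k)\<close>: a multiple of \<open>n\<close> puts
    both end points on the grid, and \<open>k\<close> is so large that \<open>p\<close> varies by at
    most \<open>e / 2\<close> between neighbours.\<close>
  obtain k where k: "0 < k" "2 * L / e < \<iota> k" using unbounded by blast
  define N where "N = n * k"
  have N: "0 < N" using k assms by (simp add: N_def)
  obtain Q d where Q: "\<And>z. \<iota> (poly Q z) = \<iota> N ^ d * P' ((\<iota> (u * k) + \<iota> z) / \<iota> N)"
    using poly_homogenize[OF N, of P "u * k"] unfolding P'_def by blast
  have Qsgn: "poly Q z \<le> 0 \<longleftrightarrow> P' ((\<iota> (u * k) + \<iota> z) / \<iota> N) \<le> 0"
    "0 < poly Q z \<longleftrightarrow> 0 < P' ((\<iota> (u * k) + \<iota> z) / \<iota> N)" for z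
  proof -
    have "0 < \<iota> N ^ d" using N by simp
    then show "poly Q z \<le> 0 \<longleftrightarrow> P' ((\<iota> (u * k) + \<iota> z) / \<iota> N) \<le> 0"
      "0 < poly Q z \<longleftrightarrow> 0 < P' ((\<iota> (u * k) + \<iota> z) / \<iota> N)"
      using Q[of z] zero_less_iff[of "poly Q z"] le_zero_iff[of "poly Q z"]
      by (simp_all only: mult_le_0_iff zero_less_mult_iff) auto
  qed
  have grid: "(\<iota> (u * k) + \<iota> z) / \<iota> N = \<alpha> + \<iota> z / \<iota> N" for z
    using assms(1) k by (simp add: N_def \<alpha>_def add_divide_distrib)
  have end1: "\<alpha> + \<iota> ((w - u) * k) / \<iota> N = \<beta>"
    using assms(1) k by (simp add: N_def \<alpha>_def \<beta>_def field_simps)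
  have "\<exists>z\<ge>0. z < (w - u) * k \<and> poly Q z \<le> 0 \<and> 0 < poly Q (z + 1)"
  proof (rule sign_change)
    show "0 < (w - u) * k" using assms k by simp
    have "P' \<alpha> / \<iota> D \<le> 0"
      using P[of \<alpha>] B[of \<alpha>] \<open>\<alpha> \<le> \<beta>\<close> e' by (auto simp: P'_def abs_le_iff)
    then show "poly Q 0 \<le> 0" unfolding Qsgn grid P'sgn by simp
    have "0 < P' \<beta> / \<iota> D"
      using P[of \<beta>] B[of \<beta>] \<open>\<alpha> \<le> \<beta>\<close> e' by (auto simp: P'_def abs_le_iff)
    then show "0 < poly Q ((w - u) * k)" unfolding Qsgn grid P'sgn end1 by simp
  qed
  then obtain z where z: "0 \<le> z" "z < (w - u) * k" "poly Q z \<le> 0" "0 < poly Q (z + 1)" by blast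
  define x y where "x = \<alpha> + \<iota> z / \<iota> N" and "y = \<alpha> + \<iota> (z + 1) / \<iota> N"
  have xy: "P' x / \<iota> D \<le> 0" "0 < P' y / \<iota> D"
    using z(3,4) unfolding Qsgn grid P'sgn by (simp_all add: x_def y_def)
  have "z + 1 \<le> (w - u) * k" using z(2) discretely_ordered_less_iff by blast
  then have "\<iota> (z + 1) / \<iota> N \<le> \<iota> ((w - u) * k) / \<iota> N"
    using N by (intro divide_right_mono) (simp_all only: le_iff zero_le_iff less_imp_le)
  then have "y \<le> \<beta>" unfolding y_def end1[symmetric] by simp
  moreover have "\<alpha> \<le> x" using z N by (simp add: x_def)
  moreover have yx: "y - x = 1 / \<iota> N" by (simp add: x_def y_def add_divide_distrib)
  moreover have "0 < 1 / \<iota> N" using N by simp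
  ultimately have bounds: "\<alpha> \<le> x" "x < y" "y \<le> \<beta>" by linarith+
  have "1 / \<iota> N \<le> 1 / \<iota> k"
  proof -
    have "k \<le> N" unfolding N_def using mult_right_mono[OF one_least_positive[OF assms(1)], of k] k by simp
    then show ?thesis using k by (simp add: frac_le)
  qed
  then have "L * (1 / \<iota> N) \<le> L * (1 / \<iota> k)" using L by (intro mult_left_mono)
  also have "L * (1 / \<iota> k) \<le> e / 2" using k assms(5) by (simp add: field_simps)
  finally have "L * \<bar>x - y\<bar> \<le> e / 2"
    using N unfolding abs_minus_commute[of x y] yx by simp
  then have "\<bar>poly p x - poly p y\<bar> \<le> e / 2"
    using L(2)[of x y] B[of x] B[of y] bounds by auto
  moreover have "poly p x \<le> e'" "- e' \<le> poly p y"
    using P[of x] P[of y] B[of x] B[of y] bounds xy by (auto simp: P'_def abs_le_iff)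
  \<comment> \<open>\<open>p x\<close> is at most \<open>e'\<close>, and at least
    \<open>- e' - e / 2\<close> by comparison with the next grid point; \<open>e'\<close> is at most
    \<open>e / 2\<close>.\<close>
  ultimately have "\<bar>poly p x\<bar> \<le> e" using e' assms(5) unfolding abs_le_iff by linarith
  moreover have "x = \<iota> (u * k + z) / \<iota> N"
    unfolding x_def grid[symmetric] by simp
  ultimately show ?thesis using N bounds unfolding \<alpha>_def \<beta>_def by (metis order_trans less_imp_le)
qed

lemma almost_root:
  assumes "0 < n" "0 < m" "\<iota> u / \<iota> n < \<iota> w / \<iota> m" "poly p (\<iota> u / \<iota> n) * poly p (\<iota> w / \<iota> m) < 0" "0 < e"
  shows "\<exists>a b. 0 < b \<and> \<iota> u / \<iota> n \<le> \<iota> a / \<iota> b \<and> \<iota> a / \<iota> b \<le> \<iota> w / \<iota> m \<and> \<bar>poly p (\<iota> a / \<iota> b)\<bar> \<le> e"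
proof -
  have 1: "\<iota> u / \<iota> n = \<iota> (u * m) / \<iota> (n * m)" "\<iota> w / \<iota> m = \<iota> (w * n) / \<iota> (n * m)"
    using assms by simp_all
  have "\<iota> (u * m) < \<iota> (w * n)" using assms(1-3) by (simp add: divide_simps mult.commute)
  then have "u * m < w * n" by (simp only: less_iff)
  moreover have nm: "0 < n * m" using assms by simp
  ultimately show ?thesis
    using almost_root_aux[OF nm, of "u * m" "w * n" p e] almost_root_aux[OF nm, of "u * m" "w * n" "- p" e] assms(4,5)
    unfolding 1 by (auto simp: mult_less_0_iff)
qed

text \<open>
  Near an approximate root the derivative is at least \<open>c\<close> in absolute value, by Bezout, so \<open>p\<close> is
  steep on an interval \<open>I\<close> whose radius does not depend on the quality of the approximation.
\<close>

lemma root_of_coprime: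
  assumes uv: "u * p + v * pderiv p = 1" and "0 < n" "0 < m"
    and ab: "\<iota> s / \<iota> n < \<iota> t / \<iota> m" "poly p (\<iota> s / \<iota> n) * poly p (\<iota> t / \<iota> m) < 0"
  shows "\<exists>x. poly p x = 0"
proof -
  \<comment> \<open>The margin 2 leaves room for the radius \<open>r \<le> 1\<close> around an
    approximate root and for a further distance of at most 1 to the limit
    \<open>\<xi>\<close>.\<close>
  define \<alpha> \<beta> B where "\<alpha> = \<iota> s / \<iota> n" and "\<beta> = \<iota> t / \<iota> m" and "B = max \<bar>\<alpha>\<bar> \<bar>\<beta>\<bar> + 2"
  have B: "\<bar>x\<bar> \<le> B" if "\<alpha> \<le> x + 2" "x \<le> \<beta> + 2" for x using that by (auto simp: B_def abs_if max_def)
  obtain K1 where K1: "K1 > 0" "\<And>x. \<bar>x\<bar> \<le> B \<Longrightarrow> \<bar>poly u x\<bar> \<le> K1" using poly_bounded by metis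
  obtain K2 where K2: "K2 > 0" "\<And>x. \<bar>x\<bar> \<le> B \<Longrightarrow> \<bar>poly v x\<bar> \<le> K2" using poly_bounded by metis
  obtain L where L: "L \<ge> 0" "\<And>x y. \<bar>x\<bar> \<le> B \<Longrightarrow> \<bar>y\<bar> \<le> B \<Longrightarrow> \<bar>poly p x - poly p y\<bar> \<le> L * \<bar>x - y\<bar>"
    using poly_lipschitz by metis
  obtain L' where L': "L' \<ge> 0"
    "\<And>x y. \<bar>x\<bar> \<le> B \<Longrightarrow> \<bar>y\<bar> \<le> B \<Longrightarrow> \<bar>poly (pderiv p) x - poly (pderiv p) y\<bar> \<le> L' * \<bar>x - y\<bar>"
    using poly_lipschitz by metis
  obtain C where C: "C \<ge> 0" "\<And>x y. \<bar>x\<bar> \<le> B \<Longrightarrow> \<bar>y\<bar> \<le> B \<Longrightarrow>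
    \<bar>poly p y - poly p x - (y - x) * poly (pderiv p) x\<bar> \<le> C * \<bar>y - x\<bar> * \<bar>y - x\<bar>"
    using poly_taylor_bound by metis
  \<comment> \<open>Where \<open>\<bar>p\<bar> \<le> 1 / (2 * K1)\<close>, the term
    \<open>u p\<close> of the Bezout identity is at most 1/2 in absolute value, so the term with the
    derivative is at least 1/2.\<close>
  define c where "c = 1 / (2 * K2)"
  have c: "0 < c" using K2 by (simp add: c_def)
  have deriv_large: "c \<le> \<bar>poly (pderiv p) x\<bar>" if x: "\<bar>x\<bar> \<le> B" "\<bar>poly p x\<bar> \<le> 1 / (2 * K1)" for x
  proof -
    have "1 = \<bar>poly u x * poly p x + poly v x * poly (pderiv p) x\<bar>"
      using arg_cong[OF uv, of "\<lambda>q. poly q x"] by simp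
    also have "\<dots> \<le> \<bar>poly u x\<bar> * \<bar>poly p x\<bar> + \<bar>poly v x\<bar> * \<bar>poly (pderiv p) x\<bar>"
      by (metis abs_mult abs_triangle_ineq)
    also have "\<dots> \<le> K1 * (1 / (2 * K1)) + K2 * \<bar>poly (pderiv p) x\<bar>"
      using x K1 K2 by (intro add_mono mult_mono) auto
    finally have "1 \<le> 2 * K2 * \<bar>poly (pderiv p) x\<bar>" using K1(1) by simp
    then show ?thesis using K2(1) by (simp add: c_def field_simps)
  qed
  \<comment> \<open>With \<open>r = 1 / \<iota> w\<close>, the second-order error and the variation
    of the derivative together cost at most half of the slope \<open>c\<close>. The choice precedes
    that of the approximate root, and as the inverse of an element of \<open>M\<close> it keeps the
    ends \<open>x - r\<close> and \<open>x + r\<close> fractions.\<close>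
  obtain w where w: "0 < w" "(4 * C + 2 * L') / c < \<iota> w" using unbounded by blast
  define r where "r = 1 / \<iota> w"
  have r: "0 < r" "r \<le> 1" using w one_least_positive[OF w(1)] by (auto simp: r_def)
  have rC: "C * (2 * r) + L' * r \<le> c / 2"
    using w c by (simp add: r_def field_simps)
  define e where "e = min (1 / (2 * K1)) (r * c / 4)"
  have e: "0 < e" "e \<le> 1 / (2 * K1)" using K1 r c by (auto simp: e_def)
  have "e \<le> r * c / 4" by (simp add: e_def)
  then have e_less: "e < r * c / 2" using mult_pos_pos[OF r(1) c] by simp
  obtain a b where "0 < b" and x0: "\<alpha> \<le> \<iota> a / \<iota> b" "\<iota> a / \<iota> b \<le> \<beta>" "\<bar>poly p (\<iota> a / \<iota> b)\<bar> \<le> e"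
    using almost_root[OF assms(2,3) ab e(1)] unfolding \<alpha>_def \<beta>_def by blast
  define x where "x = \<iota> a / \<iota> b"
  have xB: "\<bar>x\<bar> \<le> B" using B[of x] x0 by (simp add: x_def)
  have d: "c \<le> \<bar>poly (pderiv p) x\<bar>" using deriv_large[OF xB] x0 e by (simp add: x_def)
  define g where "g = poly (pderiv p) x"
  have linear: "\<bar>poly p z - poly p y - (z - y) * g\<bar> \<le> (c / 2) * \<bar>z - y\<bar>"
    if yz: "\<bar>y - x\<bar> \<le> r" "\<bar>z - x\<bar> \<le> r" for y z
  proof -
    have yzB: "\<bar>y\<bar> \<le> B" "\<bar>z\<bar> \<le> B"
      using B[of y] B[of z] x0 yz r unfolding x_def[symmetric] by (auto simp: abs_le_iff)
    have "poly p z - poly p y - (z - y) * g = (poly p z - poly p y - (z - y) * poly (pderiv p) y)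
      + (z - y) * (poly (pderiv p) y - poly (pderiv p) x)"
      by (simp add: g_def algebra_simps)
    also have "\<bar>\<dots>\<bar> \<le> \<bar>poly p z - poly p y - (z - y) * poly (pderiv p) y\<bar>
        + \<bar>z - y\<bar> * \<bar>poly (pderiv p) y - poly (pderiv p) x\<bar>"
      by (metis abs_mult abs_triangle_ineq)
    also have "\<dots> \<le> C * \<bar>z - y\<bar> * \<bar>z - y\<bar> + \<bar>z - y\<bar> * (L' * \<bar>y - x\<bar>)"
      using C(2) L'(2) yzB xB by (intro add_mono mult_left_mono) auto
    also have "\<dots> \<le> C * \<bar>z - y\<bar> * (2 * r) + \<bar>z - y\<bar> * (L' * r)"
      using C(1) L'(1) yz by (intro add_mono mult_left_mono) auto
    also have "\<dots> = (C * (2 * r) + L' * r) * \<bar>z - y\<bar>" by (simp add: algebra_simps)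
    also have "\<dots> \<le> (c / 2) * \<bar>z - y\<bar>" using rC by (intro mult_right_mono) auto
    finally show ?thesis .
  qed
  have slope: "(c / 2) * \<bar>z - y\<bar> \<le> \<bar>poly p z - poly p y\<bar>" if "\<bar>y - x\<bar> \<le> r" "\<bar>z - x\<bar> \<le> r" for y z
  proof -
    have "c * \<bar>z - y\<bar> \<le> \<bar>g\<bar> * \<bar>z - y\<bar>" using d unfolding g_def[symmetric] by (intro mult_right_mono) auto
    also have "\<dots> = \<bar>(z - y) * g\<bar>" by (simp add: abs_mult)
    finally show ?thesis using linear[OF that] by (auto simp: abs_le_iff abs_if split: if_splits)
  qed
  \<comment> \<open>Over the radius \<open>r\<close> the linear part \<open>r * g\<close> outweighs
    the error and \<open>p x\<close> together. The sign change allows \<open>almost_root\<close> to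
    be used again inside \<open>I\<close>, now for every accuracy.\<close>
  have ends: "poly p (x - r) * poly p (x + r) < 0"
  proof -
    have 1: "\<bar>poly p (x + r) - poly p x - r * g\<bar> \<le> r * c / 2"
      "\<bar>poly p (x - r) - poly p x + r * g\<bar> \<le> r * c / 2"
      using linear[of x "x + r"] linear[of x "x - r"] r by (auto simp: mult.commute)
    have px: "\<bar>poly p x\<bar> < r * c / 2" using x0 e_less by (simp add: x_def)
    have "c \<le> g \<or> g \<le> - c" using d unfolding g_def[symmetric] by (auto simp: abs_if split: if_splits)
    then have "r * c \<le> r * g \<or> r * g \<le> - (r * c)"
      using r(1) by (metis mult_le_cancel_left_pos mult_minus_right)
    then have "poly p (x - r) < 0 \<and> 0 < poly p (x + r) \<or> 0 < poly p (x - r) \<and> poly p (x + r) < 0"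
      using 1 px unfolding abs_le_iff abs_less_iff by (elim disjE) linarith+
    then show ?thesis by (auto simp: mult_less_0_iff)
  qed
  have xr: "x - r = \<iota> (a * w - b) / \<iota> (b * w)" "x + r = \<iota> (a * w + b) / \<iota> (b * w)"
    using \<open>0 < b\<close> w by (simp_all add: x_def r_def field_simps)
  have bw: "0 < b * w" using \<open>0 < b\<close> w by simp
  define I where "I = {y. \<bar>y - x\<bar> \<le> r}"
  have small: "\<exists>y\<in>I. \<bar>poly p y\<bar> \<le> e" if e: "0 < e" for e
  proof -
    have "x - r < x + r" using r by simp
    then obtain a' b' where "x - r \<le> \<iota> a' / \<iota> b'" "\<iota> a' / \<iota> b' \<le> x + r" "\<bar>poly p (\<iota> a' / \<iota> b')\<bar> \<le> e"
      using almost_root[OF bw bw _ _ e, of "a * w - b" "a * w + b" p] ends unfolding xr by blast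
    then show ?thesis
      by (intro bexI[of _ "\<iota> a' / \<iota> b'"]) (auto simp: I_def abs_le_iff)
  qed
  define k where "k = c / 2"
  have k: "0 < k" using c by (simp add: k_def)
  \<comment> \<open>By steepness, a root in \<open>I\<close> is within
    \<open>\<bar>p y\<bar> / k\<close> of each \<open>y\<close> in \<open>I\<close>. These intervals
    meet pairwise and become arbitrarily short, so the cut of their end points is filled.\<close>
  have "\<exists>x. (\<forall>a\<in>{y - \<bar>poly p y\<bar> / k |y. y \<in> I}. a \<le> x) \<and> (\<forall>b\<in>{y + \<bar>poly p y\<bar> / k |y. y \<in> I}. x \<le> b)"
  proof (rule cut_complete)
    fix a b assume "a \<in> {y - \<bar>poly p y\<bar> / k |y. y \<in> I}" "b \<in> {y + \<bar>poly p y\<bar> / k |y. y \<in> I}"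
    then obtain y z where yz: "y \<in> I" "z \<in> I" "a = y - \<bar>poly p y\<bar> / k" "b = z + \<bar>poly p z\<bar> / k" by blast
    then have "k * \<bar>y - z\<bar> \<le> \<bar>poly p y - poly p z\<bar>" using slope[of z y] by (simp add: I_def k_def)
    also have "\<dots> \<le> \<bar>poly p y\<bar> + \<bar>poly p z\<bar>" by (rule abs_triangle_ineq4)
    finally have "\<bar>y - z\<bar> \<le> \<bar>poly p y\<bar> / k + \<bar>poly p z\<bar> / k" using k by (simp add: field_simps)
    then show "a \<le> b" using yz by (auto simp: abs_le_iff)
  next
    fix e :: 'k assume "0 < e"
    then obtain y where y: "y \<in> I" "\<bar>poly p y\<bar> \<le> k * e / 4" using small[of "k * e / 4"] k by auto
    then have "\<bar>poly p y\<bar> / k \<le> e / 4" using k by (simp add: field_simps)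
    then have "y + \<bar>poly p y\<bar> / k - (y - \<bar>poly p y\<bar> / k) < e" using \<open>0 < e\<close> by linarith
    then show "\<exists>a\<in>{y - \<bar>poly p y\<bar> / k |y. y \<in> I}. \<exists>b\<in>{y + \<bar>poly p y\<bar> / k |y. y \<in> I}. b - a < e"
      using y(1) by blast
  qed
  then obtain \<xi> where "\<And>y. y \<in> I \<Longrightarrow> y - \<bar>poly p y\<bar> / k \<le> \<xi>" "\<And>y. y \<in> I \<Longrightarrow> \<xi> \<le> y + \<bar>poly p y\<bar> / k"
    by blast
  then have \<xi>: "\<bar>\<xi> - y\<bar> \<le> \<bar>poly p y\<bar> / k" if "y \<in> I" for y
    using that by (auto simp: abs_le_iff algebra_simps)
  \<comment> \<open>\<open>\<xi>\<close> is not known to lie in \<open>I\<close>, but its distance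
    from some \<open>y\<close> in \<open>I\<close> is at most \<open>e / k \<le> 1\<close>, so the
    Lipschitz bound on the larger set still applies.\<close>
  have bound: "\<bar>poly p \<xi>\<bar> \<le> (1 + L / k) * e" if e: "0 < e" "e \<le> k" for e
  proof -
    obtain y where y: "y \<in> I" "\<bar>poly p y\<bar> \<le> e" using small[OF e(1)] by blast
    have dist: "\<bar>\<xi> - y\<bar> \<le> e / k" using \<xi>[OF y(1)] y(2) k by (meson divide_right_mono less_imp_le order_trans)
    also have "\<dots> \<le> 1" using e k by simp
    finally have "\<bar>\<xi>\<bar> \<le> B" "\<bar>y\<bar> \<le> B"
      using B[of y] B[of \<xi>] x0 y(1) r unfolding x_def[symmetric] I_def by (auto simp: abs_le_iff)
    have "\<bar>poly p \<xi>\<bar> \<le> \<bar>poly p \<xi> - poly p y\<bar> + \<bar>poly p y\<bar>" by (simp add: abs_if)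
    also have "\<dots> \<le> L * \<bar>\<xi> - y\<bar> + e"
      using L(2)[OF \<open>\<bar>\<xi>\<bar> \<le> B\<close> \<open>\<bar>y\<bar> \<le> B\<close>] y by simp
    also have "L * \<bar>\<xi> - y\<bar> \<le> L * (e / k)" using dist L(1) by (rule mult_left_mono)
    finally show ?thesis by (simp add: algebra_simps)
  qed
  have "poly p \<xi> = 0"
  proof (rule ccontr)
    assume nz: "poly p \<xi> \<noteq> 0"
    define M where "M = 1 + L / k"
    have M: "1 \<le> M" using L k by (simp add: M_def)
    define e where "e = min k (\<bar>poly p \<xi>\<bar> / (2 * M))"
    have "0 < e" using nz k M by (simp add: e_def)
    then have "\<bar>poly p \<xi>\<bar> \<le> M * e" using bound[of e] by (simp add: M_def e_def)
    also have "\<dots> \<le> M * (\<bar>poly p \<xi>\<bar> / (2 * M))" using M by (intro mult_left_mono) (auto simp: e_def)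
    also have "\<dots> = \<bar>poly p \<xi>\<bar> / 2" using M by simp
    finally show False using nz by simp
  qed
  then show ?thesis ..
qed

text \<open>A nonconstant common divisor \<open>g\<close> of \<open>p\<close> and its derivative
  gives \<open>p = g * h\<close> with both degrees smaller, because the derivative is nonzero in
  characteristic 0. The product of signs shows that one of the factors changes sign.\<close>

lemma root_exists:
  assumes "0 < n" "0 < m" "\<iota> s / \<iota> n < \<iota> t / \<iota> m" "poly p (\<iota> s / \<iota> n) * poly p (\<iota> t / \<iota> m) < 0"
  shows "\<exists>x. poly p x = 0"
  using assms(4)
proof (induction "Polynomial.degree p" arbitrary: p rule: less_induct)
  case less
  have p0: "p \<noteq> 0" using less.prems by auto
  have deg: "Polynomial.degree p \<noteq> 0"
  proof
    assume "Polynomial.degree p = 0"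
    then obtain c where "p = [:c:]" by (metis degree_eq_zeroE)
    then show False using less.prems by (auto simp: mult_less_0_iff)
  qed
  obtain g u v where g: "g = u * p + v * pderiv p" "g dvd p" "g dvd pderiv p"
    using poly_bezout by metis
  have g0: "g \<noteq> 0" using g(2) p0 by auto
  show ?case
  proof (cases "Polynomial.degree g = 0")
    case True
    then obtain c where c: "g = [:c:]" "c \<noteq> 0" using g0 by (metis degree_eq_zeroE pCons_0_0)
    have "Polynomial.smult (1 / c) u * p + Polynomial.smult (1 / c) v * pderiv p = Polynomial.smult (1 / c) g"
      by (simp add: g(1) smult_add_right)
    also have "\<dots> = 1" using c by (simp add: one_pCons)
    finally show ?thesis using root_of_coprime assms(1-3) less.prems by blast
  next
    case False
    obtain h where h: "p = g * h" using g(2) by blast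
    have "pderiv p \<noteq> 0" using deg by (simp add: pderiv_eq_0_iff)
    then have "Polynomial.degree g < Polynomial.degree p"
      using dvd_imp_degree_le[OF g(3)] deg by (simp add: degree_pderiv)
    moreover have "Polynomial.degree h < Polynomial.degree p"
      using False p0 by (auto simp: h degree_mult_eq)
    moreover have "(poly g (\<iota> s / \<iota> n) * poly g (\<iota> t / \<iota> m)) * (poly h (\<iota> s / \<iota> n) * poly h (\<iota> t / \<iota> m)) < 0"
      using less.prems by (simp add: h mult_ac)
    then have "poly g (\<iota> s / \<iota> n) * poly g (\<iota> t / \<iota> m) < 0 \<or> poly h (\<iota> s / \<iota> n) * poly h (\<iota> t / \<iota> m) < 0"
      by (metis mult_less_0_iff)
    ultimately have "(\<exists>x. poly g x = 0) \<or> (\<exists>x. poly h x = 0)"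
      using less.hyps by blast
    then show ?thesis by (auto simp: h)
  qed
qed

theorem real_closed: "real_closed_subfield (UNIV :: 'k set)"
proof
  fix x :: 'k assume "0 \<le> x"
  obtain c where c: "0 < c" "x < \<iota> c" using unbounded by blast
  show "\<exists>y\<in>UNIV. y * y = x"
  proof (cases "x = 0")
    case False
    have "\<iota> c * 1 \<le> \<iota> c * \<iota> c" using one_least_positive[OF c(1)] c by (intro mult_left_mono) auto
    then have "x < \<iota> c * \<iota> c" using c(2) by simp
    then have "0 < x * (\<iota> c * \<iota> c - x)"
      using \<open>0 \<le> x\<close> False by (intro mult_pos_pos) auto
    then have "\<exists>y. poly [:- x, 0, 1:] y = 0"
      using c by (intro root_exists[of 1 1 0 c]) (auto simp: mult_less_0_iff)
    then show ?thesis by auto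
  qed auto
next
  fix p :: "'k poly" assume "odd (Polynomial.degree p)"
  then obtain b where b: "\<And>x. x \<ge> b \<Longrightarrow> poly p (- x) * poly p x < 0"
    using poly_odd_degree_sign_change by blast
  obtain c where c: "0 < c" "b < \<iota> c" using unbounded by blast
  have "\<exists>x. poly p x = 0"
    using b[of "\<iota> c"] c by (intro root_exists[of 1 1 "- c" c]) auto
  then show "\<exists>x\<in>UNIV. poly p x = 0" by blast
qed auto

end

section \<open>The exponential function of the completion\<close>

context complete_extension
begin

lemma le_if_small:
  assumes "\<And>c. 0 < c \<Longrightarrow> (x - y) * \<iota> c \<le> k"
  shows "x \<le> y"
proof (rule ccontr)
  assume "\<not> x \<le> y"
  moreover obtain c where "0 < c" "k / (x - y) < \<iota> c" using unbounded by blast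
  ultimately show False using assms[of c] by (simp add: field_simps)
qed

end

section \<open>The binary logarithm\<close>

locale txy_extension = iopen_extension \<iota>
  for \<iota> :: "'a::discretely_ordered_ring \<Rightarrow> 'k::linordered_field" +
  fixes pw :: "'a \<Rightarrow> 'a \<Rightarrow> 'a"
  assumes pw_nonneg: "0 \<le> x \<Longrightarrow> 0 \<le> y \<Longrightarrow> 0 \<le> pw x y"
    and pw_0_right: "0 \<le> x \<Longrightarrow> pw x 0 = 1"
    and pw_1_right: "0 \<le> x \<Longrightarrow> pw x 1 = x"
    and pw_1_left: "0 \<le> x \<Longrightarrow> pw 1 x = 1"
    and pw_add: "0 \<le> x \<Longrightarrow> 0 \<le> y \<Longrightarrow> 0 \<le> z \<Longrightarrow> pw x (y + z) = pw x y * pw x z"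
    and pw_mult: "0 \<le> x \<Longrightarrow> 0 \<le> y \<Longrightarrow> 0 \<le> z \<Longrightarrow> pw (x * y) z = pw x z * pw y z"
    and pw_pw: "0 \<le> x \<Longrightarrow> 0 \<le> y \<Longrightarrow> 0 \<le> z \<Longrightarrow> pw (pw x y) z = pw x (y * z)"
    and pw_less_right: "1 < x \<Longrightarrow> 0 \<le> y \<Longrightarrow> 0 \<le> z \<Longrightarrow> y < z \<longleftrightarrow> pw x y < pw x z"
    and pw_less_left: "0 < x \<Longrightarrow> 0 \<le> y \<Longrightarrow> 0 \<le> z \<Longrightarrow> y < z \<longleftrightarrow> pw y x < pw z x"
    and log2_exists: "0 < k \<Longrightarrow> \<exists>d\<ge>0. pw 2 d \<le> k \<and> k < pw 2 (d + 1)"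
    and root_floor: "0 \<le> x \<Longrightarrow> 0 < c \<Longrightarrow> \<exists>m\<ge>0. pw m c \<le> x \<and> x < pw (m + 1) c"
    and pw_bernoulli: "\<lbrakk>0 < a; 0 < b; 0 < y; y \<le> x\<rbrakk> \<Longrightarrow>
      pw (b * y + a * x) y * pw b x \<le> pw (b + a) x * pw (b * y) y"
begin

lemma pw_pos: "0 < n \<Longrightarrow> 0 \<le> m \<Longrightarrow> 0 < pw n m"
  using pw_less_left[of m 0 n] pw_nonneg[of 0 m] by (cases "m = 0") (auto simp: pw_0_right)

lemma pw_2_le_iff: "0 \<le> y \<Longrightarrow> 0 \<le> z \<Longrightarrow> pw 2 y \<le> pw 2 z \<longleftrightarrow> y \<le> z"
  using pw_less_right[of 2 z y] by (simp add: not_less[symmetric])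

lemma pw_mono_left: "0 \<le> x \<Longrightarrow> x \<le> y \<Longrightarrow> 0 < c \<Longrightarrow> pw x c \<le> pw y c"
  using pw_less_left[of c y x] by (simp add: not_less[symmetric])

text \<open>From \<open>0 = 0 * 2\<close>, the value \<open>pw 0 m\<close> is unchanged by
  multiplication with \<open>pw 2 m\<close>, which exceeds 1.\<close>

lemma pw_0_left:
  assumes "0 < m"
  shows "pw 0 m = 0"
proof -
  have "pw 0 m = pw 0 m * pw 2 m" using pw_mult[of 0 2 m] assms by simp
  moreover have "1 < pw 2 m" using pw_less_right[of 2 0 m] assms by (simp add: pw_0_right)
  ultimately show ?thesis by simp
qed

definition is_log :: "'a \<Rightarrow> 'k \<Rightarrow> bool" where
  "is_log n x \<longleftrightarrow> (\<forall>b d. 0 < b \<longrightarrow> 0 \<le> d \<longrightarrow> (pw 2 d \<le> pw n b \<longrightarrow> \<iota> d \<le> x * \<iota> b)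
    \<and> (pw n b \<le> pw 2 d \<longrightarrow> x * \<iota> b \<le> \<iota> d))"

text \<open>\<open>log2_exists\<close> for \<open>pw n c\<close> yields neighbouring exponents
  \<open>d\<close> and \<open>d + 1\<close>, hence bounds that are \<open>1 / c\<close>
  apart.\<close>

lemma is_log_exists:
  assumes n: "0 < n"
  shows "\<exists>x. is_log n x"
proof -
  define A where "A = {\<iota> d / \<iota> b | d b. 0 < b \<and> 0 \<le> d \<and> pw 2 d \<le> pw n b}"
  define B where "B = {\<iota> d / \<iota> b | d b. 0 < b \<and> 0 \<le> d \<and> pw n b \<le> pw 2 d}"
  have "\<exists>x. (\<forall>a\<in>A. a \<le> x) \<and> (\<forall>b\<in>B. x \<le> b)"
  proof (rule cut_complete)
    fix x y assume "x \<in> A" "y \<in> B"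
    then obtain d b d' b' where x: "x = \<iota> d / \<iota> b" "0 < b" "0 \<le> d" "pw 2 d \<le> pw n b"
      and y: "y = \<iota> d' / \<iota> b'" "0 < b'" "0 \<le> d'" "pw n b' \<le> pw 2 d'" by (auto simp: A_def B_def)
    have "pw 2 (d * b') = pw (pw 2 d) b'" using x y by (simp add: pw_pw)
    also have "\<dots> \<le> pw (pw n b) b'" using x y by (intro pw_mono_left pw_nonneg) auto
    also have "\<dots> = pw (pw n b') b" using x y n by (simp add: pw_pw mult.commute)
    also have "\<dots> \<le> pw (pw 2 d') b" using x y n by (intro pw_mono_left pw_nonneg) auto
    also have "\<dots> = pw 2 (d' * b)" using x y by (simp add: pw_pw)
    finally have "d * b' \<le> d' * b" using x y by (simp add: pw_2_le_iff)
    then have "\<iota> (d * b') \<le> \<iota> (d' * b)" by (simp only: le_iff)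
    then show "x \<le> y" using x y by (simp add: pos_divide_le_eq pos_le_divide_eq)
  next
    fix e :: 'k assume "0 < e"
    then obtain c where c: "0 < c" "1 / \<iota> c < e" using inverse_small by blast
    obtain d where d: "0 \<le> d" "pw 2 d \<le> pw n c" "pw n c < pw 2 (d + 1)"
      using log2_exists[of "pw n c"] pw_pos[of n c] n c by auto
    have "\<iota> d / \<iota> c \<in> A" unfolding A_def using c d by blast
    moreover have "\<iota> (d + 1) / \<iota> c \<in> B"
      unfolding B_def using c d add_nonneg_nonneg[OF d(1) zero_le_one] by (blast intro: less_imp_le)
    moreover have "\<iota> (d + 1) / \<iota> c - \<iota> d / \<iota> c < e"
      using c by (simp add: diff_divide_distrib[symmetric])
    ultimately show "\<exists>a\<in>A. \<exists>b\<in>B. b - a < e" by blast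
  qed
  then obtain x where x: "\<And>a. a \<in> A \<Longrightarrow> a \<le> x" "\<And>b. b \<in> B \<Longrightarrow> x \<le> b" by blast
  have "is_log n x"
    unfolding is_log_def
  proof (intro allI impI conjI)
    fix b d :: 'a assume b: "0 < b" "0 \<le> d"
    show "\<iota> d \<le> x * \<iota> b" if "pw 2 d \<le> pw n b"
      using x(1)[of "\<iota> d / \<iota> b"] b that by (auto simp: A_def pos_divide_le_eq)
    show "x * \<iota> b \<le> \<iota> d" if "pw n b \<le> pw 2 d"
      using x(2)[of "\<iota> d / \<iota> b"] b that by (auto simp: B_def pos_le_divide_eq)
  qed
  then show ?thesis ..
qed

definition lb :: "'a \<Rightarrow> 'k" where
  "lb n = (SOME x. is_log n x)"

lemma lb_lower: "0 < n \<Longrightarrow> 0 < b \<Longrightarrow> 0 \<le> d \<Longrightarrow> pw 2 d \<le> pw n b \<Longrightarrow> \<iota> d \<le> lb n * \<iota> b"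
  and lb_upper: "0 < n \<Longrightarrow> 0 < b \<Longrightarrow> 0 \<le> d \<Longrightarrow> pw n b \<le> pw 2 d \<Longrightarrow> lb n * \<iota> b \<le> \<iota> d"
  using someI_ex[OF is_log_exists] by (auto simp: lb_def is_log_def)

lemma lb_bracket:
  assumes "0 < n" "0 < c"
  obtains d where "0 \<le> d" "pw 2 d \<le> pw n c" "pw n c \<le> pw 2 (d + 1)" "\<iota> d \<le> lb n * \<iota> c" "lb n * \<iota> c \<le> \<iota> d + 1"
proof -
  obtain d where d: "0 \<le> d" "pw 2 d \<le> pw n c" "pw n c < pw 2 (d + 1)"
    using log2_exists[of "pw n c"] pw_pos[of n c] assms by auto
  then show ?thesis
    using that[of d] lb_lower[of n c d] lb_upper[of n c "d + 1"] assms by simp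
qed

lemma lb_1 [simp]: "lb 1 = 0"
  using lb_lower[of 1 1 0] lb_upper[of 1 1 0] by (simp add: pw_0_right pw_1_left)

lemma lb_2 [simp]: "lb 2 = 1"
  using lb_lower[of 2 1 1] lb_upper[of 2 1 1] by simp

lemma lb_mult:
  assumes m: "0 < m" and n: "0 < n"
  shows "lb (m * n) = lb m + lb n"
proof -
  have "lb (m * n) - (lb m + lb n) = 0"
  proof (rule zero_if_small)
    fix c :: 'a assume c: "0 < c"
    obtain d where d: "0 \<le> d" "pw 2 d \<le> pw m c" "pw m c \<le> pw 2 (d + 1)" "\<iota> d \<le> lb m * \<iota> c" "lb m * \<iota> c \<le> \<iota> d + 1"
      by (rule lb_bracket[OF m c])
    obtain d' where d': "0 \<le> d'" "pw 2 d' \<le> pw n c" "pw n c \<le> pw 2 (d' + 1)" "\<iota> d' \<le> lb n * \<iota> c" "lb n * \<iota> c \<le> \<iota> d' + 1"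
      by (rule lb_bracket[OF n c])
    have mn: "pw (m * n) c = pw m c * pw n c" using m n c by (simp add: pw_mult)
    have "pw 2 (d + d') \<le> pw (m * n) c"
      unfolding mn using d d' m n c by (simp add: pw_add pw_nonneg mult_mono)
    then have 1: "\<iota> (d + d') \<le> lb (m * n) * \<iota> c"
      using d(1) d'(1) m n c by (intro lb_lower) auto
    have "pw 2 ((d + 1) + (d' + 1)) = pw 2 (d + 1) * pw 2 (d' + 1)"
      using d(1) d'(1) by (intro pw_add) auto
    then have "pw (m * n) c \<le> pw 2 ((d + 1) + (d' + 1))"
      unfolding mn using d d' m n c pw_nonneg by (auto intro!: mult_mono)
    then have 2: "lb (m * n) * \<iota> c \<le> \<iota> ((d + 1) + (d' + 1))"
      using d(1) d'(1) m n c by (intro lb_upper) auto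
    have "\<bar>(lb (m * n) - (lb m + lb n)) * \<iota> c\<bar> \<le> 2"
      using 1 2 d(4,5) d'(4,5) unfolding abs_le_iff left_diff_distrib distrib_right add one by linarith
    then show "\<bar>lb (m * n) - (lb m + lb n)\<bar> * \<iota> c \<le> 2"
      using c by (simp add: abs_mult)
  qed
  then show ?thesis by simp
qed

lemma lb_mono:
  assumes "0 < m" "m \<le> n"
  shows "lb m \<le> lb n"
proof (rule le_if_small)
  fix c :: 'a assume c: "0 < c"
  obtain d where d: "0 \<le> d" "pw 2 d \<le> pw m c" "pw m c \<le> pw 2 (d + 1)" "\<iota> d \<le> lb m * \<iota> c" "lb m * \<iota> c \<le> \<iota> d + 1"
    by (rule lb_bracket[OF assms(1) c])
  have "pw m c \<le> pw n c" using assms c by (intro pw_mono_left) auto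
  then have "\<iota> d \<le> lb n * \<iota> c" using d assms c by (intro lb_lower) auto
  then show "(lb m - lb n) * \<iota> c \<le> 1" using d(5) by (simp add: left_diff_distrib)
qed

lemma lb_pw:
  assumes n: "0 < n" and m: "0 \<le> m"
  shows "lb (pw n m) = \<iota> m * lb n"
proof (cases "m = 0")
  case True
  then show ?thesis using n by (simp add: pw_0_right)
next
  case False
  then have m: "0 < m" using m by simp
  have "lb (pw n m) - \<iota> m * lb n = 0"
  proof (rule zero_if_small)
    fix c :: 'a assume c: "0 < c"
    obtain d where d: "0 \<le> d" "pw 2 d \<le> pw n (m * c)" "pw n (m * c) \<le> pw 2 (d + 1)"
      "\<iota> d \<le> lb n * \<iota> (m * c)" "lb n * \<iota> (m * c) \<le> \<iota> d + 1"
      by (rule lb_bracket[OF n mult_pos_pos[OF m c]])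
    have nm: "pw n (m * c) = pw (pw n m) c" using n m c by (simp add: pw_pw)
    have "\<iota> d \<le> lb (pw n m) * \<iota> c"
      using d n m c unfolding nm by (intro lb_lower pw_pos) auto
    moreover have "lb (pw n m) * \<iota> c \<le> \<iota> (d + 1)"
      using d n m c unfolding nm by (intro lb_upper pw_pos) auto
    moreover have "lb n * \<iota> (m * c) = \<iota> m * lb n * \<iota> c" by simp
    ultimately have "\<bar>(lb (pw n m) - \<iota> m * lb n) * \<iota> c\<bar> \<le> 1"
      using d(4,5) unfolding abs_le_iff left_diff_distrib add one by linarith
    then show "\<bar>lb (pw n m) - \<iota> m * lb n\<bar> * \<iota> c \<le> 1"
      using c by (simp add: abs_mult)
  qed
  then show ?thesis by simp
qed

text \<open>\<open>pw_bernoulli\<close> with \<open>a = y = 1\<close> and \<open>b = x = n\<close>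
  says that the \<open>n\<close>-th power of \<open>1 + 1 / n\<close> is at least 2.\<close>

lemma lb_step_lower:
  assumes "0 < n"
  shows "1 \<le> \<iota> n * (lb (n + 1) - lb n)"
proof -
  have "pw (n * 1 + 1 * n) 1 * pw n n \<le> pw (n + 1) n * pw (n * 1) 1"
    using assms one_least_positive by (intro pw_bernoulli) auto
  then have "n * (2 * pw n n) \<le> n * pw (n + 1) n"
    using assms by (simp add: pw_1_right algebra_simps)
  then have "2 * pw n n \<le> pw (n + 1) n" using assms by simp
  then have "lb (2 * pw n n) \<le> lb (pw (n + 1) n)"
    using assms pw_pos[of n n] by (intro lb_mono) auto
  then show ?thesis
    using assms pw_pos[of n n] by (simp add: lb_mult lb_pw algebra_simps add_pos_pos)
qed

text \<open>The case \<open>2\<^bsup>1 + 1 / c\<^esup> \<ge> 2 + 1 / c\<close> of Bernoulli's inequality, divided by 2.\<close>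

lemma lb_step_upper:
  assumes "0 < c"
  shows "\<iota> c * (lb (2 * c + 1) - lb (2 * c)) \<le> 1"
proof -
  have c1: "0 < c + 1" using assms by (simp add: add_pos_pos)
  have "pw (1 * c + 1 * (c + 1)) c * pw 1 (c + 1) \<le> pw (1 + 1) (c + 1) * pw (1 * c) c"
    using assms by (intro pw_bernoulli) auto
  moreover have "1 * c + 1 * (c + 1) = 2 * c + 1" by simp
  ultimately have "pw (2 * c + 1) c \<le> pw 2 (c + 1) * pw c c"
    using c1 by (simp add: pw_1_left)
  moreover have pos: "0 < 2 * c + 1" "0 < pw (2 * c + 1) c" using assms pw_pos[of "2 * c + 1" c]
    by (simp_all add: add_pos_pos)
  ultimately have "lb (pw (2 * c + 1) c) \<le> lb (pw 2 (c + 1) * pw c c)"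
    by (intro lb_mono)
  also have "\<dots> = \<iota> (c + 1) + \<iota> c * lb c"
    using assms c1 pw_pos[of 2 "c + 1"] pw_pos[of c c] by (simp add: lb_mult lb_pw)
  finally show ?thesis
    using assms pos by (simp add: lb_pw lb_mult algebra_simps)
qed

lemma lb_strict_mono:
  assumes "0 < m" "m < n"
  shows "lb m < lb n"
proof -
  have "0 < lb (m + 1) - lb m"
    using lb_step_lower[OF assms(1)] assms(1) by (metis less_le_trans zero_less_one zero_less_iff zero_less_mult_pos)
  moreover have "lb (m + 1) \<le> lb n"
    using assms discretely_ordered_less_iff[of m n] by (intro lb_mono) (auto simp: add_pos_pos)
  ultimately show ?thesis by simp
qed

lemma lb_le_iff: "0 < m \<Longrightarrow> 0 < n \<Longrightarrow> lb m \<le> lb n \<longleftrightarrow> m \<le> n"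
  using lb_mono lb_strict_mono by (metis leD leI)

section \<open>The exponential function\<close>

text \<open>Let \<open>a\<close> be the integer part of \<open>y * b\<close>, and \<open>k\<close>
  that of the \<open>b\<close>-th root of \<open>pw 2 a * pw b b\<close>. Then \<open>k / b\<close>
  bounds the exponential of \<open>y\<close> from below. From above, \<open>(k + 1) / b\<close>
  covers the exponent \<open>a / b\<close>, and the factor \<open>(b + 1) / b\<close>, whose
  logarithm is at least \<open>1 / b\<close>, makes up for the rest
  \<open>y - a / b < 1 / b\<close>.\<close>

lemma exp_near_nonneg:
  assumes "0 \<le> y" "0 < e"
  shows "\<exists>a b c d. 0 < a \<and> 0 < b \<and> 0 < c \<and> 0 < d \<and> lb a \<le> y + lb b \<and> y + lb d \<le> lb c
    \<and> \<iota> c / \<iota> d - \<iota> a / \<iota> b < e"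
proof -
  obtain B where B: "0 < B" "y < \<iota> B" using unbounded by blast
  define U where "U = pw 2 B"
  have U: "0 < U" using B pw_pos[of 2 B] by (simp add: U_def)
  \<comment> \<open>It will turn out that \<open>k \<le> U * b\<close>, so the gap
    \<open>(k + b + 1) / (b * b)\<close> is at most \<open>(U + 2) / b\<close>.\<close>
  obtain b where b: "0 < b" "(\<iota> U + 2) / e < \<iota> b" using unbounded by blast
  obtain a where a: "0 \<le> a" "\<iota> a \<le> y * \<iota> b" "y * \<iota> b < \<iota> (a + 1)"
    using floor_nonneg[of "y * \<iota> b"] assms b by auto
  define x where "x = pw 2 a * pw b b"
  have pos: "0 < pw 2 a" "0 < pw b b" using a b pw_pos by auto
  obtain k where k: "0 \<le> k" "pw k b \<le> x" "x < pw (k + 1) b"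
    using root_floor[of x b] pos b by (auto simp: x_def)
  have "pw b b \<le> x" using mult_right_mono[OF one_least_positive[OF pos(1)], of "pw b b"] pos by (simp add: x_def)
  then have "pw b b < pw (k + 1) b" using k by simp
  then have "b < k + 1" using pw_less_left[of b b "k + 1"] b k by simp
  then have k0: "0 < k" "0 < k + 1" using b discretely_ordered_less_iff[of b "k + 1"] by auto
  have lnx: "lb x = \<iota> a + \<iota> b * lb b" using pos a b by (simp add: x_def lb_mult lb_pw)
  have "lb (pw k b) \<le> lb x" using k k0 b pw_pos by (intro lb_mono) auto
  then have "\<iota> b * lb k \<le> \<iota> b * (y + lb b)"
    using k0 b a by (simp add: lnx lb_pw algebra_simps)
  then have 1: "lb k \<le> y + lb b" using b by simp
  have "lb x \<le> lb (pw (k + 1) b)" using k pos by (intro lb_mono) (auto simp: x_def)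
  then have "\<iota> a + \<iota> b * lb b \<le> \<iota> b * lb (k + 1)" using k0 b by (simp add: lnx lb_pw)
  moreover have "lb ((k + 1) * (b + 1)) = lb (k + 1) + lb (b + 1)" "lb (b * b) = lb b + lb b"
    using b k0 by (simp_all only: lb_mult add_pos_pos zero_less_one)
  ultimately have "\<iota> b * (y + lb (b * b)) \<le> \<iota> b * lb ((k + 1) * (b + 1))"
    using a(3) lb_step_lower[OF b(1)] by (simp add: algebra_simps)
  then have 2: "y + lb (b * b) \<le> lb ((k + 1) * (b + 1))" using b by simp
  have "lb k \<le> lb (U * b)"
    using 1 B b U by (simp add: lb_mult) (simp add: U_def lb_pw)
  then have "k \<le> U * b" using k0 U b by (simp add: lb_le_iff)
  then have kU: "\<iota> k \<le> \<iota> (U * b)" by (simp only: le_iff)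
  have b1: "1 \<le> \<iota> b" using one_least_positive[OF b(1)] by simp
  have "\<iota> ((k + 1) * (b + 1)) / \<iota> (b * b) - \<iota> k / \<iota> b = (\<iota> k + \<iota> b + 1) / (\<iota> b * \<iota> b)"
    using b by (simp add: field_simps)
  also have "\<dots> \<le> ((\<iota> U + 2) * \<iota> b) / (\<iota> b * \<iota> b)"
  proof (rule divide_right_mono)
    show "\<iota> k + \<iota> b + 1 \<le> (\<iota> U + 2) * \<iota> b" using kU b1 unfolding mult distrib_right by linarith
  qed (use b in simp)
  also have "\<dots> = (\<iota> U + 2) / \<iota> b" using b by simp
  also have "\<dots> < e" using b assms(2) by (simp add: field_simps)
  finally have 3: "\<iota> ((k + 1) * (b + 1)) / \<iota> (b * b) - \<iota> k / \<iota> b < e" .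
  have "0 < (k + 1) * (b + 1)" "0 < b * b" using k0 b by (simp_all add: add_pos_pos)
  with 1 2 3 k0 b show ?thesis by blast
qed

text \<open>A negative \<open>y\<close> is shifted by an integer \<open>s\<close> and the bounds are
  divided by \<open>pw 2 s\<close>, which is at least 1 and does not widen the gap.\<close>

lemma exp_near:
  assumes "0 < e"
  shows "\<exists>a b c d. 0 < a \<and> 0 < b \<and> 0 < c \<and> 0 < d \<and> lb a \<le> y + lb b \<and> y + lb d \<le> lb c
    \<and> \<iota> c / \<iota> d - \<iota> a / \<iota> b < e"
proof -
  obtain s where s: "0 < s" "- y < \<iota> s" using unbounded by blast
  define T where "T = pw 2 s"
  have T: "0 < T" "lb T = \<iota> s" using s pw_pos[of 2 s] by (simp_all add: T_def lb_pw)
  obtain a b c d where *: "0 < a" "0 < b" "0 < c" "0 < d" "lb a \<le> y + \<iota> s + lb b" "y + \<iota> s + lb d \<le> lb c"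
    "\<iota> c / \<iota> d - \<iota> a / \<iota> b < e"
    using exp_near_nonneg[of "y + \<iota> s" e] s assms by auto
  have "\<iota> c / \<iota> (d * T) - \<iota> a / \<iota> (b * T) = (\<iota> c / \<iota> d - \<iota> a / \<iota> b) / \<iota> T"
    by (simp add: diff_divide_distrib)
  also have "\<dots> < e"
  proof -
    have "e * 1 \<le> e * \<iota> T" using assms one_least_positive[OF T(1)] by (intro mult_left_mono) auto
    then show ?thesis using *(7) T(1) by (simp add: pos_divide_less_eq)
  qed
  finally show ?thesis
    using * T by (intro exI[of _ a] exI[of _ "b * T"] exI[of _ c] exI[of _ "d * T"]) (auto simp: lb_mult algebra_simps simp del: mult)
qed

definition is_exp :: "'k \<Rightarrow> 'k \<Rightarrow> bool" where
  "is_exp y x \<longleftrightarrow> (\<forall>a b. 0 < a \<longrightarrow> 0 < b \<longrightarrow> (lb a \<le> y + lb b \<longrightarrow> \<iota> a / \<iota> b \<le> x)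
    \<and> (y + lb b \<le> lb a \<longrightarrow> x \<le> \<iota> a / \<iota> b))"

lemma is_exp_exists: "\<exists>x. is_exp y x"
proof -
  define A where "A = {\<iota> a / \<iota> b | a b. 0 < a \<and> 0 < b \<and> lb a \<le> y + lb b}"
  define B where "B = {\<iota> a / \<iota> b | a b. 0 < a \<and> 0 < b \<and> y + lb b \<le> lb a}"
  have "\<exists>x. (\<forall>a\<in>A. a \<le> x) \<and> (\<forall>b\<in>B. x \<le> b)"
  proof (rule cut_complete)
    fix x z assume "x \<in> A" "z \<in> B"
    then obtain a b c d where *: "0 < a" "0 < b" "0 < c" "0 < d" "x = \<iota> a / \<iota> b" "z = \<iota> c / \<iota> d"
      "lb a \<le> y + lb b" "y + lb d \<le> lb c" by (auto simp: A_def B_def)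
    then have "lb (a * d) \<le> lb (c * b)" by (simp add: lb_mult)
    then have "a * d \<le> c * b" using * by (simp add: lb_le_iff)
    then have "\<iota> (a * d) \<le> \<iota> (c * b)" by (simp only: le_iff)
    then show "x \<le> z" using * by (simp add: pos_divide_le_eq pos_le_divide_eq)
  next
    fix e :: 'k assume "0 < e"
    then obtain a b c d where *: "0 < a" "0 < b" "0 < c" "0 < d" "lb a \<le> y + lb b" "y + lb d \<le> lb c"
      "\<iota> c / \<iota> d - \<iota> a / \<iota> b < e" using exp_near by meson
    then have "\<iota> a / \<iota> b \<in> A" "\<iota> c / \<iota> d \<in> B" by (auto simp: A_def B_def)
    with *(7) show "\<exists>a\<in>A. \<exists>b\<in>B. b - a < e" by blast
  qed
  then obtain x where x: "\<And>a. a \<in> A \<Longrightarrow> a \<le> x" "\<And>b. b \<in> B \<Longrightarrow> x \<le> b" by blast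
  have "is_exp y x"
    unfolding is_exp_def
  proof (intro allI impI conjI)
    fix a b :: 'a assume ab: "0 < a" "0 < b"
    show "\<iota> a / \<iota> b \<le> x" if "lb a \<le> y + lb b"
      using ab that by (intro x) (auto simp: A_def)
    show "x \<le> \<iota> a / \<iota> b" if "y + lb b \<le> lb a"
      using ab that by (intro x) (auto simp: B_def)
  qed
  then show ?thesis ..
qed

definition E :: "'k \<Rightarrow> 'k" where
  "E y = (SOME x. is_exp y x)"

lemma E_lower: "0 < a \<Longrightarrow> 0 < b \<Longrightarrow> lb a \<le> y + lb b \<Longrightarrow> \<iota> a / \<iota> b \<le> E y"
  and E_upper: "0 < a \<Longrightarrow> 0 < b \<Longrightarrow> y + lb b \<le> lb a \<Longrightarrow> E y \<le> \<iota> a / \<iota> b"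
  using someI_ex[OF is_exp_exists] by (auto simp: E_def is_exp_def)

lemma E_diff_lb: "0 < a \<Longrightarrow> 0 < b \<Longrightarrow> E (lb a - lb b) = \<iota> a / \<iota> b"
  by (intro order_antisym E_lower E_upper) auto

lemma E_lb: "0 < a \<Longrightarrow> E (lb a) = \<iota> a"
  using E_diff_lb[of a 1] by simp

lemma E_pos: "0 < E y"
proof -
  obtain a b where "0 < a" "0 < b" "lb a \<le> y + lb b" using exp_near[of 1 y] by force
  then show ?thesis using E_lower[of a b y] by (meson divide_pos_pos less_le_trans zero_less_iff)
qed

lemma E_mono:
  assumes "y \<le> z"
  shows "E y \<le> E z"
proof (rule field_le_epsilon)
  fix e :: 'k assume "0 < e"
  then obtain a b c d where *: "0 < a" "0 < b" "0 < c" "0 < d" "lb a \<le> y + lb b" "y + lb d \<le> lb c"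
    "\<iota> c / \<iota> d - \<iota> a / \<iota> b < e" using exp_near by meson
  then show "E y \<le> E z + e"
    using E_upper[of c d y] E_lower[of a b z] assms by simp
qed

lemma E_add: "E (y + z) = E y * E z"
proof -
  have "E (y + z) - E y * E z = 0"
  proof (rule zero_if_small)
    fix n :: 'a assume n: "0 < n"
    define e where "e = 1 / \<iota> n"
    \<comment> \<open>\<open>e \<le> 1\<close> bounds \<open>q'\<close> by \<open>E z + 1\<close>,
      so that the error is a multiple of \<open>e\<close> with a factor independent of
      \<open>n\<close>.\<close>
    have e: "0 < e" "e \<le> 1" using n one_least_positive[OF n] by (simp_all add: e_def)
    obtain a b c d where 1: "0 < a" "0 < b" "0 < c" "0 < d" "lb a \<le> y + lb b" "y + lb d \<le> lb c"
      "\<iota> c / \<iota> d - \<iota> a / \<iota> b < e" using exp_near[OF e(1)] by meson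
    obtain a' b' c' d' where 2: "0 < a'" "0 < b'" "0 < c'" "0 < d'" "lb a' \<le> z + lb b'" "z + lb d' \<le> lb c'"
      "\<iota> c' / \<iota> d' - \<iota> a' / \<iota> b' < e" using exp_near[OF e(1)] by meson
    define p q p' q' where "p = \<iota> a / \<iota> b" and "q = \<iota> c / \<iota> d" and "p' = \<iota> a' / \<iota> b'" and "q' = \<iota> c' / \<iota> d'"
    have pq: "0 < p" "0 < p'" "0 < q" "0 < q'" "q - p < e" "q' - p' < e"
      using 1 2 by (simp_all add: p_def q_def p'_def q'_def)
    have y: "p \<le> E y" "E y \<le> q" and z: "p' \<le> E z" "E z \<le> q'"
      unfolding p_def q_def p'_def q'_def using 1 2 E_lower E_upper by auto
    have l: "p * p' \<le> E (y + z)"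
      using E_lower[of "a * a'" "b * b'" "y + z"] 1 2 by (simp add: lb_mult p_def p'_def)
    have u: "E (y + z) \<le> q * q'"
      using E_upper[of "c * c'" "d * d'" "y + z"] 1 2 by (simp add: lb_mult q_def q'_def)
    have yz: "p * p' \<le> E y * E z" "E y * E z \<le> q * q'"
      using y z pq E_pos[of y] E_pos[of z] by (auto intro!: mult_mono)
    have "q * q' - p * p' = (q - p) * q' + p * (q' - p')" by (simp add: algebra_simps)
    also have "\<dots> \<le> e * (E z + 1) + E y * e"
    proof (rule add_mono)
      show "(q - p) * q' \<le> e * (E z + 1)"
        using pq z(1) e by (intro mult_mono) linarith+
      show "p * (q' - p') \<le> E y * e"
        using pq y(1) z e by (intro mult_mono) linarith+
    qed
    finally have "\<bar>E (y + z) - E y * E z\<bar> \<le> (E z + 1 + E y) * e"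
      using l u yz by (simp add: abs_le_iff algebra_simps)
    then have "\<bar>E (y + z) - E y * E z\<bar> * \<iota> n \<le> (E z + 1 + E y) * e * \<iota> n"
      using n by (intro mult_right_mono) auto
    then show "\<bar>E (y + z) - E y * E z\<bar> * \<iota> n \<le> E z + 1 + E y"
      using n by (simp add: e_def)
  qed
  then show ?thesis by simp
qed

text \<open>For \<open>1 / c < w\<close>, the estimate \<open>lb_step_upper\<close> makes
  \<open>E w\<close> at least \<open>1 + 1 / (2 * c)\<close>. Strict monotonicity rests on this,
  since comparing cuts gives only the weak inequality.\<close>

lemma E_gt_1:
  assumes "0 < w"
  shows "1 < E w"
proof -
  obtain c where c: "0 < c" "1 / \<iota> c < w" using inverse_small[OF assms] by blast
  have "lb (2 * c + 1) - lb (2 * c) \<le> 1 / \<iota> c"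
    using lb_step_upper[OF c(1)] c by (simp add: pos_le_divide_eq mult.commute)
  then have "\<iota> (2 * c + 1) / \<iota> (2 * c) \<le> E w"
    using c by (intro E_lower) (auto simp: add_pos_pos)
  moreover have "1 < \<iota> (2 * c + 1) / \<iota> (2 * c)" using c by (simp add: hom_numeral)
  ultimately show ?thesis by (rule less_le_trans[rotated])
qed

lemma E_strict_mono:
  assumes "y < z"
  shows "E y < E z"
proof -
  have "E y * 1 < E y * E (z - y)"
    using E_gt_1[of "z - y"] E_pos[of y] assms by (intro mult_strict_left_mono) auto
  then show ?thesis by (simp flip: E_add)
qed

lemma E_le_iff: "E y \<le> E z \<longleftrightarrow> y \<le> z"
  using E_strict_mono E_mono by (metis leD leI)

text \<open>The preimage is the cut of the values \<open>lb a - lb b\<close> for fractions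
  \<open>a / b\<close> on either side of \<open>x\<close>.\<close>

lemma E_surj:
  assumes "0 < x"
  shows "\<exists>y. E y = x"
proof -
  define A where "A = {lb a - lb b | a b. 0 < a \<and> 0 < b \<and> \<iota> a \<le> x * \<iota> b}"
  define B where "B = {lb a - lb b | a b. 0 < a \<and> 0 < b \<and> x * \<iota> b \<le> \<iota> a}"
  have "\<exists>y. (\<forall>a\<in>A. a \<le> y) \<and> (\<forall>b\<in>B. y \<le> b)"
  proof (rule cut_complete)
    fix u v assume "u \<in> A" "v \<in> B"
    then obtain a b c d where *: "0 < a" "0 < b" "0 < c" "0 < d" "u = lb a - lb b" "v = lb c - lb d"
      "\<iota> a \<le> x * \<iota> b" "x * \<iota> d \<le> \<iota> c" by (auto simp: A_def B_def)
    have "\<iota> a * \<iota> d \<le> (x * \<iota> b) * \<iota> d" using * by (intro mult_right_mono) auto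
    also have "\<dots> = (x * \<iota> d) * \<iota> b" by simp
    also have "\<dots> \<le> \<iota> c * \<iota> b" using * by (intro mult_right_mono) auto
    finally have "a * d \<le> c * b" by (simp flip: mult)
    then have "lb (a * d) \<le> lb (c * b)" using * by (intro lb_mono) auto
    then show "u \<le> v" using * by (simp add: lb_mult)
  next
    fix e :: 'k assume "0 < e"
    then obtain c where c: "0 < c" "1 / \<iota> c < e" using inverse_small by blast
    \<comment> \<open>A fraction between \<open>x / t\<close> and \<open>x\<close> passes
      \<open>x\<close> when multiplied by \<open>t\<close>. The logarithms of the two fractions
      differ by that of \<open>t\<close>, which is at most \<open>1 / c\<close>.\<close>
    define t where "t = 1 + 1 / \<iota> (2 * c)"
    have t: "1 < t" "t = \<iota> (2 * c + 1) / \<iota> (2 * c)" using c by (simp_all add: t_def hom_numeral field_simps)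
    have "x / t < x" using t(1) assms by (simp add: divide_less_eq)
    then obtain a b where ab: "0 < b" "x / t < \<iota> a / \<iota> b" "\<iota> a / \<iota> b < x" using fraction_dense by blast
    have "0 < x / t" using assms t(1) by simp
    then have "0 < \<iota> a / \<iota> b" using ab by (meson less_trans)
    then have a: "0 < a" using ab by (simp add: pos_less_divide_eq)
    have "x < \<iota> a / \<iota> b * t" using ab t(1) by (simp add: pos_divide_less_eq)
    also have "\<dots> = \<iota> (a * (2 * c + 1)) / \<iota> (b * (2 * c))" unfolding t(2) by simp
    finally have "x * \<iota> (b * (2 * c)) \<le> \<iota> (a * (2 * c + 1))"
      using ab c by (simp add: pos_less_divide_eq less_imp_le del: mult add)
    moreover have "\<iota> a \<le> x * \<iota> b" using ab by (simp add: pos_divide_less_eq less_imp_le)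
    moreover have pos: "0 < a * (2 * c + 1)" "0 < b * (2 * c)" using a ab c by (simp_all add: add_pos_pos)
    ultimately have AB: "lb a - lb b \<in> A" "lb (a * (2 * c + 1)) - lb (b * (2 * c)) \<in> B"
      unfolding A_def B_def using a ab(1) by blast+
    have "lb (a * (2 * c + 1)) - lb (b * (2 * c)) - (lb a - lb b) = lb (2 * c + 1) - lb (2 * c)"
    proof -
      have "0 < 2 * c + 1" "0 < 2 * c" using c by (simp_all add: add_pos_pos)
      then show ?thesis using a ab(1) by (simp only: lb_mult)
    qed
    moreover have "lb (2 * c + 1) - lb (2 * c) \<le> 1 / \<iota> c"
      using lb_step_upper[OF c(1)] c by (simp add: pos_le_divide_eq mult.commute)
    ultimately have "lb (a * (2 * c + 1)) - lb (b * (2 * c)) - (lb a - lb b) < e" using c(2) by linarith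
    with AB show "\<exists>a\<in>A. \<exists>b\<in>B. b - a < e" by blast
  qed
  then obtain y where yA: "\<And>a. a \<in> A \<Longrightarrow> a \<le> y" and yB: "\<And>b. b \<in> B \<Longrightarrow> y \<le> b" by blast
  \<comment> \<open>Otherwise a fraction lies strictly between \<open>E y\<close> and
    \<open>x\<close>; its logarithm belongs to one side of the cut, against the monotonicity of
    \<open>E\<close>.\<close>
  have "E y = x"
  proof (rule ccontr)
    assume "E y \<noteq> x"
    then consider "E y < x" | "x < E y" by fastforce
    then show False
    proof cases
      case 1
      then obtain a b where ab: "0 < b" "E y < \<iota> a / \<iota> b" "\<iota> a / \<iota> b < x" using fraction_dense by blast
      have "0 < \<iota> a / \<iota> b" using ab E_pos[of y] by (meson less_trans)
      then have a: "0 < a" using ab by (simp add: pos_less_divide_eq)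
      have "lb a - lb b \<in> A" unfolding A_def using a ab by (auto simp: pos_divide_less_eq intro: less_imp_le)
      then show False using E_mono[OF yA] E_diff_lb[OF a ab(1)] ab by fastforce
    next
      case 2
      then obtain a b where ab: "0 < b" "x < \<iota> a / \<iota> b" "\<iota> a / \<iota> b < E y" using fraction_dense by blast
      have "0 < \<iota> a / \<iota> b" using ab assms by (meson less_trans)
      then have a: "0 < a" using ab by (simp add: pos_less_divide_eq)
      have "lb a - lb b \<in> B" unfolding B_def using a ab by (auto simp: pos_less_divide_eq intro: less_imp_le)
      then show False using E_mono[OF yB] E_diff_lb[OF a ab(1)] ab by fastforce
    qed
  qed
  then show ?thesis ..
qed

lemma E_inj: "inj E"
  by (metis E_strict_mono injI linorder_neqE less_irrefl)

lemma range_E: "range E = {0<..}"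
  using E_pos E_surj by (auto simp: image_iff) metis

definition lg :: "'k \<Rightarrow> 'k" where
  "lg = inv_into UNIV E"

lemma lg_E [simp]: "lg (E x) = x"
  by (simp add: lg_def E_inj)

lemma E_lg [simp]: "0 < x \<Longrightarrow> E (lg x) = x"
  unfolding lg_def using range_E by (intro f_inv_into_f) auto

lemma lg_hom: "0 < n \<Longrightarrow> lg (\<iota> n) = lb n"
  using lg_E[of "lb n"] by (simp add: E_lb)

lemma pw_conv_E: "0 < n \<Longrightarrow> 0 \<le> m \<Longrightarrow> \<iota> (pw n m) = E (\<iota> m * lg (\<iota> n))"
  using pw_pos[of n m] E_lb[of "pw n m"] by (simp add: lg_hom lb_pw)

text \<open>With the right-hand side \<open>Q\<close> kept fixed, a violation persists for fractions
  \<open>a / b < x\<close> and \<open>p / q \<le> y\<close>. For fractions the inequality is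
  \<open>pw_bernoulli\<close>, and monotonicity bounds its right-hand side by
  \<open>Q\<close>.\<close>

lemma bernoulli:
  assumes "0 < x" "1 \<le> y"
  shows "1 + x * y \<le> E (y * lg (1 + x))"
proof (rule ccontr)
  define Q where "Q = E (y * lg (1 + x))"
  assume "\<not> ?thesis"
  then have "Q - 1 < x * y" by (simp add: Q_def)
  then have "max ((Q - 1) / y) 0 < x" using assms by (simp add: pos_divide_less_eq)
  then obtain a b where ab: "0 < b" "(Q - 1) / y < \<iota> a / \<iota> b" "0 < \<iota> a / \<iota> b" "\<iota> a / \<iota> b < x"
    using fraction_dense by fastforce
  have a: "0 < a" using ab by (simp add: pos_less_divide_eq)
  define r where "r = \<iota> a / \<iota> b"
  have r: "0 < r" "Q - 1 < r * y" using ab assms by (simp_all add: r_def pos_divide_less_eq)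
  \<comment> \<open>\<open>pw_bernoulli\<close> requires \<open>q \<le> p\<close>. For
    \<open>y = 1\<close> no fraction lies strictly between 1 and \<open>y\<close>, so
    \<open>p = q = 1\<close> is taken.\<close>
  obtain p q where pq: "0 < q" "q \<le> p" "\<iota> p / \<iota> q \<le> y" "Q - 1 < r * (\<iota> p / \<iota> q)"
  proof (cases "y = 1")
    case True
    then show ?thesis using that[of 1 1] r by simp
  next
    case False
    then have "max 1 ((Q - 1) / r) < y" using assms r by (simp add: pos_divide_less_eq mult.commute)
    then obtain p q where "0 < q" "max 1 ((Q - 1) / r) < \<iota> p / \<iota> q" "\<iota> p / \<iota> q < y"
      using fraction_dense by blast
    then show ?thesis using that[of q p] r
      by (auto simp: pos_divide_less_eq[OF r(1)] pos_less_divide_eq mult.commute less_imp_le)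
  qed
  have p: "0 < p" using pq by simp
  have pos: "0 < b * q + a * p" "0 < b + a" "0 < b * q" using a ab p pq by (simp_all add: add_pos_pos)
  have "pw (b * q + a * p) q * pw b p \<le> pw (b + a) p * pw (b * q) q"
    using a ab pq by (intro pw_bernoulli) auto
  then have "lb (pw (b * q + a * p) q * pw b p) \<le> lb (pw (b + a) p * pw (b * q) q)"
    using pos ab p pq pw_pos[of "b * q + a * p" q] pw_pos[of b p] by (intro lb_mono) auto
  then have "\<iota> q * (lb (b * q + a * p) - lb (b * q)) \<le> \<iota> p * (lb (b + a) - lb b)"
    using pos ab p pq pw_pos[of "b * q + a * p" q] pw_pos[of b p] pw_pos[of "b + a" p] pw_pos[of "b * q" q]
    by (simp add: lb_mult[of "pw _ _"] lb_pw algebra_simps)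
  then have "lb (b * q + a * p) - lb (b * q) \<le> \<iota> p / \<iota> q * (lb (b + a) - lb b)"
    using pq by (simp add: pos_le_divide_eq mult.commute)
  also have "\<dots> \<le> y * lg (1 + x)"
  proof (intro mult_mono)
    have "E (lb (b + a) - lb b) = 1 + r" using pos ab by (simp add: E_diff_lb r_def field_simps)
    also have "\<dots> \<le> E (lg (1 + x))" using ab assms by (simp add: r_def)
    finally show "lb (b + a) - lb b \<le> lg (1 + x)" by (simp add: E_le_iff)
    show "0 \<le> lb (b + a) - lb b" using lb_mono[of b "b + a"] ab a by simp
  qed (use pq assms in auto)
  finally have "E (lb (b * q + a * p) - lb (b * q)) \<le> Q" unfolding Q_def by (rule E_mono)
  moreover have "E (lb (b * q + a * p) - lb (b * q)) = 1 + r * (\<iota> p / \<iota> q)"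
    using pos ab pq by (simp add: E_diff_lb r_def field_simps)
  ultimately show False using pq(4) by simp
qed

end

section \<open>Transport to sets of pairs\<close>

context complete_extension
begin

definition cut :: "'k \<Rightarrow> ('a \<times> 'a) set" where
  "cut x = {(a, b). 0 < b \<and> \<iota> a / \<iota> b < x}"

definition uncut :: "('a \<times> 'a) set \<Rightarrow> 'k" where
  "uncut = inv_into UNIV cut"

lemma inj_cut: "inj cut"
proof (rule injI, rule ccontr)
  fix x y assume eq: "cut x = cut y" and "x \<noteq> y"
  have *: False if "x < y" "cut x = cut y" for x y
  proof -
    obtain a b where "0 < b" "x < \<iota> a / \<iota> b" "\<iota> a / \<iota> b < y"
      using fraction_dense[OF \<open>x < y\<close>] by blast
    then have "(a, b) \<in> cut y" "(a, b) \<notin> cut x" by (auto simp: cut_def)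
    with that show False by simp
  qed
  show False using *[of x y] *[of y x] eq \<open>x \<noteq> y\<close> by fastforce
qed

lemma uncut_cut [simp]: "uncut (cut x) = x"
  by (simp add: uncut_def inj_cut)

lemma cut_eq_iff [simp]: "cut x = cut y \<longleftrightarrow> x = y"
  using inj_cut by (auto dest: injD)

definition cut_field :: "('a \<times> 'a) set ordered_ring" where
  "cut_field = \<lparr>carrier = range cut, monoid.mult = (\<lambda>u v. cut (uncut u * uncut v)), one = cut 1,
     ring.zero = cut 0, ring.add = (\<lambda>u v. cut (uncut u + uncut v)), ring_le = (\<lambda>u v. uncut u \<le> uncut v)\<rparr>"

lemma cut_field_simps [simp]:
  "carrier cut_field = range cut"
  "\<one>\<^bsub>cut_field\<^esub> = cut 1" "\<zero>\<^bsub>cut_field\<^esub> = cut 0"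
  "cut x \<otimes>\<^bsub>cut_field\<^esub> cut y = cut (x * y)"
  "cut x \<oplus>\<^bsub>cut_field\<^esub> cut y = cut (x + y)"
  "cut x \<preceq>\<^bsub>cut_field\<^esub> cut y \<longleftrightarrow> x \<le> y"
  "cut x \<prec>\<^bsub>cut_field\<^esub> cut y \<longleftrightarrow> x < y"
  by (auto simp: cut_field_def ring_less_def)

lemma cring_cut_field: "cring cut_field"
proof (intro cringI abelian_groupI comm_monoidI)
  fix x assume "x \<in> carrier cut_field"
  then obtain y where "x = cut y" by auto
  then show "\<exists>y\<in>carrier cut_field. y \<oplus>\<^bsub>cut_field\<^esub> x = \<zero>\<^bsub>cut_field\<^esub>"
    by (intro bexI[of _ "cut (- y)"]) auto
qed (auto simp: algebra_simps)

lemma linearly_ordered_field_cut_field: "linearly_ordered_field cut_field"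
proof -
  interpret cring cut_field by (rule cring_cut_field)
  have "Units cut_field = carrier cut_field - {\<zero>\<^bsub>cut_field\<^esub>}"
  proof (intro subset_antisym subsetI)
    fix x assume "x \<in> carrier cut_field - {\<zero>\<^bsub>cut_field\<^esub>}"
    then obtain y where "x = cut y" "y \<noteq> 0" by auto
    then show "x \<in> Units cut_field"
      by (auto simp: Units_def intro!: exI[of _ "inverse y"])
  qed (auto simp: Units_def)
  then interpret field cut_field by (rule cring_fieldI)
  show ?thesis
    by unfold_locales auto
qed

lemma real_closed_field_cut_field:
  assumes "real_closed_subfield (UNIV :: 'k set)"
  shows "real_closed_field cut_field"
proof -
  interpret F: linearly_ordered_field cut_field by (rule linearly_ordered_field_cut_field)
  interpret S: real_closed_subfield "UNIV :: 'k set" by (rule assms)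
  show ?thesis
  proof
    fix x assume "x \<in> carrier cut_field" "\<zero>\<^bsub>cut_field\<^esub> \<preceq>\<^bsub>cut_field\<^esub> x"
    then obtain y where y: "x = cut y" "0 \<le> y" by auto
    then obtain z where "z * z = y" using S.sqrt_exists by auto
    then show "\<exists>y\<in>carrier cut_field. y \<otimes>\<^bsub>cut_field\<^esub> y = x"
      using y by (intro bexI[of _ "cut z"]) auto
  next
    fix p assume p: "polynomial\<^bsub>cut_field\<^esub> (carrier cut_field) p" "odd (Polynomials.degree p)"
    then have ne: "p \<noteq> []" by auto
    have set_p: "set p \<subseteq> carrier cut_field" and hd: "hd p \<noteq> \<zero>\<^bsub>cut_field\<^esub>"
      using p(1) ne by (auto simp: polynomial_def)
    define q where "q = Poly (rev (map uncut p))"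
    obtain y where "hd p = cut y" using set_p hd_in_set[OF ne] by auto
    then have "uncut (hd p) \<noteq> 0" using hd by simp
    \<comment> \<open>The leading coefficient is nonzero, so \<open>Poly\<close> strips nothing and
      the degree is preserved.\<close>
    then have "coeffs q = rev (map uncut p)"
      by (cases p) (auto simp: q_def)
    then have "Polynomial.degree q = length p - 1"
      by (simp add: degree_eq_length_coeffs)
    then obtain x where x: "poly q x = 0"
      using S.odd_root_exists[of q] p(2) by (auto simp: poly_over_def)
    have "uncut (F.eval p (cut x)) = poly q (uncut (cut x))"
      unfolding q_def by (rule F.eval_hom) (use set_p in auto)
    then have "uncut (F.eval p (cut x)) = 0" using x by simp
    moreover have "F.eval p (cut x) \<in> carrier cut_field"
      using set_p by (intro F.eval_in_carrier) simp_all
    then obtain y where y: "F.eval p (cut x) = cut y" unfolding cut_field_simps by blast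
    ultimately have "F.eval p (cut x) = \<zero>\<^bsub>cut_field\<^esub>" unfolding y by simp
    then show "\<exists>x\<in>carrier cut_field. F.eval p x = \<zero>\<^bsub>cut_field\<^esub>"
      by (rule bexI) simp
  qed
qed

end

context txy_extension
begin

definition cut_exp :: "('a \<times> 'a) set \<Rightarrow> ('a \<times> 'a) set" where
  "cut_exp u = cut (E (uncut u))"

lemma positives_cut_field: "positives cut_field = cut ` {0<..}"
  by (auto simp: positives_def)

lemma exponential_field_cut_field: "exponential_field cut_field cut_exp"
proof -
  interpret linearly_ordered_field cut_field by (rule linearly_ordered_field_cut_field)
  show ?thesis
  proof
    show "bij_betw cut_exp (carrier cut_field) (positives cut_field)"
      unfolding bij_betw_def
    proof
      show "inj_on cut_exp (carrier cut_field)"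
        using E_inj by (auto simp: inj_on_def cut_exp_def)
      have "cut_exp ` carrier cut_field = cut ` range E"
        by (auto simp: cut_exp_def image_iff)
      then show "cut_exp ` carrier cut_field = positives cut_field"
        by (simp add: range_E positives_cut_field)
    qed
  qed (auto simp: cut_exp_def E_add E_mono)
qed

lemma log_cut: "0 < x \<Longrightarrow> exp_field_log cut_field cut_exp (cut x) = cut (lg x)"
  unfolding exp_field_log_def
  using E_inj by (intro inv_into_f_eq) (auto simp: inj_on_def cut_exp_def)

lemma power_cut: "0 < x \<Longrightarrow> exp_field_power cut_field cut_exp (cut x) (cut y) = cut (E (y * lg x))"
  by (simp add: exp_field_power_def log_cut cut_exp_def)

lemma xy_integer_part_cut_field: "xy_integer_part cut_field cut_exp pw (\<lambda>a. cut (\<iota> a))"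
  unfolding xy_integer_part_def integer_part_def ordered_ring_embedding_def
proof (intro conjI allI impI ballI)
  fix r assume "r \<in> carrier cut_field"
  then obtain x where "r = cut x" by auto
  then show "\<exists>m. cut (\<iota> m) \<preceq>\<^bsub>cut_field\<^esub> r \<and> r \<prec>\<^bsub>cut_field\<^esub> cut (\<iota> (m + 1))"
    using floor[of x] by simp
next
  fix n m :: 'a assume "0 < n" "0 \<le> m"
  then show "cut (\<iota> (pw n m)) = exp_field_power cut_field cut_exp (cut (\<iota> n)) (cut (\<iota> m))"
    by (simp add: power_cut pw_conv_E)
qed (simp_all add: pw_0_right pw_0_left)

lemma Bernoulli_inequality_cut_field: "Bernoulli_inequality cut_field cut_exp"
  unfolding Bernoulli_inequality_def by (auto simp: power_cut bernoulli add_pos_pos)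

end

section \<open>From models to exponential fields, and the equivalence\<close>

theorem models_imp_exponential_field:
  fixes pw :: "'a::discretely_ordered_ring \<Rightarrow> 'a \<Rightarrow> 'a"
  assumes pw: "\<forall>x y. 0 \<le> x \<longrightarrow> 0 \<le> y \<longrightarrow> 0 \<le> pw x y"
    and iopen: "IOpen_model (nonneg_part pw)" and txy: "T_xy_model (nonneg_part pw)"
  shows "\<exists>(R :: ('a \<times> 'a) set ordered_ring) E \<iota>. exponential_field R E \<and> xy_integer_part R E pw \<iota> \<and>
    real_closed_field R \<and> Bernoulli_inequality R E"
proof -
  interpret T: T_xy_model "nonneg_part pw" by (rule txy)
  note T = T.T1 T.T2 T.T3 T.T4 T.T5 T.T6 T.T7 T.T8 T.T9 T.T10 T.T11
  note T' = T[unfolded nonneg_part_simps Ball_def Bex_def mem_Collect_eq add_0_left one_add_one]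
  interpret txy_extension "\<lambda>x :: 'a. of_base (to_fract x)" pw
  proof (unfold_locales, goal_cases)
    case 1
    then show ?case by (rule open_sign_change[OF iopen])
  next
    case (9 x y z)
    then show ?case using T'(7)[rule_format, of x y z] less_trans[OF zero_less_one, of x] by simp
  next
    case (10 x y z)
    then show ?case using T'(8)[rule_format, of x y z] by simp
  next
    case (11 k)
    then show ?case using T'(9)[rule_format, of k] by simp
  next
    case (12 x c)
    then show ?case using T'(10)[rule_format, of x c] by simp
  next
    case (13 a b y x)
    then show ?case using T'(11)[rule_format, of a b y x] by simp
  qed (use pw T'(1-6) in \<open>simp_all\<close>)
  show ?thesis
    using exponential_field_cut_field xy_integer_part_cut_field
      fract_completion.real_closed_field_cut_field[OF real_closed] Bernoulli_inequality_cut_field by blast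
qed

theorem theorem2p6:
  fixes pw :: "'a::discretely_ordered_ring \<Rightarrow> 'a \<Rightarrow> 'a"
  assumes "\<forall>x y. 0 \<le> x \<longrightarrow> 0 \<le> y \<longrightarrow> 0 \<le> pw x y"
  shows "((IOpen_model (nonneg_part pw) \<and> T_xy_model (nonneg_part pw)) \<longleftrightarrow>
           (\<exists>(R :: ('a \<times> 'a) set ordered_ring) E \<iota>.
              exponential_field R E \<and> xy_integer_part R E pw \<iota> \<and>
              real_closed_field R \<and> Bernoulli_inequality R E)) \<and>
         ((\<exists>(R :: 'r ordered_ring) E \<iota>.
              exponential_field R E \<and> xy_integer_part R E pw \<iota> \<and>
              real_closed_field R \<and> Bernoulli_inequality R E) \<longrightarrow>
           (IOpen_model (nonneg_part pw) \<and> T_xy_model (nonneg_part pw)))"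
  proof (intro conjI iffI impI)
  assume "IOpen_model (nonneg_part pw) \<and> T_xy_model (nonneg_part pw)"
  then show "\<exists>(R :: ('a \<times> 'a) set ordered_ring) E \<iota>. exponential_field R E \<and>
      xy_integer_part R E pw \<iota> \<and> real_closed_field R \<and> Bernoulli_inequality R E"
    using models_imp_exponential_field[OF assms] by blast
qed (blast intro: exponential_field_imp_models)+

end
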